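(* Let $\Sigma$ be a small category and let $\mathcal{A}$ be a $\Sigma$-co-complete abelian category. Then the following conditions are equivalent: (a) the functor $\mathrm{colim}_{\Sigma}:\mathrm{Fun}(\Sigma,\mathcal{A})\to\mathcal{A}$ is exact; (b) the map $\Psi^{\Sigma}_{F,A}:\mathrm{Ext}^1_{\mathcal{A}}(C_F,A)\to\mathrm{Ext}^1_{\mathrm{Fun}(\Sigma,\mathcal{A})}(F,\kappa^{\Sigma}(A))$ is bijective for every $F\in\mathrm{Fun}(\Sigma,\mathcal{A})$ and every object $A$ of $\mathcal{A}$; (c) the bifunctors $\mathrm{Ext}^1_{\mathcal{A}}(\mathrm{colim}_{\Sigma}(?),-)$ and $\mathrm{Ext}^1_{\mathrm{Fun}(\Sigma,\mathcal{A})}(?,\kappa^{\Sigma}(-))$ are naturally isomorphic in the obvious way, i.e. via the maps $\Psi^{\Sigma}_{?,-}$.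
   Context: A category is called small when the isomorphism classes of its objects form a set. $\mathrm{Fun}(\Sigma,\mathcal{A})$ is the abelian category of functors $\Sigma\to\mathcal{A}$ with natural transformations (exactness computed objectwise). $\mathcal{A}$ is $\Sigma$-co-complete if every functor $\Sigma\to\mathcal{A}$ has a colimit in $\mathcal{A}$. For $F\in\mathrm{Fun}(\Sigma,\mathcal{A})$ write $C_F:=\mathrm{colim}_{\Sigma}(F)$, with universal natural transformation $\rho^F:F\to\kappa^{\Sigma}(C_F)$, where $\kappa^{\Sigma}:\mathcal{A}\to\mathrm{Fun}(\Sigma,\mathcal{A})$ is the constant diagram functor ($\kappa^{\Sigma}(A)$ sends every object to $A$ and every morphism to $1_A$), which is exact. For an abelian category $\mathcal{X}$ and $X,Y\in\mathcal{X}$, $\mathrm{Ext}^1_{\mathcal{X}}(X,Y)$ denotes the (possibly "big", i.e. class-sized) Yoneda group of equivalence classes $\overline{\epsilon}$ of short exact sequences $\epsilon: 0\to Y\to E\to X\to0$; it is functorial via pullback along morphisms $X'\to X$ (written $\overline{\epsilon}\cdot f$) and pushout along morphisms $Y\to Y'$ (written $f\cdot\overline{\epsilon}$). Definition of $\Psi$: for a short exact sequence $\epsilon:0\to A\to B\to C_F\to0$ in $\mathcal{A}$, $\Psi^{\Sigma}_{F,A}(\overline{\epsilon})$ is the class of the short exact sequence $0\to\kappa^{\Sigma}(A)\to G\to F\to0$ obtained from $\kappa^{\Sigma}(\epsilon):0\to\kappa^{\Sigma}(A)\to\kappa^{\Sigma}(B)\to\kappa^{\Sigma}(C_F)\to0$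 by pullback along $\rho^F:F\to\kappa^{\Sigma}(C_F)$. These maps are natural in $A$ and in $F$. *)

theory Defs
  imports "HOL-Algebra.Group"
begin

section \<open>Abelian categories\<close>

record ('o, 'a) cat =
  Obj :: "'o set"
  Arr :: "'a set"
  Dom :: "'a \<Rightarrow> 'o"
  Cod :: "'a \<Rightarrow> 'o"
  Ident :: "'o \<Rightarrow> 'a"
  Comp :: "'a \<Rightarrow> 'a \<Rightarrow> 'a" (infixr "\<cdot>\<index>" 70)

definition Hom :: "('o, 'a, 'm) cat_scheme \<Rightarrow> 'o \<Rightarrow> 'o \<Rightarrow> 'a set" where
  "Hom C x y = {f \<in> Arr C. Dom C f = x \<and> Cod C f = y}"

text \<open>
  Composition is written in applicative order: \<open>g \<cdot> f\<close> is \<open>g\<close> after \<open>f\<close>.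
\<close>

locale category =
  fixes C :: "('o, 'a, 'm) cat_scheme" (structure)
  assumes Dom_in: "f \<in> Arr C \<Longrightarrow> Dom C f \<in> Obj C"
    and Cod_in: "f \<in> Arr C \<Longrightarrow> Cod C f \<in> Obj C"
    and Ident_in: "x \<in> Obj C \<Longrightarrow> Ident C x \<in> Hom C x x"
    and Comp_in: "f \<in> Hom C x y \<Longrightarrow> g \<in> Hom C y z \<Longrightarrow> g \<cdot> f \<in> Hom C x z"
    and Comp_Ident: "f \<in> Hom C x y \<Longrightarrow> f \<cdot> Ident C x = f"
    and Ident_Comp: "f \<in> Hom C x y \<Longrightarrow> Ident C y \<cdot> f = f"
    and Comp_assoc: "f \<in> Hom C w x \<Longrightarrow> g \<in> Hom C x y \<Longrightarrow> h \<in> Hom C y z \<Longrightarrow>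
      (h \<cdot> g) \<cdot> f = h \<cdot> (g \<cdot> f)"

record ('o, 'a) addcat = "('o, 'a) cat" +
  Add :: "'a \<Rightarrow> 'a \<Rightarrow> 'a" (infixl "\<boxplus>\<index>" 65)
  Zero :: "'o \<Rightarrow> 'o \<Rightarrow> 'a"

locale preadditive_category = category C
  for C :: "('o, 'a, 'm) addcat_scheme" (structure) +
  assumes Hom_group: "x \<in> Obj C \<Longrightarrow> y \<in> Obj C \<Longrightarrow>
      comm_group \<lparr>carrier = Hom C x y, mult = Add C, one = Zero C x y\<rparr>"
    and Comp_Add: "f \<in> Hom C x y \<Longrightarrow> f' \<in> Hom C x y \<Longrightarrow> g \<in> Hom C y z \<Longrightarrow>
      g \<cdot> (f \<boxplus> f') = (g \<cdot> f) \<boxplus> (g \<cdot> f')"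
    and Add_Comp: "f \<in> Hom C x y \<Longrightarrow> g \<in> Hom C y z \<Longrightarrow> g' \<in> Hom C y z \<Longrightarrow>
      (g \<boxplus> g') \<cdot> f = (g \<cdot> f) \<boxplus> (g' \<cdot> f)"

definition is_zero_object :: "('o, 'a, 'm) cat_scheme \<Rightarrow> 'o \<Rightarrow> bool" where
  "is_zero_object C z \<longleftrightarrow>
     z \<in> Obj C \<and> (\<forall>x\<in>Obj C. (\<exists>!f. f \<in> Hom C x z) \<and> (\<exists>!f. f \<in> Hom C z x))"

definition is_biproduct ::
  "('o, 'a, 'm) addcat_scheme \<Rightarrow> 'o \<Rightarrow> 'o \<Rightarrow> 'a \<Rightarrow> 'a \<Rightarrow> 'a \<Rightarrow> 'a \<Rightarrow> bool" where
  "is_biproduct C x y i j p q \<longleftrightarrow> (\<exists>b\<in>Obj C.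
     i \<in> Hom C x b \<and> j \<in> Hom C y b \<and> p \<in> Hom C b x \<and> q \<in> Hom C b y \<and>
     p \<cdot>\<^bsub>C\<^esub> i = Ident C x \<and> q \<cdot>\<^bsub>C\<^esub> j = Ident C y \<and>
     q \<cdot>\<^bsub>C\<^esub> i = Zero C x y \<and> p \<cdot>\<^bsub>C\<^esub> j = Zero C y x \<and>
     (i \<cdot>\<^bsub>C\<^esub> p) \<boxplus>\<^bsub>C\<^esub> (j \<cdot>\<^bsub>C\<^esub> q) = Ident C b)"

definition is_kernel :: "('o, 'a, 'm) addcat_scheme \<Rightarrow> 'a \<Rightarrow> 'a \<Rightarrow> bool" where
  "is_kernel C f k \<longleftrightarrow>
     f \<in> Arr C \<and> k \<in> Arr C \<and> Cod C k = Dom C f \<and>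
     f \<cdot>\<^bsub>C\<^esub> k = Zero C (Dom C k) (Cod C f) \<and>
     (\<forall>h\<in>Arr C. Cod C h = Dom C f \<and> f \<cdot>\<^bsub>C\<^esub> h = Zero C (Dom C h) (Cod C f) \<longrightarrow>
        (\<exists>!u. u \<in> Hom C (Dom C h) (Dom C k) \<and> k \<cdot>\<^bsub>C\<^esub> u = h))"

definition is_cokernel :: "('o, 'a, 'm) addcat_scheme \<Rightarrow> 'a \<Rightarrow> 'a \<Rightarrow> bool" where
  "is_cokernel C f q \<longleftrightarrow>
     f \<in> Arr C \<and> q \<in> Arr C \<and> Dom C q = Cod C f \<and>
     q \<cdot>\<^bsub>C\<^esub> f = Zero C (Dom C f) (Cod C q) \<and>
     (\<forall>h\<in>Arr C. Dom C h = Cod C f \<and> h \<cdot>\<^bsub>C\<^esub> f = Zero C (Dom C f) (Cod C h) \<longrightarrow>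
        (\<exists>!u. u \<in> Hom C (Cod C q) (Cod C h) \<and> u \<cdot>\<^bsub>C\<^esub> q = h))"

definition is_mono :: "('o, 'a, 'm) cat_scheme \<Rightarrow> 'a \<Rightarrow> bool" where
  "is_mono C m \<longleftrightarrow> m \<in> Arr C \<and>
     (\<forall>w. \<forall>f\<in>Hom C w (Dom C m). \<forall>g\<in>Hom C w (Dom C m). m \<cdot>\<^bsub>C\<^esub> f = m \<cdot>\<^bsub>C\<^esub> g \<longrightarrow> f = g)"

definition is_epi :: "('o, 'a, 'm) cat_scheme \<Rightarrow> 'a \<Rightarrow> bool" where
  "is_epi C e \<longleftrightarrow> e \<in> Arr C \<and>
     (\<forall>w. \<forall>f\<in>Hom C (Cod C e) w. \<forall>g\<in>Hom C (Cod C e) w. f \<cdot>\<^bsub>C\<^esub> e = g \<cdot>\<^bsub>C\<^esub> e \<longrightarrow> f = g)"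

locale abelian_category = preadditive_category C
  for C :: "('o, 'a, 'm) addcat_scheme" (structure) +
  assumes zero_object: "\<exists>z. is_zero_object C z"
    and biproducts: "x \<in> Obj C \<Longrightarrow> y \<in> Obj C \<Longrightarrow> \<exists>i j p q. is_biproduct C x y i j p q"
    and kernels: "f \<in> Arr C \<Longrightarrow> \<exists>k. is_kernel C f k"
    and cokernels: "f \<in> Arr C \<Longrightarrow> \<exists>q. is_cokernel C f q"
    and mono_normal: "is_mono C m \<Longrightarrow> \<exists>f. is_kernel C f m"
    and epi_normal: "is_epi C e \<Longrightarrow> \<exists>f. is_cokernel C f e"

definition short_exact :: "('o, 'a, 'm) addcat_scheme \<Rightarrow> 'a \<Rightarrow> 'a \<Rightarrow> bool" where
  "short_exact C i p \<longleftrightarrow> is_kernel C p i \<and> is_cokernel C i p"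

section \<open>Functors and functor categories\<close>

record ('o1, 'a1, 'o2, 'a2) func =
  FOb :: "'o1 \<Rightarrow> 'o2"
  FAr :: "'a1 \<Rightarrow> 'a2"

record ('o1, 'a1, 'o2, 'a2) ntrans =
  NDom :: "('o1, 'a1, 'o2, 'a2) func"
  NCod :: "('o1, 'a1, 'o2, 'a2) func"
  NAt :: "'o1 \<Rightarrow> 'a2"

text \<open>
  Functors and natural transformations are required to be \<^const>\<open>undefined\<close> off the objects and
  arrows of their source, so that equality of HOL values is equality of functors and of
  transformations.
\<close>

definition functors ::
  "('o1, 'a1, 'm) cat_scheme \<Rightarrow> ('o2, 'a2, 'n) cat_scheme \<Rightarrow> ('o1, 'a1, 'o2, 'a2) func set" where
  "functors C D = {F.
     FOb F \<in> Obj C \<rightarrow>\<^sub>E Obj D \<and> FAr F \<in> Arr C \<rightarrow>\<^sub>E Arr D \<and>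
     (\<forall>f\<in>Arr C. FAr F f \<in> Hom D (FOb F (Dom C f)) (FOb F (Cod C f))) \<and>
     (\<forall>x\<in>Obj C. FAr F (Ident C x) = Ident D (FOb F x)) \<and>
     (\<forall>f\<in>Arr C. \<forall>g\<in>Arr C. Cod C f = Dom C g \<longrightarrow>
        FAr F (g \<cdot>\<^bsub>C\<^esub> f) = FAr F g \<cdot>\<^bsub>D\<^esub> FAr F f)}"

definition nat_transes ::
  "('o1, 'a1, 'm) cat_scheme \<Rightarrow> ('o2, 'a2, 'n) cat_scheme \<Rightarrow> ('o1, 'a1, 'o2, 'a2) ntrans set" where
  "nat_transes C D = {\<eta>.
     NDom \<eta> \<in> functors C D \<and> NCod \<eta> \<in> functors C D \<and> NAt \<eta> \<in> extensional (Obj C) \<and>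
     (\<forall>x\<in>Obj C. NAt \<eta> x \<in> Hom D (FOb (NDom \<eta>) x) (FOb (NCod \<eta>) x)) \<and>
     (\<forall>f\<in>Arr C. FAr (NCod \<eta>) f \<cdot>\<^bsub>D\<^esub> NAt \<eta> (Dom C f) = NAt \<eta> (Cod C f) \<cdot>\<^bsub>D\<^esub> FAr (NDom \<eta>) f)}"

definition fun_cat ::
  "('s, 't, 'm) cat_scheme \<Rightarrow> ('o, 'a, 'n) addcat_scheme \<Rightarrow>
   (('s, 't, 'o, 'a) func, ('s, 't, 'o, 'a) ntrans) addcat" where
  "fun_cat S A = \<lparr>
     Obj = functors S A,
     Arr = nat_transes S A,
     Dom = NDom,
     Cod = NCod,
     Ident = (\<lambda>F. \<lparr>NDom = F, NCod = F, NAt = (\<lambda>x\<in>Obj S. Ident A (FOb F x))\<rparr>),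
     Comp = (\<lambda>\<theta> \<eta>. \<lparr>NDom = NDom \<eta>, NCod = NCod \<theta>, NAt = (\<lambda>x\<in>Obj S. NAt \<theta> x \<cdot>\<^bsub>A\<^esub> NAt \<eta> x)\<rparr>),
     Add = (\<lambda>\<eta> \<theta>. \<lparr>NDom = NDom \<eta>, NCod = NCod \<eta>, NAt = (\<lambda>x\<in>Obj S. NAt \<eta> x \<boxplus>\<^bsub>A\<^esub> NAt \<theta> x)\<rparr>),
     Zero = (\<lambda>F G. \<lparr>NDom = F, NCod = G, NAt = (\<lambda>x\<in>Obj S. Zero A (FOb F x) (FOb G x))\<rparr>)\<rparr>"

definition exact_functor ::
  "('o1, 'a1, 'm) addcat_scheme \<Rightarrow> ('o2, 'a2, 'n) addcat_scheme \<Rightarrow>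
   ('o1, 'a1, 'o2, 'a2) func \<Rightarrow> bool" where
  "exact_functor C D F \<longleftrightarrow>
     F \<in> functors C D \<and>
     (\<forall>x\<in>Obj C. \<forall>y\<in>Obj C. \<forall>f\<in>Hom C x y. \<forall>g\<in>Hom C x y.
        FAr F (f \<boxplus>\<^bsub>C\<^esub> g) = FAr F f \<boxplus>\<^bsub>D\<^esub> FAr F g) \<and>
     (\<forall>i p. short_exact C i p \<longrightarrow> short_exact D (FAr F i) (FAr F p))"

section \<open>Constant diagrams and colimits\<close>

definition const_ob ::
  "('s, 't, 'm) cat_scheme \<Rightarrow> ('o, 'a, 'n) addcat_scheme \<Rightarrow> 'o \<Rightarrow> ('s, 't, 'o, 'a) func" where
  "const_ob S A a = \<lparr>FOb = (\<lambda>x\<in>Obj S. a), FAr = (\<lambda>f\<in>Arr S. Ident A a)\<rparr>"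

definition const_ar ::
  "('s, 't, 'm) cat_scheme \<Rightarrow> ('o, 'a, 'n) addcat_scheme \<Rightarrow> 'a \<Rightarrow> ('s, 't, 'o, 'a) ntrans" where
  "const_ar S A f =
     \<lparr>NDom = const_ob S A (Dom A f), NCod = const_ob S A (Cod A f), NAt = (\<lambda>x\<in>Obj S. f)\<rparr>"

definition is_colimit ::
  "('s, 't, 'm) cat_scheme \<Rightarrow> ('o, 'a, 'n) addcat_scheme \<Rightarrow> ('s, 't, 'o, 'a) func \<Rightarrow>
   'o \<Rightarrow> ('s, 't, 'o, 'a) ntrans \<Rightarrow> bool" where
  "is_colimit S A F c \<rho> \<longleftrightarrow>
     c \<in> Obj A \<and> \<rho> \<in> Hom (fun_cat S A) F (const_ob S A c) \<and>
     (\<forall>d\<in>Obj A. \<forall>\<sigma>\<in>Hom (fun_cat S A) F (const_ob S A d).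
        \<exists>!u. u \<in> Hom A c d \<and> const_ar S A u \<cdot>\<^bsub>fun_cat S A\<^esub> \<rho> = \<sigma>)"

definition cocomplete ::
  "('s, 't, 'm) cat_scheme \<Rightarrow> ('o, 'a, 'n) addcat_scheme \<Rightarrow> bool" where
  "cocomplete S A \<longleftrightarrow> (\<forall>F\<in>functors S A. \<exists>c \<rho>. is_colimit S A F c \<rho>)"

definition colim_cocone ::
  "('s, 't, 'm) cat_scheme \<Rightarrow> ('o, 'a, 'n) addcat_scheme \<Rightarrow> ('s, 't, 'o, 'a) func \<Rightarrow>
   'o \<times> ('s, 't, 'o, 'a) ntrans" where
  "colim_cocone S A F = (SOME (c, \<rho>). is_colimit S A F c \<rho>)"

definition colim_ob ::
  "('s, 't, 'm) cat_scheme \<Rightarrow> ('o, 'a, 'n) addcat_scheme \<Rightarrow> ('s, 't, 'o, 'a) func \<Rightarrow> 'o" where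
  "colim_ob S A F = fst (colim_cocone S A F)"

definition colim_in ::
  "('s, 't, 'm) cat_scheme \<Rightarrow> ('o, 'a, 'n) addcat_scheme \<Rightarrow> ('s, 't, 'o, 'a) func \<Rightarrow>
   ('s, 't, 'o, 'a) ntrans" where
  "colim_in S A F = snd (colim_cocone S A F)"

definition colim_ar ::
  "('s, 't, 'm) cat_scheme \<Rightarrow> ('o, 'a, 'n) addcat_scheme \<Rightarrow> ('s, 't, 'o, 'a) ntrans \<Rightarrow> 'a" where
  "colim_ar S A \<eta> = (THE u.
     u \<in> Hom A (colim_ob S A (NDom \<eta>)) (colim_ob S A (NCod \<eta>)) \<and>
     const_ar S A u \<cdot>\<^bsub>fun_cat S A\<^esub> colim_in S A (NDom \<eta>) =
       colim_in S A (NCod \<eta>) \<cdot>\<^bsub>fun_cat S A\<^esub> \<eta>)"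

definition colim_functor ::
  "('s, 't, 'm) cat_scheme \<Rightarrow> ('o, 'a, 'n) addcat_scheme \<Rightarrow>
   (('s, 't, 'o, 'a) func, ('s, 't, 'o, 'a) ntrans, 'o, 'a) func" where
  "colim_functor S A =
     \<lparr>FOb = (\<lambda>F\<in>functors S A. colim_ob S A F), FAr = (\<lambda>\<eta>\<in>nat_transes S A. colim_ar S A \<eta>)\<rparr>"

section \<open>Yoneda extension groups\<close>

text \<open>
  An extension \<open>0 \<rightarrow> Y \<rightarrow> E \<rightarrow> X \<rightarrow> 0\<close> is encoded by its two nontrivial arrows \<open>(i, p)\<close>.
\<close>

definition extensions :: "('o, 'a, 'm) addcat_scheme \<Rightarrow> 'o \<Rightarrow> 'o \<Rightarrow> ('a \<times> 'a) set" where
  "extensions C X Y = {(i, p). short_exact C i p \<and> Dom C i = Y \<and> Cod C p = X}"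

definition is_iso :: "('o, 'a, 'm) cat_scheme \<Rightarrow> 'a \<Rightarrow> bool" where
  "is_iso C h \<longleftrightarrow> h \<in> Arr C \<and>
     (\<exists>k\<in>Hom C (Cod C h) (Dom C h). k \<cdot>\<^bsub>C\<^esub> h = Ident C (Dom C h) \<and> h \<cdot>\<^bsub>C\<^esub> k = Ident C (Cod C h))"

definition ext_rel :: "('o, 'a, 'm) addcat_scheme \<Rightarrow> (('a \<times> 'a) \<times> ('a \<times> 'a)) set" where
  "ext_rel C = {((i, p), (i', p')).
     short_exact C i p \<and> short_exact C i' p' \<and> Dom C i = Dom C i' \<and> Cod C p = Cod C p' \<and>
     (\<exists>h\<in>Hom C (Cod C i) (Cod C i'). is_iso C h \<and> h \<cdot>\<^bsub>C\<^esub> i = i' \<and> p' \<cdot>\<^bsub>C\<^esub> h = p)}"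

definition ext_class :: "('o, 'a, 'm) addcat_scheme \<Rightarrow> 'a \<times> 'a \<Rightarrow> ('a \<times> 'a) set" where
  "ext_class C \<epsilon> = ext_rel C `` {\<epsilon>}"

definition is_pullback ::
  "('o, 'a, 'm) cat_scheme \<Rightarrow> 'a \<Rightarrow> 'a \<Rightarrow> 'a \<Rightarrow> 'a \<Rightarrow> bool" where
  "is_pullback C p f g q \<longleftrightarrow>
     p \<in> Arr C \<and> f \<in> Arr C \<and> g \<in> Arr C \<and> q \<in> Arr C \<and>
     Cod C p = Cod C f \<and> Dom C g = Dom C q \<and> Cod C g = Dom C p \<and> Cod C q = Dom C f \<and>
     p \<cdot>\<^bsub>C\<^esub> g = f \<cdot>\<^bsub>C\<^esub> q \<and>
     (\<forall>w. \<forall>r\<in>Hom C w (Dom C p). \<forall>s\<in>Hom C w (Dom C f). p \<cdot>\<^bsub>C\<^esub> r = f \<cdot>\<^bsub>C\<^esub> s \<longrightarrow>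
        (\<exists>!u. u \<in> Hom C w (Dom C g) \<and> g \<cdot>\<^bsub>C\<^esub> u = r \<and> q \<cdot>\<^bsub>C\<^esub> u = s))"

definition is_pushout ::
  "('o, 'a, 'm) cat_scheme \<Rightarrow> 'a \<Rightarrow> 'a \<Rightarrow> 'a \<Rightarrow> 'a \<Rightarrow> bool" where
  "is_pushout C i f g j \<longleftrightarrow>
     i \<in> Arr C \<and> f \<in> Arr C \<and> g \<in> Arr C \<and> j \<in> Arr C \<and>
     Dom C i = Dom C f \<and> Cod C g = Cod C j \<and> Dom C g = Cod C i \<and> Dom C j = Cod C f \<and>
     g \<cdot>\<^bsub>C\<^esub> i = j \<cdot>\<^bsub>C\<^esub> f \<and>
     (\<forall>w. \<forall>r\<in>Hom C (Cod C i) w. \<forall>s\<in>Hom C (Cod C f) w. r \<cdot>\<^bsub>C\<^esub> i = s \<cdot>\<^bsub>C\<^esub> f \<longrightarrow>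
        (\<exists>!u. u \<in> Hom C (Cod C g) w \<and> u \<cdot>\<^bsub>C\<^esub> g = r \<and> u \<cdot>\<^bsub>C\<^esub> j = s))"

text \<open>
  \<open>pullback_ext C f \<epsilon> \<epsilon>'\<close>: there is a commutative diagram with exact rows and right square a pullback
  \<open>
    \<epsilon>' :  0 \<rightarrow> Y \<rightarrow>i' E' \<rightarrow>p' X' \<rightarrow> 0
               =      g\<down>     f\<down>
    \<epsilon>  :  0 \<rightarrow> Y \<rightarrow>i  E  \<rightarrow>p  X  \<rightarrow> 0
  \<close>
  and dually for \<open>pushout_ext C f \<epsilon> \<epsilon>'\<close>, where \<open>f\<close> starts at \<open>Y\<close> and the left square is a pushout.
\<close>

definition pullback_ext ::
  "('o, 'a, 'm) addcat_scheme \<Rightarrow> 'a \<Rightarrow> 'a \<times> 'a \<Rightarrow> 'a \<times> 'a \<Rightarrow> bool" where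
  "pullback_ext C f = (\<lambda>(i, p) (i', p').
     short_exact C i p \<and> short_exact C i' p' \<and> Dom C i' = Dom C i \<and>
     (\<exists>g. is_pullback C p f g p' \<and> g \<cdot>\<^bsub>C\<^esub> i' = i))"

definition pushout_ext ::
  "('o, 'a, 'm) addcat_scheme \<Rightarrow> 'a \<Rightarrow> 'a \<times> 'a \<Rightarrow> 'a \<times> 'a \<Rightarrow> bool" where
  "pushout_ext C f = (\<lambda>(i, p) (i', p').
     short_exact C i p \<and> short_exact C i' p' \<and> Cod C p' = Cod C p \<and>
     (\<exists>g. is_pushout C i f g i' \<and> p' \<cdot>\<^bsub>C\<^esub> g = p))"

text \<open>
  Operations on classes are defined as unions, over all representatives \<open>\<epsilon>\<close> of the given class, of
  the classes of the extensions constructed from \<open>\<epsilon>\<close>; since the result does not depend on the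
  representatives and constructions chosen, such a union is a single equivalence class.
\<close>

definition ext_pull :: "('o, 'a, 'm) addcat_scheme \<Rightarrow> 'a \<Rightarrow> ('a \<times> 'a) set \<Rightarrow> ('a \<times> 'a) set" where
  "ext_pull C f c = (\<Union>\<epsilon>\<in>c. \<Union>\<epsilon>'\<in>{\<epsilon>'. pullback_ext C f \<epsilon> \<epsilon>'}. ext_class C \<epsilon>')"

definition ext_push :: "('o, 'a, 'm) addcat_scheme \<Rightarrow> 'a \<Rightarrow> ('a \<times> 'a) set \<Rightarrow> ('a \<times> 'a) set" where
  "ext_push C f c = (\<Union>\<epsilon>\<in>c. \<Union>\<epsilon>'\<in>{\<epsilon>'. pushout_ext C f \<epsilon> \<epsilon>'}. ext_class C \<epsilon>')"

definition biprod :: "('o, 'a, 'm) addcat_scheme \<Rightarrow> 'o \<Rightarrow> 'o \<Rightarrow> 'a \<times> 'a \<times> 'a \<times> 'a" where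
  "biprod C x y = (SOME (i, j, p, q). is_biproduct C x y i j p q)"

definition in1 :: "('o, 'a, 'm) addcat_scheme \<Rightarrow> 'o \<Rightarrow> 'o \<Rightarrow> 'a" where
  "in1 C x y = fst (biprod C x y)"

definition in2 :: "('o, 'a, 'm) addcat_scheme \<Rightarrow> 'o \<Rightarrow> 'o \<Rightarrow> 'a" where
  "in2 C x y = fst (snd (biprod C x y))"

definition pr1 :: "('o, 'a, 'm) addcat_scheme \<Rightarrow> 'o \<Rightarrow> 'o \<Rightarrow> 'a" where
  "pr1 C x y = fst (snd (snd (biprod C x y)))"

definition pr2 :: "('o, 'a, 'm) addcat_scheme \<Rightarrow> 'o \<Rightarrow> 'o \<Rightarrow> 'a" where
  "pr2 C x y = snd (snd (snd (biprod C x y)))"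

definition dsum :: "('o, 'a, 'm) addcat_scheme \<Rightarrow> 'a \<Rightarrow> 'a \<Rightarrow> 'a" where
  "dsum C f g =
     (in1 C (Cod C f) (Cod C g) \<cdot>\<^bsub>C\<^esub> f \<cdot>\<^bsub>C\<^esub> pr1 C (Dom C f) (Dom C g)) \<boxplus>\<^bsub>C\<^esub>
     (in2 C (Cod C f) (Cod C g) \<cdot>\<^bsub>C\<^esub> g \<cdot>\<^bsub>C\<^esub> pr2 C (Dom C f) (Dom C g))"

definition ext_dsum ::
  "('o, 'a, 'm) addcat_scheme \<Rightarrow> ('a \<times> 'a) set \<Rightarrow> ('a \<times> 'a) set \<Rightarrow> ('a \<times> 'a) set" where
  "ext_dsum C c d = (\<Union>(i, p)\<in>c. \<Union>(i', p')\<in>d. ext_class C (dsum C i i', dsum C p p'))"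

text \<open>The Baer sum: push out along the codiagonal of \<open>Y\<close>, pull back along the diagonal of \<open>X\<close>.\<close>

definition baer_sum ::
  "('o, 'a, 'm) addcat_scheme \<Rightarrow> 'o \<Rightarrow> 'o \<Rightarrow> ('a \<times> 'a) set \<Rightarrow> ('a \<times> 'a) set \<Rightarrow> ('a \<times> 'a) set" where
  "baer_sum C X Y c d =
     ext_push C (pr1 C Y Y \<boxplus>\<^bsub>C\<^esub> pr2 C Y Y)
       (ext_pull C (in1 C X X \<boxplus>\<^bsub>C\<^esub> in2 C X X) (ext_dsum C c d))"

definition Ext1 :: "('o, 'a, 'm) addcat_scheme \<Rightarrow> 'o \<Rightarrow> 'o \<Rightarrow> ('a \<times> 'a) set monoid" where
  "Ext1 C X Y = \<lparr>
     carrier = extensions C X Y // ext_rel C,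
     mult = baer_sum C X Y,
     one = ext_class C (in1 C Y X, pr2 C Y X)\<rparr>"

text \<open>The action of the bifunctor \<open>Ext\<close> on a pair of arrows \<open>g : X' \<rightarrow> X\<close> and \<open>f : Y \<rightarrow> Y'\<close>.\<close>

definition ext_act ::
  "('o, 'a, 'm) addcat_scheme \<Rightarrow> 'a \<Rightarrow> 'a \<Rightarrow> ('a \<times> 'a) set \<Rightarrow> ('a \<times> 'a) set" where
  "ext_act C g f c = ext_push C f (ext_pull C g c)"

section \<open>The comparison maps\<close>

definition ext_const ::
  "('s, 't, 'm) cat_scheme \<Rightarrow> ('o, 'a, 'n) addcat_scheme \<Rightarrow> ('a \<times> 'a) set \<Rightarrow>
   (('s, 't, 'o, 'a) ntrans \<times> ('s, 't, 'o, 'a) ntrans) set" where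
  "ext_const S A c = (\<Union>(i, p)\<in>c. ext_class (fun_cat S A) (const_ar S A i, const_ar S A p))"

definition Psi ::
  "('s, 't, 'm) cat_scheme \<Rightarrow> ('o, 'a, 'n) addcat_scheme \<Rightarrow> ('s, 't, 'o, 'a) func \<Rightarrow>
   ('a \<times> 'a) set \<Rightarrow> (('s, 't, 'o, 'a) ntrans \<times> ('s, 't, 'o, 'a) ntrans) set" where
  "Psi S A F c = ext_pull (fun_cat S A) (colim_in S A F) (ext_const S A c)"

text \<open>
  \<open>H\<close> and \<open>K\<close> are group-valued bifunctors on \<open>C\<^sup>o\<^sup>p \<times> D\<close>, with actions \<open>h u v\<close> and \<open>k u v\<close> on pairs of
  arrows.  The family \<open>\<psi> x y : H x y \<rightarrow> K x y\<close> is a natural isomorphism between them.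
\<close>

definition natural_iso_of_bifunctors ::
  "('o1, 'a1, 'm) cat_scheme \<Rightarrow> ('o2, 'a2, 'n) cat_scheme \<Rightarrow>
   ('o1 \<Rightarrow> 'o2 \<Rightarrow> 'g monoid) \<Rightarrow> ('a1 \<Rightarrow> 'a2 \<Rightarrow> 'g \<Rightarrow> 'g) \<Rightarrow>
   ('o1 \<Rightarrow> 'o2 \<Rightarrow> 'k monoid) \<Rightarrow> ('a1 \<Rightarrow> 'a2 \<Rightarrow> 'k \<Rightarrow> 'k) \<Rightarrow>
   ('o1 \<Rightarrow> 'o2 \<Rightarrow> 'g \<Rightarrow> 'k) \<Rightarrow> bool" where
  "natural_iso_of_bifunctors C D H h K k \<psi> \<longleftrightarrow>
     (\<forall>x\<in>Obj C. \<forall>y\<in>Obj D. \<psi> x y \<in> iso (H x y) (K x y)) \<and>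
     (\<forall>u\<in>Arr C. \<forall>v\<in>Arr D. \<forall>c\<in>carrier (H (Cod C u) (Dom D v)).
        \<psi> (Dom C u) (Cod D v) (h u v c) = k u v (\<psi> (Cod C u) (Dom D v) c))"

end

theory Submission
  imports Defs
begin

text \<open>
  The constant diagram functor \<open>\<kappa>\<close> is exact and has the left adjoint \<open>colim\<close>, which is always right
  exact. If \<open>colim\<close> is exact, it turns an extension of \<open>F\<close> by \<open>\<kappa> A\<close> into an extension of \<open>colim F\<close> by
  \<open>colim (\<kappa> A)\<close>, and pushing out along the counit \<open>colim (\<kappa> A) \<rightarrow> A\<close> gives the inverse of \<open>\<Psi>\<close>.
  Conversely, let \<open>0 \<rightarrow> F' \<rightarrow> F \<rightarrow> F'' \<rightarrow> 0\<close> be exact and push it out along the unit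
  \<open>F' \<rightarrow> \<kappa> (colim F')\<close>. By surjectivity of \<open>\<Psi>\<close> the result is pulled back from
  an extension \<open>0 \<rightarrow> colim F' \<rightarrow> B \<rightarrow> colim F'' \<rightarrow> 0\<close>, and the adjoint \<open>colim F \<rightarrow> B\<close> of the
  induced \<open>F \<rightarrow> \<kappa> B\<close> factors the monomorphism \<open>colim F' \<rightarrow> B\<close> through \<open>colim F' \<rightarrow> colim F\<close>,
  which is therefore a monomorphism. Naturality and additivity of \<open>\<Psi>\<close> hold without any hypothesis.
\<close>

section \<open>Arrows in preadditive and abelian categories\<close>

text \<open>Classes are hardly ever manipulated directly. The working notion is a map of extensions
  recorded by its two outer arrows, with the middle arrow hidden: identities outside mean
  equivalence (short five lemma), and one identity outside already makes the map a pullback or a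
  pushout up to equivalence. So \<open>\<Psi>\<close> sends the class of \<open>e\<close> to that of
  \<open>\<phi>\<close> as soon as some map from \<open>\<phi>\<close> to \<open>\<kappa> e\<close>
  has outer arrows \<open>1\<close> and \<open>\<rho>\<close>, and all claims about
  \<open>\<Psi>\<close> become compositions and factorisations of such maps. The obstacle is the
  group structure: Baer sums are built from chosen biproducts, and \<open>\<kappa>\<close> need not
  respect the choices. What survives is a configuration of three maps out of one auxiliary extension
  whose left arrows are \<open>a\<close>, \<open>b\<close> and their sum. The other labour is that
  diagrams form an abelian category. Kernels and cokernels are built object by object, and normality
  needs the less obvious fact that a monomorphism of diagrams is a monomorphism at every
  object.\<close>

lemma mem_Hom [simp]: "f \<in> Hom C x y \<longleftrightarrow> f \<in> Arr C \<and> Dom C f = x \<and> Cod C f = y"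
  by (simp add: Hom_def)

context category
begin

lemma Dom_Obj [simp]: "f \<in> Arr C \<Longrightarrow> Dom C f \<in> Obj C"
  by (rule Dom_in)

lemma Cod_Obj [simp]: "f \<in> Arr C \<Longrightarrow> Cod C f \<in> Obj C"
  by (rule Cod_in)

lemma Ident_simps [simp]:
  assumes "x \<in> Obj C"
  shows "Ident C x \<in> Arr C" "Dom C (Ident C x) = x" "Cod C (Ident C x) = x"
  using Ident_in[OF assms] by auto

lemma comp_simps [simp]:
  assumes "f \<in> Arr C" "g \<in> Arr C" "Dom C g = Cod C f"
  shows "g \<cdot> f \<in> Arr C" "Dom C (g \<cdot> f) = Dom C f" "Cod C (g \<cdot> f) = Cod C g"
  using Comp_in[of f "Dom C f" "Cod C f" g "Cod C g"] assms by auto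

lemma comp_ident [simp]: "f \<in> Arr C \<Longrightarrow> Dom C f = x \<Longrightarrow> f \<cdot> Ident C x = f"
  using Comp_Ident by auto

lemma ident_comp [simp]: "f \<in> Arr C \<Longrightarrow> Cod C f = y \<Longrightarrow> Ident C y \<cdot> f = f"
  using Ident_Comp by auto

lemma comp_assoc [simp]:
  assumes "f \<in> Arr C" "g \<in> Arr C" "h \<in> Arr C" "Dom C g = Cod C f" "Dom C h = Cod C g"
  shows "(h \<cdot> g) \<cdot> f = h \<cdot> g \<cdot> f"
  using Comp_assoc[of f "Dom C f" "Cod C f" g "Cod C g" h "Cod C h"] assms by auto

text \<open>Composites are normalised to the right, so the left side of
  \<open>g \<cdot> f = h\<close> no longer occurs as a subterm once a further arrow \<open>u\<close>
  is precomposed. In this form the equation still applies inside a chain.\<close>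

lemma comp_reduce:
  assumes "g \<cdot> f = h" "f \<in> Arr C" "g \<in> Arr C" "u \<in> Arr C" "Dom C g = Cod C f" "Dom C f = Cod C u"
  shows "g \<cdot> f \<cdot> u = h \<cdot> u"
  using comp_assoc[of u f g] assms by simp

lemma mono_arr: "is_mono C m \<Longrightarrow> m \<in> Arr C"
  unfolding is_mono_def by (rule conjunct1)

lemma is_monoD:
  assumes "is_mono C m" "m \<cdot> f = m \<cdot> g" "f \<in> Arr C" "g \<in> Arr C" "Cod C f = Dom C m"
    "Cod C g = Dom C m" "Dom C f = Dom C g"
  shows "f = g"
proof -
  have "f \<in> Hom C (Dom C g) (Dom C m)" "g \<in> Hom C (Dom C g) (Dom C m)" using assms by simp_all
  then show ?thesis using assms(1,2) unfolding is_mono_def by blast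
qed

lemma epi_arr: "is_epi C m \<Longrightarrow> m \<in> Arr C"
  unfolding is_epi_def by (rule conjunct1)

lemma is_epiD:
  assumes "is_epi C e" "f \<cdot> e = g \<cdot> e" "f \<in> Arr C" "g \<in> Arr C" "Dom C f = Cod C e"
    "Dom C g = Cod C e" "Cod C f = Cod C g"
  shows "f = g"
proof -
  have "f \<in> Hom C (Cod C e) (Cod C g)" "g \<in> Hom C (Cod C e) (Cod C g)" using assms by simp_all
  then show ?thesis using assms(1,2) unfolding is_epi_def by blast
qed

end

section \<open>Additive calculus of arrows\<close>

context preadditive_category
begin

text \<open>Indexed by an arrow instead of two objects, so that \<open>neg\<close> can read off its
  hom group from its only argument.\<close>

definition hom_group :: "'a \<Rightarrow> 'a monoid" where
  "hom_group f = \<lparr>carrier = Hom C (Dom C f) (Cod C f), mult = Add C, one = Zero C (Dom C f) (Cod C f)\<rparr>"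

definition neg :: "'a \<Rightarrow> 'a" where
  "neg f = inv\<^bsub>hom_group f\<^esub> f"

lemma hom_group_comm: "f \<in> Arr C \<Longrightarrow> comm_group (hom_group f)"
  unfolding hom_group_def by (rule Hom_group) auto

lemma hom_group_simps [simp]:
  "carrier (hom_group f) = Hom C (Dom C f) (Cod C f)"
  "mult (hom_group f) = Add C"
  "one (hom_group f) = Zero C (Dom C f) (Cod C f)"
  by (auto simp: hom_group_def)

lemma zero_simps [simp]:
  assumes "x \<in> Obj C" "y \<in> Obj C"
  shows "Zero C x y \<in> Arr C" "Dom C (Zero C x y) = x" "Cod C (Zero C x y) = y"
proof -
  interpret G: comm_group "\<lparr>carrier = Hom C x y, mult = Add C, one = Zero C x y\<rparr>"
    by (rule Hom_group[OF assms])
  show "Zero C x y \<in> Arr C" "Dom C (Zero C x y) = x" "Cod C (Zero C x y) = y"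
    using G.one_closed by auto
qed

lemma add_simps [simp]:
  assumes "f \<in> Arr C" "g \<in> Arr C" "Dom C g = Dom C f" "Cod C g = Cod C f"
  shows "f \<boxplus> g \<in> Arr C" "Dom C (f \<boxplus> g) = Dom C f" "Cod C (f \<boxplus> g) = Cod C f"
proof -
  interpret G: comm_group "hom_group f" by (rule hom_group_comm[OF assms(1)])
  show "f \<boxplus> g \<in> Arr C" "Dom C (f \<boxplus> g) = Dom C f" "Cod C (f \<boxplus> g) = Cod C f"
    using G.m_closed[of f g] assms by auto
qed

lemma neg_simps [simp]:
  assumes "f \<in> Arr C"
  shows "neg f \<in> Arr C" "Dom C (neg f) = Dom C f" "Cod C (neg f) = Cod C f"
    "f \<boxplus> neg f = Zero C (Dom C f) (Cod C f)"
proof -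
  interpret G: comm_group "hom_group f" by (rule hom_group_comm[OF assms(1)])
  show "neg f \<in> Arr C" "Dom C (neg f) = Dom C f" "Cod C (neg f) = Cod C f"
    "f \<boxplus> neg f = Zero C (Dom C f) (Cod C f)"
    using G.inv_closed[of f] G.r_inv[of f] assms unfolding neg_def by auto
qed

lemma add_zero [simp]:
  assumes "f \<in> Arr C" "Dom C f = x" "Cod C f = y"
  shows "f \<boxplus> Zero C x y = f" "Zero C x y \<boxplus> f = f"
proof -
  interpret G: comm_group "hom_group f" by (rule hom_group_comm[OF assms(1)])
  show "f \<boxplus> Zero C x y = f" "Zero C x y \<boxplus> f = f"
    using G.r_one[of f] G.l_one[of f] assms by auto
qed

lemma add_assoc:
  assumes "f \<in> Arr C" "g \<in> Arr C" "h \<in> Arr C" "Dom C g = Dom C f" "Cod C g = Cod C f"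
    "Dom C h = Dom C f" "Cod C h = Cod C f"
  shows "f \<boxplus> g \<boxplus> h = f \<boxplus> (g \<boxplus> h)"
proof -
  interpret G: comm_group "hom_group f" by (rule hom_group_comm[OF assms(1)])
  show ?thesis using G.m_assoc[of f g h] assms by auto
qed

lemma add_comm:
  assumes "f \<in> Arr C" "g \<in> Arr C" "Dom C g = Dom C f" "Cod C g = Cod C f"
  shows "f \<boxplus> g = g \<boxplus> f"
proof -
  interpret G: comm_group "hom_group f" by (rule hom_group_comm[OF assms(1)])
  show ?thesis using G.m_comm[of f g] assms by auto
qed

text \<open>Cancellation in a hom group. Bilinearity makes a composite with a zero arrow idempotent
  for addition, which is how \<open>comp_zero\<close> and \<open>zero_comp\<close> follow from the
  axioms.\<close>

lemma add_idem_zero: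
  assumes "f \<in> Arr C" "f \<boxplus> f = f"
  shows "f = Zero C (Dom C f) (Cod C f)"
proof -
  interpret G: comm_group "hom_group f" by (rule hom_group_comm[OF assms(1)])
  show ?thesis using G.l_cancel_one[of f f] assms by auto
qed

lemma eq_neg_if_add_zero:
  assumes "f \<in> Arr C" "g \<in> Arr C" "Dom C g = Dom C f" "Cod C g = Cod C f"
    "f \<boxplus> g = Zero C (Dom C f) (Cod C f)"
  shows "g = neg f"
proof -
  interpret G: comm_group "hom_group f" by (rule hom_group_comm[OF assms(1)])
  show ?thesis using G.inv_equality[of g f] assms add_comm[of f g] unfolding neg_def by auto
qed

lemma eq_if_add_neg_zero:
  assumes "f \<in> Arr C" "g \<in> Arr C" "Dom C g = Dom C f" "Cod C g = Cod C f"
    "f \<boxplus> neg g = Zero C (Dom C f) (Cod C f)"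
  shows "f = g"
proof -
  have "f = f \<boxplus> (neg g \<boxplus> g)" using assms by (simp add: add_comm[of "neg g" g])
  also have "\<dots> = (f \<boxplus> neg g) \<boxplus> g" using assms by (subst add_assoc) auto
  also have "\<dots> = g" using assms by simp
  finally show ?thesis .
qed

lemma comp_add [simp]:
  assumes "f \<in> Arr C" "f' \<in> Arr C" "g \<in> Arr C" "Dom C f' = Dom C f" "Cod C f' = Cod C f"
    "Dom C g = Cod C f"
  shows "g \<cdot> (f \<boxplus> f') = g \<cdot> f \<boxplus> g \<cdot> f'"
  using Comp_Add[of f "Dom C f" "Cod C f" f' g] assms by auto

lemma add_comp [simp]:
  assumes "f \<in> Arr C" "g \<in> Arr C" "g' \<in> Arr C" "Dom C g' = Dom C g" "Cod C g' = Cod C g"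
    "Dom C g = Cod C f"
  shows "(g \<boxplus> g') \<cdot> f = g \<cdot> f \<boxplus> g' \<cdot> f"
  using Add_Comp[of f "Dom C f" "Cod C f" g "Cod C g" g'] assms by auto

lemma comp_zero [simp]:
  assumes "f \<in> Arr C" "Dom C f = y" "x \<in> Obj C"
  shows "f \<cdot> Zero C x y = Zero C x (Cod C f)"
proof -
  have y: "y \<in> Obj C" using assms by auto
  have "f \<cdot> Zero C x y \<boxplus> f \<cdot> Zero C x y = f \<cdot> (Zero C x y \<boxplus> Zero C x y)"
    using assms y by (subst comp_add) auto
  also have "\<dots> = f \<cdot> Zero C x y" using assms y by simp
  finally show ?thesis using add_idem_zero[of "f \<cdot> Zero C x y"] assms y by simp
qed

lemma zero_comp [simp]:
  assumes "f \<in> Arr C" "Cod C f = x" "y \<in> Obj C"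
  shows "Zero C x y \<cdot> f = Zero C (Dom C f) y"
proof -
  have x: "x \<in> Obj C" using assms by auto
  have "Zero C x y \<cdot> f \<boxplus> Zero C x y \<cdot> f = (Zero C x y \<boxplus> Zero C x y) \<cdot> f"
    using assms x by (subst add_comp) auto
  also have "\<dots> = Zero C x y \<cdot> f" using assms x by simp
  finally show ?thesis using add_idem_zero[of "Zero C x y \<cdot> f"] assms x by simp
qed

lemma comp_neg [simp]:
  assumes "f \<in> Arr C" "g \<in> Arr C" "Dom C g = Cod C f"
  shows "g \<cdot> neg f = neg (g \<cdot> f)"
proof (rule eq_neg_if_add_zero)
  have "g \<cdot> f \<boxplus> g \<cdot> neg f = g \<cdot> (f \<boxplus> neg f)" using assms by (subst comp_add) auto
  then show "g \<cdot> f \<boxplus> g \<cdot> neg f = Zero C (Dom C (g \<cdot> f)) (Cod C (g \<cdot> f))" using assms by simp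
qed (use assms in auto)

lemma neg_comp [simp]:
  assumes "f \<in> Arr C" "g \<in> Arr C" "Dom C g = Cod C f"
  shows "neg g \<cdot> f = neg (g \<cdot> f)"
proof (rule eq_neg_if_add_zero)
  have "g \<cdot> f \<boxplus> neg g \<cdot> f = (g \<boxplus> neg g) \<cdot> f" using assms by (subst add_comp) auto
  then show "g \<cdot> f \<boxplus> neg g \<cdot> f = Zero C (Dom C (g \<cdot> f)) (Cod C (g \<cdot> f))" using assms by simp
qed (use assms in auto)

lemma neg_zero [simp]: "x \<in> Obj C \<Longrightarrow> y \<in> Obj C \<Longrightarrow> neg (Zero C x y) = Zero C x y"
  by (rule eq_neg_if_add_zero[symmetric]) simp_all

text \<open>Cancellation is tested on differences, since \<open>m \<cdot> f = m \<cdot> g\<close>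
  says that \<open>m\<close> kills \<open>f - g\<close>. Most diagram chases below then only have to
  follow arrows that become zero.\<close>

lemma is_monoI:
  assumes m: "m \<in> Arr C"
    and "\<And>f. f \<in> Arr C \<Longrightarrow> Cod C f = Dom C m \<Longrightarrow> m \<cdot> f = Zero C (Dom C f) (Cod C m) \<Longrightarrow>
      f = Zero C (Dom C f) (Dom C m)"
  shows "is_mono C m"
  unfolding is_mono_def
proof (intro conjI allI ballI impI)
  fix w f g assume f: "f \<in> Hom C w (Dom C m)" and g: "g \<in> Hom C w (Dom C m)" and eq: "m \<cdot> f = m \<cdot> g"
  have "m \<cdot> (f \<boxplus> neg g) = m \<cdot> f \<boxplus> neg (m \<cdot> g)" using f g m by simp
  also have "\<dots> = Zero C w (Cod C m)" using f g m eq by simp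
  finally have "f \<boxplus> neg g = Zero C w (Dom C m)" using assms(2)[of "f \<boxplus> neg g"] f g m by simp
  then show "f = g" using eq_if_add_neg_zero[of f g] f g by simp
qed (rule m)

lemma is_monoD_zero:
  assumes m: "is_mono C m" and f: "f \<in> Arr C" "Dom C f = x" "Cod C f = Dom C m"
    and "m \<cdot> f = Zero C x (Cod C m)"
  shows "f = Zero C x (Dom C m)"
proof (rule is_monoD[OF m])
  have "m \<in> Arr C" by (rule mono_arr[OF m])
  then show "m \<cdot> f = m \<cdot> Zero C x (Dom C m)" "Zero C x (Dom C m) \<in> Arr C"
    "Cod C (Zero C x (Dom C m)) = Dom C m" "Dom C f = Dom C (Zero C x (Dom C m))"
    using assms Dom_Obj[OF f(1)] by auto
qed fact+

lemma is_epiI: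
  assumes m: "m \<in> Arr C"
    and "\<And>f. f \<in> Arr C \<Longrightarrow> Dom C f = Cod C m \<Longrightarrow> f \<cdot> m = Zero C (Dom C m) (Cod C f) \<Longrightarrow>
      f = Zero C (Cod C m) (Cod C f)"
  shows "is_epi C m"
  unfolding is_epi_def
proof (intro conjI allI ballI impI)
  fix w f g assume f: "f \<in> Hom C (Cod C m) w" and g: "g \<in> Hom C (Cod C m) w" and eq: "f \<cdot> m = g \<cdot> m"
  have "(f \<boxplus> neg g) \<cdot> m = f \<cdot> m \<boxplus> neg (g \<cdot> m)" using f g m by simp
  also have "\<dots> = Zero C (Dom C m) w" using f g m eq by simp
  finally have "f \<boxplus> neg g = Zero C (Cod C m) w" using assms(2)[of "f \<boxplus> neg g"] f g m by simp
  then show "f = g" using eq_if_add_neg_zero[of f g] f g by simp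
qed (rule m)

lemma is_epiD_zero:
  assumes m: "is_epi C m" and f: "f \<in> Arr C" "Cod C f = y" "Dom C f = Cod C m"
    and "f \<cdot> m = Zero C (Dom C m) y"
  shows "f = Zero C (Cod C m) y"
proof (rule is_epiD[OF m])
  have "m \<in> Arr C" by (rule epi_arr[OF m])
  then show "f \<cdot> m = Zero C (Cod C m) y \<cdot> m" "Zero C (Cod C m) y \<in> Arr C"
    "Dom C (Zero C (Cod C m) y) = Cod C m" "Cod C f = Cod C (Zero C (Cod C m) y)"
    using assms Cod_Obj[OF f(1)] by auto
qed fact+

section \<open>Universal properties of kernels and cokernels\<close>

lemma is_kernelD:
  assumes "is_kernel C f k"
  shows "f \<in> Arr C" "k \<in> Arr C" "Cod C k = Dom C f" "f \<cdot> k = Zero C (Dom C k) (Cod C f)"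
  using assms unfolding is_kernel_def by blast+

lemma is_cokernelD:
  assumes "is_cokernel C f k"
  shows "f \<in> Arr C" "k \<in> Arr C" "Dom C k = Cod C f" "k \<cdot> f = Zero C (Dom C f) (Cod C k)"
  using assms unfolding is_cokernel_def by blast+

lemma kernel_lift:
  assumes "is_kernel C f k" "h \<in> Arr C" "Cod C h = Dom C f" "f \<cdot> h = Zero C (Dom C h) (Cod C f)"
  obtains u where "u \<in> Arr C" "Dom C u = Dom C h" "Cod C u = Dom C k" "k \<cdot> u = h"
proof -
  have "\<exists>!u. u \<in> Hom C (Dom C h) (Dom C k) \<and> k \<cdot> u = h"
    using assms unfolding is_kernel_def by blast
  then show ?thesis using that by auto
qed

lemma cokernel_desc:
  assumes "is_cokernel C f k" "h \<in> Arr C" "Dom C h = Cod C f" "h \<cdot> f = Zero C (Dom C f) (Cod C h)"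
  obtains u where "u \<in> Arr C" "Dom C u = Cod C k" "Cod C u = Cod C h" "u \<cdot> k = h"
proof -
  have "\<exists>!u. u \<in> Hom C (Cod C k) (Cod C h) \<and> u \<cdot> k = h"
    using assms unfolding is_cokernel_def by blast
  then show ?thesis using that by auto
qed

text \<open>The arrow \<open>k \<cdot> v\<close> is itself killed by \<open>f\<close>, and
  uniqueness of its lift through \<open>k\<close> is cancellation.\<close>

lemma kernel_mono:
  assumes k: "is_kernel C f k"
  shows "is_mono C k"
  unfolding is_mono_def
proof (intro conjI allI ballI impI)
  note K [simp] = is_kernelD[OF k]
  fix w u v assume u: "u \<in> Hom C w (Dom C k)" and v: "v \<in> Hom C w (Dom C k)" and eq: "k \<cdot> u = k \<cdot> v"
  have "f \<cdot> (k \<cdot> v) = Zero C (Dom C (k \<cdot> v)) (Cod C f)" "k \<cdot> v \<in> Arr C" "Cod C (k \<cdot> v) = Dom C f"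
    using v by (simp_all add: comp_reduce[OF K(4)])
  moreover have w: "Dom C (k \<cdot> v) = w" using v by simp
  ultimately have "\<exists>!u. u \<in> Hom C (Dom C (k \<cdot> v)) (Dom C k) \<and> k \<cdot> u = k \<cdot> v"
    using k unfolding is_kernel_def by blast
  then show "u = v" using u v eq unfolding w by blast
qed (use is_kernelD[OF k] in auto)

lemma cokernel_epi:
  assumes k: "is_cokernel C f k"
  shows "is_epi C k"
  unfolding is_epi_def
proof (intro conjI allI ballI impI)
  note K [simp] = is_cokernelD[OF k]
  fix w u v assume u: "u \<in> Hom C (Cod C k) w" and v: "v \<in> Hom C (Cod C k) w" and eq: "u \<cdot> k = v \<cdot> k"
  have "(v \<cdot> k) \<cdot> f = Zero C (Dom C f) (Cod C (v \<cdot> k))" "v \<cdot> k \<in> Arr C" "Dom C (v \<cdot> k) = Cod C f"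
    using v by simp_all
  moreover have w: "Cod C (v \<cdot> k) = w" using v by simp
  ultimately have "\<exists>!u. u \<in> Hom C (Cod C k) (Cod C (v \<cdot> k)) \<and> u \<cdot> k = v \<cdot> k"
    using k unfolding is_cokernel_def by blast
  then show "u = v" using u v eq unfolding w by blast
qed (use is_cokernelD[OF k] in auto)

lemma is_kernelI:
  assumes "f \<in> Arr C" "Cod C k = Dom C f" "f \<cdot> k = Zero C (Dom C k) (Cod C f)" "is_mono C k"
    "\<And>h. h \<in> Arr C \<Longrightarrow> Cod C h = Dom C f \<Longrightarrow> f \<cdot> h = Zero C (Dom C h) (Cod C f) \<Longrightarrow>
      \<exists>u\<in>Hom C (Dom C h) (Dom C k). k \<cdot> u = h"
  shows "is_kernel C f k"
  unfolding is_kernel_def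
proof (intro conjI ballI impI; (elim conjE)?)
  show k: "k \<in> Arr C" by (rule mono_arr[OF assms(4)])
  fix h assume h: "h \<in> Arr C" "Cod C h = Dom C f" "f \<cdot> h = Zero C (Dom C h) (Cod C f)"
  from assms(5)[OF this] obtain u where u: "u \<in> Hom C (Dom C h) (Dom C k) \<and> k \<cdot> u = h" by blast
  then show "\<exists>!u. u \<in> Hom C (Dom C h) (Dom C k) \<and> k \<cdot> u = h"
  proof (rule ex1I)
    fix v assume "v \<in> Hom C (Dom C h) (Dom C k) \<and> k \<cdot> v = h"
    with u show "v = u" by - (rule is_monoD[OF assms(4)]; simp)
  qed
qed (use assms in auto)

lemma is_cokernelI:
  assumes "f \<in> Arr C" "Dom C k = Cod C f" "k \<cdot> f = Zero C (Dom C f) (Cod C k)" "is_epi C k"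
    "\<And>h. h \<in> Arr C \<Longrightarrow> Dom C h = Cod C f \<Longrightarrow> h \<cdot> f = Zero C (Dom C f) (Cod C h) \<Longrightarrow>
      \<exists>u\<in>Hom C (Cod C k) (Cod C h). u \<cdot> k = h"
  shows "is_cokernel C f k"
  unfolding is_cokernel_def
proof (intro conjI ballI impI; (elim conjE)?)
  show k: "k \<in> Arr C" by (rule epi_arr[OF assms(4)])
  fix h assume h: "h \<in> Arr C" "Dom C h = Cod C f" "h \<cdot> f = Zero C (Dom C f) (Cod C h)"
  from assms(5)[OF this] obtain u where u: "u \<in> Hom C (Cod C k) (Cod C h) \<and> u \<cdot> k = h" by blast
  then show "\<exists>!u. u \<in> Hom C (Cod C k) (Cod C h) \<and> u \<cdot> k = h"
  proof (rule ex1I)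
    fix v assume "v \<in> Hom C (Cod C k) (Cod C h) \<and> v \<cdot> k = h"
    with u show "v = u" by - (rule is_epiD[OF assms(4)]; simp)
  qed
qed (use assms in auto)

end

section \<open>Duality through the opposite category\<close>

definition opp :: "('o, 'a, 'm) addcat_scheme \<Rightarrow> ('o, 'a) addcat" where
  "opp C = \<lparr>Obj = Obj C, Arr = Arr C, Dom = Cod C, Cod = Dom C, Ident = Ident C,
     Comp = (\<lambda>g f. f \<cdot>\<^bsub>C\<^esub> g), Add = Add C, Zero = (\<lambda>x y. Zero C y x)\<rparr>"

lemma opp_simps [simp]:
  "Obj (opp C) = Obj C" "Arr (opp C) = Arr C" "Dom (opp C) = Cod C" "Cod (opp C) = Dom C"
  "Ident (opp C) = Ident C" "g \<cdot>\<^bsub>opp C\<^esub> f = f \<cdot>\<^bsub>C\<^esub> g" "Add (opp C) = Add C"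
  "Zero (opp C) x y = Zero C y x"
  by (simp_all add: opp_def)

lemma Hom_opp: "Hom (opp C) x y = Hom C y x"
  by (auto simp: Hom_def)

lemma kernel_opp: "is_kernel (opp C) f k \<longleftrightarrow> is_cokernel C f k"
  unfolding is_kernel_def is_cokernel_def Hom_opp opp_simps by (rule refl)

lemma cokernel_opp: "is_cokernel (opp C) f k \<longleftrightarrow> is_kernel C f k"
  unfolding is_kernel_def is_cokernel_def Hom_opp opp_simps by (rule refl)

lemma mono_opp: "is_mono (opp C) m \<longleftrightarrow> is_epi C m"
  unfolding is_mono_def is_epi_def Hom_opp opp_simps by (rule refl)

lemma epi_opp: "is_epi (opp C) m \<longleftrightarrow> is_mono C m"
  unfolding is_mono_def is_epi_def Hom_opp opp_simps by (rule refl)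

lemma short_exact_opp: "short_exact (opp C) p i \<longleftrightarrow> short_exact C i p"
  unfolding short_exact_def kernel_opp cokernel_opp by blast

text \<open>An extension dualises with its two arrows interchanged. Through this equivalence
  pushouts of extensions inherit existence and factorisation from pullbacks.\<close>

lemma pullback_ext_opp: "pullback_ext (opp C) f (p, i) (p', i') \<longleftrightarrow> pushout_ext C f (i, p) (i', p')"
  unfolding pullback_ext_def pushout_ext_def is_pullback_def is_pushout_def short_exact_opp
    Hom_opp opp_simps prod.case
  by (rule refl)

lemma abelian_opp:
  assumes "abelian_category C"
  shows "abelian_category (opp C)"
proof -
  interpret abelian_category C by fact
  show ?thesis
  proof (intro abelian_category.intro preadditive_category.intro category.intro
      abelian_category_axioms.intro preadditive_category_axioms.intro, unfold Hom_opp kernel_opp cokernel_opp mono_opp epi_opp opp_simps)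
    show "\<exists>z. is_zero_object (opp C) z"
      using zero_object unfolding is_zero_object_def Hom_opp opp_simps
      by (simp add: conj_commute del: mem_Hom)
    fix x y assume "x \<in> Obj C" "y \<in> Obj C"
    then obtain i j p q where "is_biproduct C x y i j p q" using biproducts by blast
    \<comment> \<open>Injections and projections change places.\<close>
    then have "is_biproduct (opp C) x y p q i j"
      unfolding is_biproduct_def Hom_opp opp_simps by blast
    then show "\<exists>i j p q. is_biproduct (opp C) x y i j p q" by blast
  next
    fix f w x g y h z
    assume "f \<in> Hom C x w" "g \<in> Hom C y x" "h \<in> Hom C z y"
    then show "f \<cdot>\<^bsub>C\<^esub> g \<cdot>\<^bsub>C\<^esub> h = (f \<cdot>\<^bsub>C\<^esub> g) \<cdot>\<^bsub>C\<^esub> h" by simp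
  qed (auto simp del: mem_Hom intro: Comp_in Ident_in Hom_group kernels cokernels epi_normal mono_normal
      Comp_Ident Ident_Comp Comp_Add Add_Comp Dom_in Cod_in)
qed

section \<open>Morphisms of extensions\<close>

text \<open>
  On Yoneda classes \<open>ext_mor C a b e e'\<close> means \<open>a \<cdot> e = e' \<cdot> b\<close>: with \<open>b\<close> an identity it says that
  \<open>e'\<close> is the pushout of \<open>e\<close> along \<open>a\<close>, with \<open>a\<close> an identity that \<open>e\<close> is the pullback of \<open>e'\<close> along \<open>b\<close>.
\<close>

definition ext_mor :: "('o, 'a, 'm) addcat_scheme \<Rightarrow> 'a \<Rightarrow> 'a \<Rightarrow> 'a \<times> 'a \<Rightarrow> 'a \<times> 'a \<Rightarrow> bool" where
  "ext_mor C a b = (\<lambda>(i, p) (i', p').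
     short_exact C i p \<and> short_exact C i' p' \<and>
     a \<in> Hom C (Dom C i) (Dom C i') \<and> b \<in> Hom C (Cod C p) (Cod C p') \<and>
     (\<exists>g\<in>Hom C (Cod C i) (Cod C i'). g \<cdot>\<^bsub>C\<^esub> i = i' \<cdot>\<^bsub>C\<^esub> a \<and> p' \<cdot>\<^bsub>C\<^esub> g = b \<cdot>\<^bsub>C\<^esub> p))"

context abelian_category
begin

text \<open>By normality \<open>e\<close> is the cokernel of some \<open>f\<close>. Since
  \<open>f\<close> factors through the kernel \<open>k\<close>, whatever kills \<open>k\<close>
  kills \<open>f\<close> and hence factors through \<open>e\<close>.\<close>

lemma epi_cokernel_of_kernel:
  assumes e: "is_epi C e" and k: "is_kernel C e k"
  shows "is_cokernel C k e"
proof (rule is_cokernelI)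
  note [simp] = is_kernelD[OF k]
  obtain f where f: "is_cokernel C f e" using epi_normal[OF e] by blast
  note [simp] = is_cokernelD[OF f]
  obtain u where u [simp]: "u \<in> Arr C" "Dom C u = Dom C f" "Cod C u = Dom C k" and ku: "k \<cdot> u = f"
    by (rule kernel_lift[OF k, of f]) auto
  fix h assume h: "h \<in> Arr C" "Dom C h = Cod C k" "h \<cdot> k = Zero C (Dom C k) (Cod C h)"
  have "h \<cdot> f = (h \<cdot> k) \<cdot> u" using h(1,2) by (simp add: ku)
  also have "\<dots> = Zero C (Dom C f) (Cod C h)" unfolding h(3) using h(1) by simp
  finally obtain v where "v \<in> Arr C" "Dom C v = Cod C e" "Cod C v = Cod C h" "v \<cdot> e = h"
    using cokernel_desc[OF f, of h] h(1,2) by auto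
  then show "\<exists>u\<in>Hom C (Cod C e) (Cod C h). u \<cdot> e = h" by auto
qed (use is_kernelD[OF k] e in auto)

lemma mono_kernel_of_cokernel:
  assumes "is_mono C m" "is_cokernel C m q"
  shows "is_kernel C q m"
proof -
  interpret op: abelian_category "opp C" by (rule abelian_opp) unfold_locales
  show ?thesis using op.epi_cokernel_of_kernel[of m q] assms
    unfolding kernel_opp cokernel_opp epi_opp by blast
qed

lemma short_exactD:
  assumes "short_exact C i p"
  shows "i \<in> Arr C" "p \<in> Arr C" "Cod C i = Dom C p" "p \<cdot> i = Zero C (Dom C i) (Cod C p)"
    "is_kernel C p i" "is_cokernel C i p" "is_mono C i" "is_epi C p"
proof -
  show k: "is_kernel C p i" and c: "is_cokernel C i p" using assms by (auto simp: short_exact_def)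
  show "i \<in> Arr C" "p \<in> Arr C" "Cod C i = Dom C p" "p \<cdot> i = Zero C (Dom C i) (Cod C p)"
    using is_kernelD[OF k] by auto
  show "is_mono C i" "is_epi C p" by (rule kernel_mono[OF k], rule cokernel_epi[OF c])
qed

lemma short_exactI_epi: "is_kernel C p i \<Longrightarrow> is_epi C p \<Longrightarrow> short_exact C i p"
  by (simp add: short_exact_def epi_cokernel_of_kernel)

lemma short_exactI_mono: "is_cokernel C i p \<Longrightarrow> is_mono C i \<Longrightarrow> short_exact C i p"
  by (simp add: short_exact_def mono_kernel_of_cokernel)

text \<open>The cokernel of an epimorphism is zero, and a monomorphism is the kernel of its
  cokernel. So the identity lifts through \<open>h\<close>, giving a right inverse, which is also a
  left inverse because \<open>h\<close> can be cancelled.\<close>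

lemma mono_epi_iso:
  assumes m: "is_mono C h" and e: "is_epi C h"
  shows "is_iso C h"
proof -
  have h [simp]: "h \<in> Arr C" by (rule mono_arr[OF m])
  obtain c where c: "is_cokernel C h c" using cokernels[OF h] by blast
  note [simp] = is_cokernelD(1-3)[OF c]
  have k: "is_kernel C c h" by (rule mono_kernel_of_cokernel[OF m c])
  have "c = Zero C (Cod C h) (Cod C c)" by (rule is_epiD_zero[OF e]) (use is_cokernelD[OF c] in auto)
  then have "c \<cdot> Ident C (Cod C h) = Zero C (Cod C h) (Cod C c)" by simp
  then obtain u where u [simp]: "u \<in> Arr C" "Dom C u = Cod C h" "Cod C u = Dom C h"
    and hu: "h \<cdot> u = Ident C (Cod C h)"
    using kernel_lift[OF k, of "Ident C (Cod C h)"] by auto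
  have "u \<cdot> h = Ident C (Dom C h)"
    by (rule is_monoD[OF m]) (simp_all add: comp_reduce[OF hu])
  then show ?thesis unfolding is_iso_def using hu by (auto intro!: bexI[of _ u])
qed

lemma ext_mor_comp:
  assumes "ext_mor C a b e e'" "ext_mor C a' b' e' e''"
  shows "ext_mor C (a' \<cdot> a) (b' \<cdot> b) e e''"
proof -
  obtain i p i' p' i'' p'' where e: "e = (i, p)" "e' = (i', p')" "e'' = (i'', p'')"
    by (cases e, cases e', cases e'') auto
  obtain g g' where
    g: "g \<in> Hom C (Cod C i) (Cod C i')" "g \<cdot> i = i' \<cdot> a" "p' \<cdot> g = b \<cdot> p" and
    g': "g' \<in> Hom C (Cod C i') (Cod C i'')" "g' \<cdot> i' = i'' \<cdot> a'" "p'' \<cdot> g' = b' \<cdot> p'" and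
    ex: "short_exact C i p" "short_exact C i' p'" "short_exact C i'' p''" and
    ab [simp]: "a \<in> Hom C (Dom C i) (Dom C i')" "b \<in> Hom C (Cod C p) (Cod C p')"
     "a' \<in> Hom C (Dom C i') (Dom C i'')" "b' \<in> Hom C (Cod C p') (Cod C p'')"
    using assms unfolding ext_mor_def e prod.case by blast
  note [simp] = short_exactD(1-3)[OF ex(1)] short_exactD(1-3)[OF ex(2)] short_exactD(1-3)[OF ex(3)]
  have [simp]: "g \<in> Arr C" "Dom C g = Dom C p" "Cod C g = Dom C p'"
    "g' \<in> Arr C" "Dom C g' = Dom C p'" "Cod C g' = Dom C p''" using g(1) g'(1) by auto
  have [simp]: "a \<in> Arr C" "Dom C a = Dom C i" "Cod C a = Dom C i'"
    "b \<in> Arr C" "Dom C b = Cod C p" "Cod C b = Cod C p'"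
    "a' \<in> Arr C" "Dom C a' = Dom C i'" "Cod C a' = Dom C i''"
    "b' \<in> Arr C" "Dom C b' = Cod C p'" "Cod C b' = Cod C p''" using ab by auto
  have 1: "(g' \<cdot> g) \<cdot> i = i'' \<cdot> a' \<cdot> a" by (simp add: g(2) comp_reduce[OF g'(2)])
  have 2: "p'' \<cdot> g' \<cdot> g = (b' \<cdot> b) \<cdot> p" by (simp add: g(3) comp_reduce[OF g'(3)])
  show ?thesis unfolding e ext_mor_def prod.case
    using ex 1 2 by (intro conjI bexI[of _ "g' \<cdot> g"]) simp_all
qed

text \<open>The middle arrows add as well, by bilinearity of composition. This is the source of
  every additivity statement about extensions below.\<close>

lemma ext_mor_add:
  assumes "ext_mor C a b e e'" "ext_mor C a' b' e e'"
  shows "ext_mor C (a \<boxplus> a') (b \<boxplus> b') e e'"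
proof -
  obtain i p i' p' where e: "e = (i, p)" "e' = (i', p')"
    by (cases e, cases e') auto
  obtain g g' where
    g: "g \<in> Hom C (Cod C i) (Cod C i')" "g \<cdot> i = i' \<cdot> a" "p' \<cdot> g = b \<cdot> p" and
    g': "g' \<in> Hom C (Cod C i) (Cod C i')" "g' \<cdot> i = i' \<cdot> a'" "p' \<cdot> g' = b' \<cdot> p" and
    ex: "short_exact C i p" "short_exact C i' p'" and
    ab: "a \<in> Hom C (Dom C i) (Dom C i')" "b \<in> Hom C (Cod C p) (Cod C p')"
     "a' \<in> Hom C (Dom C i) (Dom C i')" "b' \<in> Hom C (Cod C p) (Cod C p')"
    using assms unfolding ext_mor_def e prod.case by blast
  note [simp] = short_exactD(1-3)[OF ex(1)] short_exactD(1-3)[OF ex(2)]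
  show ?thesis unfolding e ext_mor_def prod.case
    using ex g g' ab by (intro conjI bexI[of _ "g \<boxplus> g'"]) simp_all
qed

text \<open>One half of the short five lemma: an arrow killed by \<open>g\<close> is killed by
  \<open>p\<close> because \<open>b\<close> is mono, so it comes from an arrow \<open>u\<close>
  through \<open>i\<close>, and then \<open>i' \<cdot> a\<close> kills \<open>u\<close>. The epi
  half is this statement in the opposite category.\<close>

lemma ext_mor_mono:
  assumes "ext_mor C a b (i, p) (i', p')" "is_mono C a" "is_mono C b"
    and g: "g \<in> Hom C (Cod C i) (Cod C i')" "g \<cdot> i = i' \<cdot> a" "p' \<cdot> g = b \<cdot> p"
  shows "is_mono C g"
proof (rule is_monoI)
  have ex: "short_exact C i p" "short_exact C i' p'"
    and ab: "a \<in> Hom C (Dom C i) (Dom C i')" "b \<in> Hom C (Cod C p) (Cod C p')"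
    using assms(1) unfolding ext_mor_def by auto
  note E = short_exactD[OF ex(1)] and E' = short_exactD[OF ex(2)]
  note [simp] = E(1-3) E'(1-3)
  have [simp]: "g \<in> Arr C" "Dom C g = Dom C p" "Cod C g = Dom C p'"
    "a \<in> Arr C" "Dom C a = Dom C i" "Cod C a = Dom C i'"
    "b \<in> Arr C" "Dom C b = Cod C p" "Cod C b = Cod C p'" using g(1) ab by auto
  show "g \<in> Arr C" by simp
  fix h assume h: "h \<in> Arr C" "Cod C h = Dom C g" "g \<cdot> h = Zero C (Dom C h) (Cod C g)"
  have "b \<cdot> p \<cdot> h = p' \<cdot> g \<cdot> h" using h(1,2) by (simp add: comp_reduce[OF g(3)])
  also have "\<dots> = Zero C (Dom C h) (Cod C b)" unfolding h(3) using h(1) by simp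
  finally have "p \<cdot> h = Zero C (Dom C h) (Dom C b)"
    using h(1,2) by (intro is_monoD_zero[OF assms(3)]) simp_all
  then obtain u where u: "u \<in> Arr C" "Dom C u = Dom C h" "Cod C u = Dom C i" "i \<cdot> u = h"
    using kernel_lift[OF E(5), of h] h(1,2) by auto
  have "i' \<cdot> a \<cdot> u = g \<cdot> i \<cdot> u" using u(1-3) by (simp add: comp_reduce[OF g(2)])
  also have "\<dots> = Zero C (Dom C u) (Cod C i')" using u h by simp
  finally have "a \<cdot> u = Zero C (Dom C u) (Dom C i')"
    using u(1-3) by (intro is_monoD_zero[OF E'(7)]) simp_all
  then have "u = Zero C (Dom C u) (Dom C a)"
    using u(1-3) by (intro is_monoD_zero[OF assms(2)]) simp_all
  then have "i \<cdot> u = i \<cdot> Zero C (Dom C u) (Dom C a)" by (rule arg_cong)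
  then show "h = Zero C (Dom C h) (Dom C g)" using u h(1) by simp
qed

end

lemma short_exact_middle: "short_exact C i p \<Longrightarrow> Cod C i = Dom C p"
  unfolding short_exact_def is_kernel_def by blast

text \<open>\<open>ext_mor\<close> types the middle arrow by \<open>Cod C i\<close>, which duality
  turns into \<open>Dom C p\<close>. The two agree only for exact pairs, whence the case
  distinction; otherwise both sides are false.\<close>

lemma ext_mor_opp: "ext_mor (opp C) b a (p', i') (p, i) \<longleftrightarrow> ext_mor C a b (i, p) (i', p')"
proof (cases "short_exact C i p \<and> short_exact C i' p'")
  case True
  then have "Cod C i = Dom C p" "Cod C i' = Dom C p'" by (simp_all add: short_exact_middle)
  with True show ?thesis
    unfolding ext_mor_def prod.case short_exact_opp Hom_opp opp_simps by (simp only:) blast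
qed (auto simp only: ext_mor_def prod.case short_exact_opp)

section \<open>Yoneda equivalence in terms of morphisms of extensions\<close>

context abelian_category
begin

lemma extensionsD:
  assumes "(i, p) \<in> extensions C X Y"
  shows "short_exact C i p" "i \<in> Arr C" "p \<in> Arr C" "Dom C i = Y" "Cod C i = Dom C p" "Cod C p = X"
    "X \<in> Obj C" "Y \<in> Obj C"
  using assms short_exactD(1-3)[of i p] by (auto simp: extensions_def)

lemma ext_mor_source:
  assumes "ext_mor C a b e e'" "Dom C a = Y" "Dom C b = X"
  shows "e \<in> extensions C X Y"
  using assms by (cases e) (auto simp: ext_mor_def extensions_def)

lemma ext_mor_target:
  assumes "ext_mor C a b e e'" "Cod C a = Y" "Cod C b = X"
  shows "e' \<in> extensions C X Y"
  using assms by (cases e') (auto simp: ext_mor_def extensions_def)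

lemma ext_mor_ident:
  assumes "e \<in> extensions C X Y"
  shows "ext_mor C (Ident C Y) (Ident C X) e e"
proof -
  obtain i p where e: "e = (i, p)" by (cases e)
  note D = extensionsD[OF assms[unfolded e]]
  show ?thesis unfolding e ext_mor_def prod.case
    using D by (intro conjI bexI[of _ "Ident C (Dom C p)"]) simp_all
qed

text \<open>Short five lemma: identities are mono and epi, so the middle arrow is both, hence
  invertible.\<close>

lemma ext_equiv:
  assumes "ext_mor C (Ident C Y) (Ident C X) e e'" "X \<in> Obj C" "Y \<in> Obj C"
  shows "(e, e') \<in> ext_rel C"
proof -
  obtain i p i' p' where e: "e = (i, p)" "e' = (i', p')" by (cases e, cases e') auto
  note m = assms(1)[unfolded e]
  have ee: "(i, p) \<in> extensions C X Y" "(i', p') \<in> extensions C X Y"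
    using ext_mor_source[OF m] ext_mor_target[OF m] assms by auto
  note D = extensionsD[OF ee(1)] and D' = extensionsD[OF ee(2)]
  note [simp] = D(2-) D'(2-)
  obtain g where g: "g \<in> Hom C (Cod C i) (Cod C i')" "g \<cdot> i = i' \<cdot> Ident C Y" "p' \<cdot> g = Ident C X \<cdot> p"
    using m unfolding ext_mor_def by blast
  have I: "is_mono C (Ident C x)" "is_epi C (Ident C x)" if "x \<in> Obj C" for x
    using that by (auto intro!: is_monoI is_epiI)
  have mono: "is_mono C g"
    by (rule ext_mor_mono[OF m I(1) I(1) g]) (use assms in auto)
  interpret op: abelian_category "opp C" by (rule abelian_opp) unfold_locales
  have "is_mono (opp C) g"
    by (rule op.ext_mor_mono[OF m[folded ext_mor_opp[of C]]]) (use I assms g in \<open>auto simp: mono_opp\<close>)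
  then have "is_iso C g" using mono mono_epi_iso unfolding mono_opp by blast
  then show ?thesis unfolding e ext_rel_def using g D D' by auto
qed

text \<open>Frees the equivalence relation from the demand that the middle arrow be invertible, so
  that from here on equivalence is a special case of \<open>ext_mor\<close>.\<close>

lemma ext_rel_iff:
  assumes "e \<in> extensions C X Y"
  shows "(e, e') \<in> ext_rel C \<longleftrightarrow> ext_mor C (Ident C Y) (Ident C X) e e'"
proof
  obtain i p i' p' where e: "e = (i, p)" "e' = (i', p')" by (cases e, cases e') auto
  note D = extensionsD[OF assms[unfolded e]]
  assume "(e, e') \<in> ext_rel C"
  then have D': "short_exact C i' p'" "Dom C i' = Y" "Cod C p' = X"
    and "\<exists>h\<in>Hom C (Cod C i) (Cod C i'). h \<cdot> i = i' \<and> p' \<cdot> h = p"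
    using D unfolding ext_rel_def e by auto
  then obtain h where "h \<in> Hom C (Cod C i) (Cod C i')" "h \<cdot> i = i'" "p' \<cdot> h = p" by blast
  then show "ext_mor C (Ident C Y) (Ident C X) e e'"
    unfolding ext_mor_def e prod.case
    using D D' short_exactD(1-3)[OF D'(1)] by (intro conjI bexI[of _ h]) simp_all
next
  assume "ext_mor C (Ident C Y) (Ident C X) e e'"
  moreover have "X \<in> Obj C" "Y \<in> Obj C" using assms extensionsD(7,8) by (cases e; blast)+
  ultimately show "(e, e') \<in> ext_rel C" by (rule ext_equiv)
qed

lemma ext_rel_sym:
  assumes "(e, e') \<in> ext_rel C"
  shows "(e', e) \<in> ext_rel C"
proof -
  obtain i p i' p' where e: "e = (i, p)" "e' = (i', p')" by (cases e, cases e') auto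
  obtain h where ex: "short_exact C i p" "short_exact C i' p'" and d: "Dom C i = Dom C i'" "Cod C p = Cod C p'"
    and h: "h \<in> Hom C (Cod C i) (Cod C i')" "is_iso C h" "h \<cdot> i = i'" "p' \<cdot> h = p"
    using assms unfolding ext_rel_def e by blast
  note [simp] = short_exactD(1-3)[OF ex(1)] short_exactD(1-3)[OF ex(2)]
  have [simp]: "h \<in> Arr C" "Dom C h = Dom C p" "Cod C h = Dom C p'" using h(1) by auto
  have "\<exists>k\<in>Hom C (Dom C p') (Dom C p). k \<cdot> h = Ident C (Dom C p) \<and> h \<cdot> k = Ident C (Dom C p')"
    using h(2) unfolding is_iso_def by (simp del: mem_Hom)
  then obtain k where kH: "k \<in> Hom C (Dom C p') (Dom C p)"
    and k: "k \<cdot> h = Ident C (Dom C p)" "h \<cdot> k = Ident C (Dom C p')" by blast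
  have [simp]: "k \<in> Arr C" "Dom C k = Dom C p'" "Cod C k = Dom C p" using kH by auto
  have "is_iso C k" unfolding is_iso_def using k by (intro conjI bexI[of _ h]) simp_all
  moreover have "k \<cdot> i' = i" unfolding h(3)[symmetric] by (simp add: comp_reduce[OF k(1)])
  moreover have "p \<cdot> k = p'" unfolding h(4)[symmetric] using k(2) by simp
  ultimately have "\<exists>h\<in>Hom C (Cod C i') (Cod C i). is_iso C h \<and> h \<cdot> i' = i \<and> p \<cdot> h = p'"
    by (intro bexI[of _ k] conjI) simp_all
  then show ?thesis unfolding ext_rel_def e using ex d by simp
qed

text \<open>A map of extensions has no evident reverse; it is found by passing to
  \<open>ext_rel\<close>, where the middle arrow has an inverse.\<close>

lemma ext_mor_sym:
  assumes "ext_mor C (Ident C Y) (Ident C X) e e'" "X \<in> Obj C" "Y \<in> Obj C"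
  shows "ext_mor C (Ident C Y) (Ident C X) e' e"
proof -
  have "e' \<in> extensions C X Y" using ext_mor_target[OF assms(1)] assms by simp
  then show ?thesis using ext_rel_sym[OF ext_equiv[OF assms]] ext_rel_iff by blast
qed

lemma ext_mor_trans:
  assumes "ext_mor C (Ident C Y) (Ident C X) e e'" "ext_mor C (Ident C Y) (Ident C X) e' e''"
    "X \<in> Obj C" "Y \<in> Obj C"
  shows "ext_mor C (Ident C Y) (Ident C X) e e''"
  using ext_mor_comp[OF assms(1,2)] assms(3,4) by simp

lemma ext_class_mem:
  assumes "e \<in> extensions C X Y"
  shows "e' \<in> ext_class C e \<longleftrightarrow> ext_mor C (Ident C Y) (Ident C X) e e'"
  using ext_rel_iff[OF assms] by (auto simp: ext_class_def)

lemma ext_class_self: "e \<in> extensions C X Y \<Longrightarrow> e \<in> ext_class C e"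
  by (simp add: ext_class_mem ext_mor_ident)

lemma ext_obj:
  assumes "e \<in> extensions C X Y"
  shows "X \<in> Obj C" "Y \<in> Obj C"
  using assms by (cases e; blast dest: extensionsD(7,8))+

lemma ext_class_eqI:
  assumes "ext_mor C (Ident C Y) (Ident C X) e e'" "X \<in> Obj C" "Y \<in> Obj C"
  shows "ext_class C e = ext_class C e'"
proof -
  have m: "e \<in> extensions C X Y" "e' \<in> extensions C X Y"
    using ext_mor_source[OF assms(1)] ext_mor_target[OF assms(1)] assms by auto
  show ?thesis
  proof (rule Set.set_eqI)
    fix f show "f \<in> ext_class C e \<longleftrightarrow> f \<in> ext_class C e'"
      using ext_mor_trans[OF assms(1) _ assms(2,3)] ext_mor_trans[OF ext_mor_sym[OF assms] _ assms(2,3)]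
      unfolding ext_class_mem[OF m(1)] ext_class_mem[OF m(2)] by blast
  qed
qed

lemma ext_class_eqD:
  assumes "ext_class C e = ext_class C e'" "e \<in> extensions C X Y" "e' \<in> extensions C X Y"
  shows "ext_mor C (Ident C Y) (Ident C X) e e'"
  using assms ext_class_self ext_class_mem by blast

lemma Ext1_carrier: "carrier (Ext1 C X Y) = ext_class C ` extensions C X Y"
  by (auto simp: Ext1_def ext_class_def quotient_def)

section \<open>Pullbacks of extensions\<close>

lemma biproductE:
  assumes "x \<in> Obj C" "y \<in> Obj C"
  obtains b i j p q where "b \<in> Obj C" "i \<in> Arr C" "Dom C i = x" "Cod C i = b"
    "j \<in> Arr C" "Dom C j = y" "Cod C j = b" "p \<in> Arr C" "Dom C p = b" "Cod C p = x"
    "q \<in> Arr C" "Dom C q = b" "Cod C q = y"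
    "p \<cdot> i = Ident C x" "q \<cdot> j = Ident C y" "q \<cdot> i = Zero C x y" "p \<cdot> j = Zero C y x"
    "i \<cdot> p \<boxplus> j \<cdot> q = Ident C b"
proof -
  obtain i j p q where b: "is_biproduct C x y i j p q" using biproducts[OF assms] by blast
  then obtain b where "b \<in> Obj C" "i \<in> Hom C x b" "j \<in> Hom C y b" "p \<in> Hom C b x" "q \<in> Hom C b y"
    "p \<cdot> i = Ident C x" "q \<cdot> j = Ident C y" "q \<cdot> i = Zero C x y" "p \<cdot> j = Zero C y x"
    "i \<cdot> p \<boxplus> j \<cdot> q = Ident C b"
    unfolding is_biproduct_def by blast
  then show ?thesis by (intro that[of b i j p q]) simp_all
qed

text \<open>The pullback is the kernel \<open>k\<close> of the difference \<open>d\<close> of the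
  two ways from the biproduct of \<open>Dom C p\<close> and \<open>Dom C f\<close> to
  \<open>Cod C p\<close>. The real content is that \<open>q\<close>, the pulled back
  \<open>p\<close>, is again epi.\<close>

lemma pullback_ext_exists:
  assumes ex: "short_exact C i p" and f: "f \<in> Arr C" "Cod C f = Cod C p"
  obtains i' p' where "pullback_ext C f (i, p) (i', p')"
proof -
  note E = short_exactD[OF ex]
  note [simp] = E(1-3) f
  obtain b i1 i2 p1 p2 where b [simp]: "b \<in> Obj C" "i1 \<in> Arr C" "Dom C i1 = Dom C p" "Cod C i1 = b"
    "i2 \<in> Arr C" "Dom C i2 = Dom C f" "Cod C i2 = b" "p1 \<in> Arr C" "Dom C p1 = b" "Cod C p1 = Dom C p"
    "p2 \<in> Arr C" "Dom C p2 = b" "Cod C p2 = Dom C f"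
    and bp: "p1 \<cdot> i1 = Ident C (Dom C p)" "p2 \<cdot> i2 = Ident C (Dom C f)"
      "p2 \<cdot> i1 = Zero C (Dom C p) (Dom C f)" "p1 \<cdot> i2 = Zero C (Dom C f) (Dom C p)"
      "i1 \<cdot> p1 \<boxplus> i2 \<cdot> p2 = Ident C b"
    by (rule biproductE[of "Dom C p" "Dom C f"]) auto
  note bs = bp(1-4) bp(1-4)[THEN comp_reduce]
  define d where "d = p \<cdot> p1 \<boxplus> neg (f \<cdot> p2)"
  have d [simp]: "d \<in> Arr C" "Dom C d = b" "Cod C d = Cod C p" by (simp_all add: d_def)
  have d_comp: "d \<cdot> u = p \<cdot> p1 \<cdot> u \<boxplus> neg (f \<cdot> p2 \<cdot> u)" if "u \<in> Arr C" "Cod C u = b" for u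
    unfolding d_def using that by simp
  obtain k where k: "is_kernel C d k" using kernels d(1) by blast
  note K = is_kernelD[OF k]
  have [simp]: "k \<in> Arr C" "Cod C k = b" using K by auto
  define g q where "g = p1 \<cdot> k" and "q = p2 \<cdot> k"
  have [simp]: "g \<in> Arr C" "Dom C g = Dom C k" "Cod C g = Dom C p"
    "q \<in> Arr C" "Dom C q = Dom C k" "Cod C q = Dom C f" by (simp_all add: g_def q_def)
  have sq: "p \<cdot> g = f \<cdot> q"
  proof (rule eq_if_add_neg_zero)
    show "p \<cdot> g \<boxplus> neg (f \<cdot> q) = Zero C (Dom C (p \<cdot> g)) (Cod C (p \<cdot> g))"
      using K(4) d_comp[of k] by (simp add: g_def q_def)
  qed simp_all
  \<comment> \<open>The projections \<open>g\<close> and \<open>q\<close> are jointly monic, because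
    \<open>k\<close> is mono and is recovered from its two components. Uniqueness in the pullback,
    and the kernel property of \<open>i'\<close>, rest on this.\<close>
  have joint: "u = v" if "u \<in> Arr C" "v \<in> Arr C" "Dom C v = Dom C u" "Cod C u = Dom C k" "Cod C v = Dom C k"
    "g \<cdot> u = g \<cdot> v" "q \<cdot> u = q \<cdot> v" for u v
  proof -
    have *: "k \<cdot> w = i1 \<cdot> (g \<cdot> w) \<boxplus> i2 \<cdot> (q \<cdot> w)" if "w \<in> Arr C" "Cod C w = Dom C k" for w
    proof -
      have "k \<cdot> w = (i1 \<cdot> p1 \<boxplus> i2 \<cdot> p2) \<cdot> k \<cdot> w" unfolding bp(5) using that by simp
      then show ?thesis unfolding g_def q_def using that by simp
    qed
    have "k \<cdot> u = k \<cdot> v" unfolding *[OF that(1,4)] *[OF that(2,5)] that(6,7) by (rule refl)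
    then show "u = v" by (rule is_monoD[OF kernel_mono[OF k]]) (use that in auto)
  qed
  have fill: "\<exists>u. u \<in> Hom C (Dom C r) (Dom C k) \<and> g \<cdot> u = r \<and> q \<cdot> u = s"
    if rs: "r \<in> Arr C" "s \<in> Arr C" "Dom C s = Dom C r" "Cod C r = Dom C p" "Cod C s = Dom C f"
    "p \<cdot> r = f \<cdot> s" for r s
  proof -
    have "d \<cdot> (i1 \<cdot> r \<boxplus> i2 \<cdot> s) = p \<cdot> r \<boxplus> neg (f \<cdot> s)"
      using rs(1-5) by (subst d_comp) (simp_all add: bs)
    then have "d \<cdot> (i1 \<cdot> r \<boxplus> i2 \<cdot> s) = Zero C (Dom C r) (Cod C d)"
      using rs by simp
    then obtain u where u: "u \<in> Arr C" "Dom C u = Dom C r" "Cod C u = Dom C k"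
      "k \<cdot> u = i1 \<cdot> r \<boxplus> i2 \<cdot> s"
      using kernel_lift[OF k, of "i1 \<cdot> r \<boxplus> i2 \<cdot> s"] rs(1-5) by auto
    have "g \<cdot> u = p1 \<cdot> k \<cdot> u" "q \<cdot> u = p2 \<cdot> k \<cdot> u" unfolding g_def q_def using u(1,3) by simp_all
    then have "g \<cdot> u = r" "q \<cdot> u = s" unfolding u(4) using rs(1-5) by (simp_all add: bs)
    then show ?thesis using u by auto
  qed
  have pb: "is_pullback C p f g q"
    unfolding is_pullback_def
  proof (intro conjI allI ballI impI)
    fix w r s assume rs: "r \<in> Hom C w (Dom C p)" "s \<in> Hom C w (Dom C f)" "p \<cdot> r = f \<cdot> s"
    then obtain u where u: "u \<in> Hom C w (Dom C g) \<and> g \<cdot> u = r \<and> q \<cdot> u = s"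
      using fill[of r s] by auto
    show "\<exists>!u. u \<in> Hom C w (Dom C g) \<and> g \<cdot> u = r \<and> q \<cdot> u = s"
    proof (rule ex1I)
      show "u \<in> Hom C w (Dom C g) \<and> g \<cdot> u = r \<and> q \<cdot> u = s" by (rule u)
      fix v assume "v \<in> Hom C w (Dom C g) \<and> g \<cdot> v = r \<and> q \<cdot> v = s"
      with u show "v = u" using joint[of v u] by simp
    qed
  qed (simp_all add: sq)
  \<comment> \<open>Both \<open>i\<close> and the zero arrow become zero over
    \<open>Cod C p\<close>, so together they lift to the pullback.\<close>
  obtain i' where i' [simp]: "i' \<in> Arr C" "Dom C i' = Dom C i" "Cod C i' = Dom C k"
    and gi: "g \<cdot> i' = i" and qi: "q \<cdot> i' = Zero C (Dom C i) (Dom C f)"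
    using fill[of i "Zero C (Dom C i) (Dom C f)"] E(4) by auto
  have mono: "is_mono C i'"
  proof (rule is_monoI)
    fix h assume h: "h \<in> Arr C" "Cod C h = Dom C i'" "i' \<cdot> h = Zero C (Dom C h) (Cod C i')"
    have "i \<cdot> h = g \<cdot> i' \<cdot> h" using h(1,2) by (simp add: comp_reduce[OF gi])
    also have "\<dots> = Zero C (Dom C h) (Cod C i)" unfolding h(3) using h(1,2) by simp
    finally show "h = Zero C (Dom C h) (Dom C i')"
      using h(1,2) is_monoD_zero[OF E(7) h(1)] by simp
  qed simp
  have ker: "is_kernel C q i'"
  proof (rule is_kernelI)
    fix h assume h: "h \<in> Arr C" "Cod C h = Dom C q" "q \<cdot> h = Zero C (Dom C h) (Cod C q)"
    have "p \<cdot> g \<cdot> h = f \<cdot> q \<cdot> h" using h(1,2) by (simp add: comp_reduce[OF sq])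
    then have "p \<cdot> g \<cdot> h = Zero C (Dom C h) (Cod C p)" unfolding h(3) using h(1,2) by simp
    then obtain u where u: "u \<in> Arr C" "Dom C u = Dom C h" "Cod C u = Dom C i" "i \<cdot> u = g \<cdot> h"
      using kernel_lift[OF E(5), of "g \<cdot> h"] h(1,2) by auto
    have "i' \<cdot> u = h"
    proof (rule joint)
      show "g \<cdot> i' \<cdot> u = g \<cdot> h" using u by (simp add: comp_reduce[OF gi])
      show "q \<cdot> i' \<cdot> u = q \<cdot> h" unfolding h(3) using u by (simp add: comp_reduce[OF qi])
    qed (use h(1,2) u in simp_all)
    then show "\<exists>u\<in>Hom C (Dom C h) (Dom C i'). i' \<cdot> u = h" using u by auto
  qed (simp_all add: qi mono)
  \<comment> \<open>Restricted to the first summand \<open>d\<close> is the epimorphism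
    \<open>p\<close>. Hence \<open>d\<close> is epi, and therefore the cokernel of its kernel
    \<open>k\<close>.\<close>
  have d1: "d \<cdot> i1 = p" using d_comp[of i1] by (simp add: bs)
  have epi_d: "is_epi C d"
  proof (rule is_epiI)
    fix w assume w: "w \<in> Arr C" "Dom C w = Cod C d" "w \<cdot> d = Zero C (Dom C d) (Cod C w)"
    have "w \<cdot> p = (w \<cdot> d) \<cdot> i1" using w(1,2) by (simp add: d1)
    also have "\<dots> = Zero C (Dom C p) (Cod C w)" unfolding w(3) using w(1,2) by simp
    finally show "w = Zero C (Cod C d) (Cod C w)"
      using w(1,2) is_epiD_zero[OF E(8) w(1)] by simp
  qed simp
  have cok: "is_cokernel C k d" by (rule epi_cokernel_of_kernel[OF epi_d k])
  \<comment> \<open>If \<open>u\<close> kills \<open>q\<close>, then \<open>u \<cdot> p2\<close>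
    vanishes on \<open>k\<close> and so equals \<open>v \<cdot> d\<close> for some \<open>v\<close>.
    On the first summand this says \<open>v \<cdot> p = 0\<close>, so \<open>v\<close> is zero; on
    the second it then says that \<open>u\<close> is zero.\<close>
  have epi: "is_epi C q"
  proof (rule is_epiI)
    fix u assume u: "u \<in> Arr C" "Dom C u = Cod C q" "u \<cdot> q = Zero C (Dom C q) (Cod C u)"
    have "(u \<cdot> p2) \<cdot> k = Zero C (Dom C k) (Cod C u)" using u by (simp add: q_def)
    then obtain v where v: "v \<in> Arr C" "Dom C v = Cod C p" "Cod C v = Cod C u" "v \<cdot> d = u \<cdot> p2"
      using cokernel_desc[OF cok, of "u \<cdot> p2"] u(1,2) by auto
    have "v \<cdot> p = (v \<cdot> d) \<cdot> i1" using v(1,2) by (simp add: d1)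
    also have "\<dots> = Zero C (Dom C p) (Cod C u)" unfolding v(4) using u(1,2) by (simp add: bs)
    finally have v0: "v = Zero C (Cod C p) (Cod C u)"
      using v(1-3) by (intro is_epiD_zero[OF E(8)]) simp_all
    have "u = (u \<cdot> p2) \<cdot> i2" using u(1,2) by (simp add: bs)
    also have "\<dots> = Zero C (Dom C f) (Cod C u)" unfolding v(4)[symmetric] v0 using u(1,2) by simp
    finally show "u = Zero C (Cod C q) (Cod C u)" by simp
  qed simp
  have "short_exact C i' q" by (rule short_exactI_epi[OF ker epi])
  then have "pullback_ext C f (i, p) (i', q)"
    unfolding pullback_ext_def prod.case using ex pb gi i' by auto
  then show ?thesis by (rule that)
qed

lemma ext_morD:
  assumes "ext_mor C a b e e'"
  shows "a \<in> Arr C" "b \<in> Arr C" "e \<in> extensions C (Dom C b) (Dom C a)"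
    "e' \<in> extensions C (Cod C b) (Cod C a)"
proof -
  show "a \<in> Arr C" "b \<in> Arr C" using assms by (auto simp: ext_mor_def)
  show "e \<in> extensions C (Dom C b) (Dom C a)" "e' \<in> extensions C (Cod C b) (Cod C a)"
    using ext_mor_source[OF assms] ext_mor_target[OF assms] by simp_all
qed

lemma pullback_ext_mor:
  assumes "pullback_ext C f e e'" "e \<in> extensions C X Y"
  shows "ext_mor C (Ident C Y) f e' e"
proof -
  obtain i p i' p' where e: "e = (i, p)" "e' = (i', p')" by (cases e, cases e') auto
  obtain g where ex: "short_exact C i p" "short_exact C i' p'" "Dom C i' = Dom C i"
    and pb: "is_pullback C p f g p'" and gi: "g \<cdot> i' = i"
    using assms(1) unfolding e pullback_ext_def prod.case by blast
  note D = extensionsD[OF assms(2)[unfolded e]]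
  note [simp] = D(2-) short_exactD(1-3)[OF ex(2)] ex(3)
  have [simp]: "g \<in> Arr C" "Dom C g = Dom C p'" "Cod C g = Dom C p" "f \<in> Arr C"
    "Dom C f = Cod C p'" "Cod C f = X" and sq: "p \<cdot> g = f \<cdot> p'"
    using pb unfolding is_pullback_def by auto
  show ?thesis unfolding e ext_mor_def prod.case
    using ex sq gi by (intro conjI bexI[of _ g]) simp_all
qed

text \<open>The middle arrow is induced by the universal property from \<open>h\<close> and
  \<open>b \<cdot> r\<close>, which settles the right square at once.\<close>

lemma pullback_ext_factor:
  assumes pull: "pullback_ext C f e1 e2" and m: "ext_mor C a (f \<cdot> b) e0 e1"
    and b: "b \<in> Arr C" "Cod C b = Dom C f"
  shows "ext_mor C a b e0 e2"
proof -
  obtain i p i' p' j r where e: "e1 = (i, p)" "e2 = (i', p')" "e0 = (j, r)"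
    by (cases e1, cases e2, cases e0) auto
  obtain g where ex: "short_exact C i p" "short_exact C i' p'" "Dom C i' = Dom C i"
    and pb: "is_pullback C p f g p'" and gi: "g \<cdot> i' = i"
    using pull unfolding e pullback_ext_def prod.case by blast
  obtain h where ex0: "short_exact C j r" and a: "a \<in> Hom C (Dom C j) (Dom C i)"
    and fb: "f \<cdot> b \<in> Hom C (Cod C r) (Cod C p)"
    and h: "h \<in> Hom C (Cod C j) (Cod C i)" "h \<cdot> j = i \<cdot> a" "p \<cdot> h = (f \<cdot> b) \<cdot> r"
    using m unfolding e ext_mor_def prod.case by blast
  note E = short_exactD[OF ex(1)] and E' = short_exactD[OF ex(2)] and E0 = short_exactD[OF ex0]
  note [simp] = E(1-3) E'(1-3) E0(1-3) ex(3)
  have [simp]: "g \<in> Arr C" "Dom C g = Dom C p'" "Cod C g = Dom C p" "f \<in> Arr C"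
    "Dom C f = Cod C p'" "Cod C f = Cod C p" and sq: "p \<cdot> g = f \<cdot> p'"
    using pb unfolding is_pullback_def by auto
  have [simp]: "a \<in> Arr C" "Dom C a = Dom C j" "Cod C a = Dom C i"
    "h \<in> Arr C" "Dom C h = Dom C r" "Cod C h = Dom C p" using a h(1) by auto
  have [simp]: "b \<in> Arr C" "Dom C b = Cod C r" "Cod C b = Cod C p'" using b fb by simp_all
  have univ: "\<exists>!u. u \<in> Hom C w (Dom C g) \<and> g \<cdot> u = x \<and> p' \<cdot> u = s"
    if "x \<in> Hom C w (Dom C p)" "s \<in> Hom C w (Dom C f)" "p \<cdot> x = f \<cdot> s" for w x s
    using pb that unfolding is_pullback_def by blast
  have "p \<cdot> h = f \<cdot> b \<cdot> r" using h(3) by simp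
  then obtain u where "u \<in> Hom C (Dom C r) (Dom C g)" and gu: "g \<cdot> u = h" and pu: "p' \<cdot> u = b \<cdot> r"
    using univ[of h "Dom C r" "b \<cdot> r"] by auto
  then have [simp]: "u \<in> Arr C" "Dom C u = Dom C r" "Cod C u = Dom C p'" by simp_all
  \<comment> \<open>The left square is not part of the problem that defines \<open>u\<close>. It
    commutes because \<open>u \<cdot> j\<close> and \<open>i' \<cdot> a\<close> solve the same
    pullback problem, with data \<open>i \<cdot> a\<close> and zero.\<close>
  have "g \<cdot> u \<cdot> j = i \<cdot> a" using h(2) by (simp add: comp_reduce[OF gu])
  moreover have "g \<cdot> i' \<cdot> a = i \<cdot> a" by (simp add: comp_reduce[OF gi])
  moreover have "p' \<cdot> u \<cdot> j = Zero C (Dom C j) (Dom C f)" by (simp add: comp_reduce[OF pu] E0(4))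
  moreover have "p' \<cdot> i' \<cdot> a = Zero C (Dom C j) (Dom C f)" by (simp add: comp_reduce[OF E'(4)])
  moreover have "\<exists>!u. u \<in> Hom C (Dom C j) (Dom C g) \<and> g \<cdot> u = i \<cdot> a \<and> p' \<cdot> u = Zero C (Dom C j) (Dom C f)"
    by (rule univ) (simp_all add: comp_reduce[OF E(4)])
  moreover have "u \<cdot> j \<in> Hom C (Dom C j) (Dom C g)" "i' \<cdot> a \<in> Hom C (Dom C j) (Dom C g)"
    by simp_all
  ultimately have "u \<cdot> j = i' \<cdot> a" by blast
  then show ?thesis unfolding e ext_mor_def prod.case
    using ex ex0 pu by (intro conjI bexI[of _ u]) simp_all
qed

lemma pull_exists:
  assumes "e \<in> extensions C X Y" "f \<in> Arr C" "Cod C f = X"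
  obtains e' where "pullback_ext C f e e'" "ext_mor C (Ident C Y) f e' e"
proof -
  obtain i p where e: "e = (i, p)" by (cases e)
  note D = extensionsD[OF assms(1)[unfolded e]]
  obtain i' p' where "pullback_ext C f (i, p) (i', p')"
    using pullback_ext_exists[OF D(1), of f] D(6) assms(2,3) by auto
  then show ?thesis using that pullback_ext_mor assms(1) unfolding e by blast
qed

text \<open>Any map that is the identity on the left serves as a pullback: a genuine pullback
  \<open>e3\<close> of \<open>e1\<close> receives maps from both \<open>e0\<close> and
  \<open>e2\<close>, and the one from \<open>e2\<close> is an equivalence, hence reversible.\<close>

lemma pull_factor:
  assumes m: "ext_mor C a (f \<cdot> b) e0 e1" "ext_mor C (Ident C Y) f e2 e1" "Y \<in> Obj C"
    and b: "b \<in> Arr C" "Cod C b = Dom C f"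
  shows "ext_mor C a b e0 e2"
proof -
  note f = ext_morD[OF m(2)]
  obtain e3 where e3: "pullback_ext C f e1 e3"
    using pull_exists[OF f(4) f(2)] by blast
  have "ext_mor C a b e0 e3" by (rule pullback_ext_factor[OF e3 m(1) b])
  moreover have "ext_mor C (Ident C Y) (Ident C (Dom C f)) e2 e3"
    by (rule pullback_ext_factor[OF e3]) (use m f in simp_all)
  then have "ext_mor C (Ident C Y) (Ident C (Dom C f)) e3 e2"
    using f(2) m(3) by - (rule ext_mor_sym; simp)
  ultimately have "ext_mor C (Ident C Y \<cdot> a) (Ident C (Dom C f) \<cdot> b) e0 e2" by (rule ext_mor_comp)
  \<comment> \<open>The left end of \<open>e1\<close> is read off in two ways, which identifies
    \<open>Cod C a\<close> with \<open>Y\<close>.\<close>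
  moreover have "e1 \<in> extensions C (Cod C (f \<cdot> b)) (Cod C a)" "e1 \<in> extensions C (Cod C f) Y"
    using ext_morD(4)[OF m(1)] f(4) m(3) by simp_all
  then have "Cod C a = Y" unfolding extensions_def by auto
  ultimately show ?thesis using b ext_morD(1)[OF m(1)] by simp
qed

text \<open>Collapses the double union in \<open>ext_pull\<close>: every pullback of every
  representative maps to \<open>e\<close> with outer arrows \<open>1\<close> and \<open>f\<close>,
  hence is equivalent to \<open>e'\<close>.\<close>

lemma ext_pull_eq:
  assumes m: "ext_mor C (Ident C Y) f e' e" and Y: "Y \<in> Obj C"
  shows "ext_pull C f (ext_class C e) = ext_class C e'"
proof -
  note f = ext_morD[OF m]
  have [simp]: "Dom C (Ident C Y) = Y" "Cod C (Ident C Y) = Y" using Y by simp_all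
  note fs = f[simplified]
  have "ext_class C e2 = ext_class C e'" if "e1 \<in> ext_class C e" "pullback_ext C f e1 e2" for e1 e2
  proof (rule ext_class_eqI)
    have m1: "ext_mor C (Ident C Y) (Ident C (Cod C f)) e e1" using that(1) ext_class_mem[OF fs(4)] by blast
    have e1: "e1 \<in> extensions C (Cod C f) Y" using ext_morD(4)[OF m1] fs(2) by simp
    have "ext_mor C (Ident C Y) f e2 e1" by (rule pullback_ext_mor[OF that(2) e1])
    from ext_mor_comp[OF this ext_mor_sym[OF m1]] have "ext_mor C (Ident C Y) (f \<cdot> Ident C (Dom C f)) e2 e"
      using fs(2) Y by simp
    from pull_factor[OF this m Y] show "ext_mor C (Ident C Y) (Ident C (Dom C f)) e2 e'" using fs(2) by simp
  qed (use fs(2) Y in simp_all)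
  moreover obtain e2 where "pullback_ext C f e e2" using pull_exists[OF fs(4,2)] by blast
  moreover have "e \<in> ext_class C e" by (rule ext_class_self[OF fs(4)])
  ultimately show ?thesis unfolding ext_pull_def by blast
qed

section \<open>Pushouts of extensions, by duality\<close>

lemma pushout_ext_mor:
  assumes "pushout_ext C f e e'" "e \<in> extensions C X Y"
  shows "ext_mor C f (Ident C X) e e'"
proof -
  interpret op: abelian_category "opp C" by (rule abelian_opp) unfold_locales
  obtain i p i' p' where e: "e = (i, p)" "e' = (i', p')" by (cases e, cases e') auto
  have "(p, i) \<in> extensions (opp C) Y X"
    using assms(2) unfolding e by (simp add: extensions_def short_exact_opp)
  from op.pullback_ext_mor[OF assms(1)[unfolded e pullback_ext_opp[symmetric]] this]
  show ?thesis unfolding e by (simp add: ext_mor_opp)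
qed

lemma push_exists:
  assumes "e \<in> extensions C X Y" "f \<in> Arr C" "Dom C f = Y"
  obtains e' where "pushout_ext C f e e'" "ext_mor C f (Ident C X) e e'"
proof -
  interpret op: abelian_category "opp C" by (rule abelian_opp) unfold_locales
  obtain i p where e: "e = (i, p)" by (cases e)
  have "(p, i) \<in> extensions (opp C) Y X"
    using assms(1) unfolding e by (simp add: extensions_def short_exact_opp)
  then obtain i' p' where "pullback_ext (opp C) f (p, i) (p', i')"
    using op.pull_exists[of "(p, i)" Y X f] assms(2,3) by (metis opp_simps(2,4) surj_pair)
  then show ?thesis using that pushout_ext_mor assms(1) unfolding e pullback_ext_opp by blast
qed

lemma push_factor:
  assumes m: "ext_mor C (b \<cdot> f) c e1 e0" "ext_mor C f (Ident C X) e1 e2" "X \<in> Obj C"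
    and b: "b \<in> Arr C" "Dom C b = Cod C f"
  shows "ext_mor C b c e2 e0"
proof -
  interpret op: abelian_category "opp C" by (rule abelian_opp) unfold_locales
  obtain i0 p0 i1 p1 i2 p2 where e: "e0 = (i0, p0)" "e1 = (i1, p1)" "e2 = (i2, p2)"
    by (cases e0, cases e1, cases e2) auto
  have "ext_mor (opp C) c (f \<cdot>\<^bsub>opp C\<^esub> b) (p0, i0) (p1, i1)"
    "ext_mor (opp C) (Ident (opp C) X) f (p2, i2) (p1, i1)"
    using m unfolding e by (simp_all add: ext_mor_opp)
  then have "ext_mor (opp C) c b (p0, i0) (p2, i2)"
    by (rule op.pull_factor) (use m(3) b in simp_all)
  then show ?thesis unfolding e by (simp add: ext_mor_opp)
qed

text \<open>Mirrors the argument for \<open>ext_pull_eq\<close> instead of dualising it, because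
  classes in \<open>opp C\<close> consist of reversed pairs.\<close>

lemma ext_push_eq:
  assumes m: "ext_mor C f (Ident C X) e e'" and X: "X \<in> Obj C"
  shows "ext_push C f (ext_class C e) = ext_class C e'"
proof -
  note f = ext_morD[OF m]
  have [simp]: "Dom C (Ident C X) = X" "Cod C (Ident C X) = X" using X by simp_all
  note fs = f[simplified]
  have "ext_class C e2 = ext_class C e'" if "e1 \<in> ext_class C e" "pushout_ext C f e1 e2" for e1 e2
  proof (rule ext_class_eqI[symmetric])
    have m1: "ext_mor C (Ident C (Dom C f)) (Ident C X) e e1" using that(1) ext_class_mem[OF fs(3)] by blast
    have e1: "e1 \<in> extensions C X (Dom C f)" using ext_morD(4)[OF m1] fs(1) by simp
    have "ext_mor C f (Ident C X) e1 e2" by (rule pushout_ext_mor[OF that(2) e1])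
    from ext_mor_comp[OF m1 this] have "ext_mor C (Ident C (Cod C f) \<cdot> f) (Ident C X) e e2"
      using fs(1) X by simp
    from push_factor[OF this m X] show "ext_mor C (Ident C (Cod C f)) (Ident C X) e' e2" using fs(1) by simp
  qed (use fs(1) X in simp_all)
  moreover obtain e2 where "pushout_ext C f e e2" using push_exists[OF fs(3,1)] by blast
  moreover have "e \<in> ext_class C e" by (rule ext_class_self[OF fs(3)])
  ultimately show ?thesis unfolding ext_push_def by blast
qed

end

section \<open>Biproducts and Baer sums\<close>

context abelian_category
begin

text \<open>A chosen biproduct is stored as its four arrows only; this recovers the object.\<close>

definition bip :: "'o \<Rightarrow> 'o \<Rightarrow> 'o" where
  "bip x y = Cod C (in1 C x y)"

lemma biprod_simps [simp]:
  assumes "x \<in> Obj C" "y \<in> Obj C"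
  shows "bip x y \<in> Obj C"
    "in1 C x y \<in> Arr C" "Dom C (in1 C x y) = x" "Cod C (in1 C x y) = bip x y"
    "in2 C x y \<in> Arr C" "Dom C (in2 C x y) = y" "Cod C (in2 C x y) = bip x y"
    "pr1 C x y \<in> Arr C" "Dom C (pr1 C x y) = bip x y" "Cod C (pr1 C x y) = x"
    "pr2 C x y \<in> Arr C" "Dom C (pr2 C x y) = bip x y" "Cod C (pr2 C x y) = y"
    "pr1 C x y \<cdot> in1 C x y = Ident C x" "pr2 C x y \<cdot> in2 C x y = Ident C y"
    "pr2 C x y \<cdot> in1 C x y = Zero C x y" "pr1 C x y \<cdot> in2 C x y = Zero C y x"
  and biprod_sum: "in1 C x y \<cdot> pr1 C x y \<boxplus> in2 C x y \<cdot> pr2 C x y = Ident C (bip x y)"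
proof -
  have "\<exists>z. case z of (i, j, p, q) \<Rightarrow> is_biproduct C x y i j p q" using biproducts[OF assms] by auto
  then have "case biprod C x y of (i, j, p, q) \<Rightarrow> is_biproduct C x y i j p q"
    unfolding biprod_def by (rule someI_ex)
  then have "is_biproduct C x y (in1 C x y) (in2 C x y) (pr1 C x y) (pr2 C x y)"
    unfolding in1_def in2_def pr1_def pr2_def by (cases "biprod C x y") simp
  then obtain b where b: "b \<in> Obj C" "in1 C x y \<in> Hom C x b" "in2 C x y \<in> Hom C y b"
     "pr1 C x y \<in> Hom C b x" "pr2 C x y \<in> Hom C b y"
     "pr1 C x y \<cdot> in1 C x y = Ident C x" "pr2 C x y \<cdot> in2 C x y = Ident C y"
    "pr2 C x y \<cdot> in1 C x y = Zero C x y" "pr1 C x y \<cdot> in2 C x y = Zero C y x"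
    "in1 C x y \<cdot> pr1 C x y \<boxplus> in2 C x y \<cdot> pr2 C x y = Ident C b"
    unfolding is_biproduct_def by blast
  have "bip x y = b" using b(2) unfolding bip_def by simp
  then show "bip x y \<in> Obj C"
    "in1 C x y \<in> Arr C" "Dom C (in1 C x y) = x" "Cod C (in1 C x y) = bip x y"
    "in2 C x y \<in> Arr C" "Dom C (in2 C x y) = y" "Cod C (in2 C x y) = bip x y"
    "pr1 C x y \<in> Arr C" "Dom C (pr1 C x y) = bip x y" "Cod C (pr1 C x y) = x"
    "pr2 C x y \<in> Arr C" "Dom C (pr2 C x y) = bip x y" "Cod C (pr2 C x y) = y"
    "pr1 C x y \<cdot> in1 C x y = Ident C x" "pr2 C x y \<cdot> in2 C x y = Ident C y"
    "pr2 C x y \<cdot> in1 C x y = Zero C x y" "pr1 C x y \<cdot> in2 C x y = Zero C y x"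
    "in1 C x y \<cdot> pr1 C x y \<boxplus> in2 C x y \<cdot> pr2 C x y = Ident C (bip x y)"
    using b by simp_all
qed

lemma biprod_reduce [simp]:
  assumes "x \<in> Obj C" "y \<in> Obj C" "u \<in> Arr C"
  shows "Cod C u = x \<Longrightarrow> pr1 C x y \<cdot> in1 C x y \<cdot> u = u"
    "Cod C u = y \<Longrightarrow> pr2 C x y \<cdot> in2 C x y \<cdot> u = u"
    "Cod C u = x \<Longrightarrow> pr2 C x y \<cdot> in1 C x y \<cdot> u = Zero C (Dom C u) y"
    "Cod C u = y \<Longrightarrow> pr1 C x y \<cdot> in2 C x y \<cdot> u = Zero C (Dom C u) x"
  using assms by (simp_all add: biprod_simps(14-17)[OF assms(1,2), THEN comp_reduce])

lemma biprod_eqI: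
  assumes "f \<in> Arr C" "g \<in> Arr C" "Dom C g = Dom C f" "Cod C f = bip x y" "Cod C g = bip x y"
    "x \<in> Obj C" "y \<in> Obj C" "pr1 C x y \<cdot> f = pr1 C x y \<cdot> g" "pr2 C x y \<cdot> f = pr2 C x y \<cdot> g"
  shows "f = g"
proof -
  have *: "h = in1 C x y \<cdot> pr1 C x y \<cdot> h \<boxplus> in2 C x y \<cdot> pr2 C x y \<cdot> h" (is "_ = ?r")
    if "h \<in> Arr C" "Cod C h = bip x y" for h
  proof -
    have "h = (in1 C x y \<cdot> pr1 C x y \<boxplus> in2 C x y \<cdot> pr2 C x y) \<cdot> h"
      using assms(6,7) that by simp
    also have "\<dots> = ?r" using assms(6,7) that by (subst comp_add add_comp) simp_all
    finally show ?thesis .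
  qed
  show ?thesis by (subst *[OF assms(1,4)], subst *[OF assms(2,5)]) (simp only: assms(8,9))
qed

lemma biprod_co_eqI:
  assumes "f \<in> Arr C" "g \<in> Arr C" "Cod C g = Cod C f" "Dom C f = bip x y" "Dom C g = bip x y"
    "x \<in> Obj C" "y \<in> Obj C" "f \<cdot> in1 C x y = g \<cdot> in1 C x y" "f \<cdot> in2 C x y = g \<cdot> in2 C x y"
  shows "f = g"
proof -
  have *: "h = (h \<cdot> in1 C x y) \<cdot> pr1 C x y \<boxplus> (h \<cdot> in2 C x y) \<cdot> pr2 C x y" (is "_ = ?r")
    if "h \<in> Arr C" "Dom C h = bip x y" for h
  proof -
    have "h = h \<cdot> (in1 C x y \<cdot> pr1 C x y \<boxplus> in2 C x y \<cdot> pr2 C x y)"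
      using assms(6,7) that by simp
    also have "\<dots> = ?r" using assms(6,7) that by (subst comp_add add_comp) simp_all
    finally show ?thesis .
  qed
  show ?thesis by (subst *[OF assms(1,4)], subst *[OF assms(2,5)]) (simp only: assms(8,9))
qed

section \<open>Direct sums of arrows and of extensions\<close>

lemma dsum_simps [simp]:
  assumes "f \<in> Arr C" "g \<in> Arr C" "x = Dom C f" "y = Dom C g" "x' = Cod C f" "y' = Cod C g"
  shows "dsum C f g \<in> Arr C" "Dom C (dsum C f g) = bip (Dom C f) (Dom C g)"
    "Cod C (dsum C f g) = bip (Cod C f) (Cod C g)"
    "dsum C f g \<cdot> in1 C x y = in1 C x' y' \<cdot> f" "dsum C f g \<cdot> in2 C x y = in2 C x' y' \<cdot> g"
    "pr1 C x' y' \<cdot> dsum C f g = f \<cdot> pr1 C x y" "pr2 C x' y' \<cdot> dsum C f g = g \<cdot> pr2 C x y"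
  using assms by (simp_all add: dsum_def)

lemma dsum_reduce [simp]:
  assumes "f \<in> Arr C" "g \<in> Arr C" "x = Dom C f" "y = Dom C g" "x' = Cod C f" "y' = Cod C g" "u \<in> Arr C"
  shows "Cod C u = x \<Longrightarrow> dsum C f g \<cdot> in1 C x y \<cdot> u = in1 C x' y' \<cdot> f \<cdot> u"
    "Cod C u = y \<Longrightarrow> dsum C f g \<cdot> in2 C x y \<cdot> u = in2 C x' y' \<cdot> g \<cdot> u"
    "Cod C u = bip x y \<Longrightarrow> pr1 C x' y' \<cdot> dsum C f g \<cdot> u = f \<cdot> pr1 C x y \<cdot> u"
    "Cod C u = bip x y \<Longrightarrow> pr2 C x' y' \<cdot> dsum C f g \<cdot> u = g \<cdot> pr2 C x y \<cdot> u"
  using assms(1,2,7) unfolding assms(3-6)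
  by (simp_all add: dsum_simps(4-7)[OF assms(1,2) refl refl refl refl, THEN comp_reduce])

lemma dsum_ident: "x \<in> Obj C \<Longrightarrow> y \<in> Obj C \<Longrightarrow> dsum C (Ident C x) (Ident C y) = Ident C (bip x y)"
  by (rule biprod_eqI[of _ _ x y]) simp_all

lemma dsum_comp:
  assumes "f \<in> Arr C" "g \<in> Arr C" "f' \<in> Arr C" "g' \<in> Arr C" "Dom C f' = Cod C f" "Dom C g' = Cod C g"
  shows "dsum C (f' \<cdot> f) (g' \<cdot> g) = dsum C f' g' \<cdot> dsum C f g"
  by (rule biprod_eqI[of _ _ "Cod C f'" "Cod C g'"]) (use assms in simp_all)

text \<open>Everything is tested on components: projections detect that the sum of the
  \<open>i\<close> is mono, injections that the sum of the \<open>p\<close> is epi.\<close>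

lemma dsum_extension:
  assumes "(i, p) \<in> extensions C X Y" "(i', p') \<in> extensions C X' Y'"
  shows "(dsum C i i', dsum C p p') \<in> extensions C (bip X X') (bip Y Y')"
proof -
  note D = extensionsD[OF assms(1)] and D' = extensionsD[OF assms(2)]
  note E = short_exactD[OF D(1)] and E' = short_exactD[OF D'(1)]
  note [simp] = D(2-) D'(2-)
  have pi: "p \<cdot> i = Zero C Y X" "p' \<cdot> i' = Zero C Y' X'" using E(4) E'(4) by simp_all
  have mono: "is_mono C (dsum C i i')"
  proof (rule is_monoI)
    fix h assume h: "h \<in> Arr C" "Cod C h = Dom C (dsum C i i')"
      "dsum C i i' \<cdot> h = Zero C (Dom C h) (Cod C (dsum C i i'))"
    have "i \<cdot> pr1 C Y Y' \<cdot> h = pr1 C (Dom C p) (Dom C p') \<cdot> dsum C i i' \<cdot> h"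
      "i' \<cdot> pr2 C Y Y' \<cdot> h = pr2 C (Dom C p) (Dom C p') \<cdot> dsum C i i' \<cdot> h" using h(1,2) by simp_all
    then have "i \<cdot> pr1 C Y Y' \<cdot> h = Zero C (Dom C h) (Cod C i)" "i' \<cdot> pr2 C Y Y' \<cdot> h = Zero C (Dom C h) (Cod C i')"
      unfolding h(3) using h(1) by simp_all
    then have "pr1 C Y Y' \<cdot> h = Zero C (Dom C h) (Dom C i)" "pr2 C Y Y' \<cdot> h = Zero C (Dom C h) (Dom C i')"
      using h(1,2) by (intro is_monoD_zero[OF E(7)] is_monoD_zero[OF E'(7)]; simp)+
    then show "h = Zero C (Dom C h) (Dom C (dsum C i i'))"
      using h(1,2) by - (rule biprod_eqI[of h _ Y Y']; simp)
  qed simp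
  have epi: "is_epi C (dsum C p p')"
  proof (rule is_epiI)
    fix h assume h: "h \<in> Arr C" "Dom C h = Cod C (dsum C p p')"
      "h \<cdot> dsum C p p' = Zero C (Dom C (dsum C p p')) (Cod C h)"
    have "(h \<cdot> in1 C X X') \<cdot> p = (h \<cdot> dsum C p p') \<cdot> in1 C (Dom C p) (Dom C p')"
      "(h \<cdot> in2 C X X') \<cdot> p' = (h \<cdot> dsum C p p') \<cdot> in2 C (Dom C p) (Dom C p')" using h(1,2) by simp_all
    then have "(h \<cdot> in1 C X X') \<cdot> p = Zero C (Dom C p) (Cod C h)"
      "(h \<cdot> in2 C X X') \<cdot> p' = Zero C (Dom C p') (Cod C h)"
      unfolding h(3) using h(1) by simp_all
    then have "h \<cdot> in1 C X X' = Zero C (Cod C p) (Cod C h)" "h \<cdot> in2 C X X' = Zero C (Cod C p') (Cod C h)"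
      using h(1,2) by (intro is_epiD_zero[OF E(8)] is_epiD_zero[OF E'(8)]; simp)+
    then show "h = Zero C (Cod C (dsum C p p')) (Cod C h)"
      using h(1,2) by - (rule biprod_co_eqI[of h _ X X']; simp)
  qed simp
  have ker: "is_kernel C (dsum C p p') (dsum C i i')"
  proof (rule is_kernelI)
    show "dsum C p p' \<cdot> dsum C i i' = Zero C (Dom C (dsum C i i')) (Cod C (dsum C p p'))"
      by (rule biprod_eqI[of _ _ X X']) (simp_all add: comp_reduce[OF pi(1)] comp_reduce[OF pi(2)])
    fix h assume h: "h \<in> Arr C" "Cod C h = Dom C (dsum C p p')"
      "dsum C p p' \<cdot> h = Zero C (Dom C h) (Cod C (dsum C p p'))"
    have "p \<cdot> pr1 C (Dom C p) (Dom C p') \<cdot> h = pr1 C X X' \<cdot> dsum C p p' \<cdot> h"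
      "p' \<cdot> pr2 C (Dom C p) (Dom C p') \<cdot> h = pr2 C X X' \<cdot> dsum C p p' \<cdot> h" using h(1,2) by simp_all
    then have z: "p \<cdot> pr1 C (Dom C p) (Dom C p') \<cdot> h = Zero C (Dom C h) X"
      "p' \<cdot> pr2 C (Dom C p) (Dom C p') \<cdot> h = Zero C (Dom C h) X'"
      unfolding h(3) using h(1) by simp_all
    obtain u where u: "u \<in> Arr C" "Dom C u = Dom C h" "Cod C u = Y" "i \<cdot> u = pr1 C (Dom C p) (Dom C p') \<cdot> h"
      using kernel_lift[OF E(5), of "pr1 C (Dom C p) (Dom C p') \<cdot> h"] z(1) h(1,2) by auto
    obtain v where v: "v \<in> Arr C" "Dom C v = Dom C h" "Cod C v = Y'" "i' \<cdot> v = pr2 C (Dom C p) (Dom C p') \<cdot> h"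
      using kernel_lift[OF E'(5), of "pr2 C (Dom C p) (Dom C p') \<cdot> h"] z(2) h(1,2) by auto
    \<comment> \<open>The lift through the sum is assembled from the lifts \<open>u\<close> and
      \<open>v\<close> of the two components of \<open>h\<close>.\<close>
    have "dsum C i i' \<cdot> (in1 C Y Y' \<cdot> u \<boxplus> in2 C Y Y' \<cdot> v) = h"
      by (rule biprod_eqI[of _ _ "Dom C p" "Dom C p'"]) (use u v h(1,2) in simp_all)
    then show "\<exists>u\<in>Hom C (Dom C h) (Dom C (dsum C i i')). dsum C i i' \<cdot> u = h"
      using u(1-3) v(1-3) by (intro bexI[of _ "in1 C Y Y' \<cdot> u \<boxplus> in2 C Y Y' \<cdot> v"]) simp_all
  qed (simp_all add: mono)
  show ?thesis using short_exactI_epi[OF ker epi] by (simp add: extensions_def)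
qed

text \<open>The structure arrows of the three biproducts (left ends, middles, right ends) are
  compatible, so a direct sum of extensions carries projections and injections in the sense of
  \<open>ext_mor\<close>.\<close>

lemma dsum_ext_mor:
  assumes "(i, p) \<in> extensions C X Y" "(i', p') \<in> extensions C X' Y'"
  shows "ext_mor C (pr1 C Y Y') (pr1 C X X') (dsum C i i', dsum C p p') (i, p)"
    "ext_mor C (pr2 C Y Y') (pr2 C X X') (dsum C i i', dsum C p p') (i', p')"
    "ext_mor C (in1 C Y Y') (in1 C X X') (i, p) (dsum C i i', dsum C p p')"
    "ext_mor C (in2 C Y Y') (in2 C X X') (i', p') (dsum C i i', dsum C p p')"
proof -
  note D = extensionsD[OF assms(1)] and D' = extensionsD[OF assms(2)]
  note [simp] = D(2-) D'(2-)
  have ex: "short_exact C (dsum C i i') (dsum C p p')"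
    using dsum_extension[OF assms] by (simp add: extensions_def)
  show "ext_mor C (pr1 C Y Y') (pr1 C X X') (dsum C i i', dsum C p p') (i, p)"
    unfolding ext_mor_def prod.case
    using D(1) ex by (intro conjI bexI[of _ "pr1 C (Dom C p) (Dom C p')"]) simp_all
  show "ext_mor C (pr2 C Y Y') (pr2 C X X') (dsum C i i', dsum C p p') (i', p')"
    unfolding ext_mor_def prod.case
    using D'(1) ex by (intro conjI bexI[of _ "pr2 C (Dom C p) (Dom C p')"]) simp_all
  show "ext_mor C (in1 C Y Y') (in1 C X X') (i, p) (dsum C i i', dsum C p p')"
    unfolding ext_mor_def prod.case
    using D(1) ex by (intro conjI bexI[of _ "in1 C (Dom C p) (Dom C p')"]) simp_all
  show "ext_mor C (in2 C Y Y') (in2 C X X') (i', p') (dsum C i i', dsum C p p')"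
    unfolding ext_mor_def prod.case
    using D'(1) ex by (intro conjI bexI[of _ "in2 C (Dom C p) (Dom C p')"]) simp_all
qed

text \<open>Pairing of two maps with a common source: compose with the two injections and
  add.\<close>

lemma ext_mor_into_dsum:
  assumes "ext_mor C a b e (i, p)" "ext_mor C a' b' e (i', p')"
  shows "ext_mor C (in1 C (Cod C a) (Cod C a') \<cdot> a \<boxplus> in2 C (Cod C a) (Cod C a') \<cdot> a')
    (in1 C (Cod C b) (Cod C b') \<cdot> b \<boxplus> in2 C (Cod C b) (Cod C b') \<cdot> b')
    e (dsum C i i', dsum C p p')"
  by (rule ext_mor_add; rule ext_mor_comp[OF assms(1)] ext_mor_comp[OF assms(2)];
      rule dsum_ext_mor[OF ext_morD(4)[OF assms(1)] ext_morD(4)[OF assms(2)]])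

text \<open>Projecting, changing representatives and pairing again gives a map between the two sums
  whose outer arrows are \<open>in1 \<cdot> pr1 + in2 \<cdot> pr2\<close>, that is,
  identities.\<close>

lemma dsum_class:
  assumes e: "(i, p) \<in> extensions C X Y" and e': "(i', p') \<in> extensions C X' Y'"
  shows "ext_dsum C (ext_class C (i, p)) (ext_class C (i', p')) = ext_class C (dsum C i i', dsum C p p')"
proof -
  note [simp] = ext_obj[OF e] ext_obj[OF e']
  note d = dsum_extension[OF assms]
  have "ext_class C (dsum C j j', dsum C q q') = ext_class C (dsum C i i', dsum C p p')"
    if "(j, q) \<in> ext_class C (i, p)" "(j', q') \<in> ext_class C (i', p')" for j q j' q'
  proof -
    have m: "ext_mor C (Ident C Y) (Ident C X) (i, p) (j, q)"
      "ext_mor C (Ident C Y') (Ident C X') (i', p') (j', q')"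
      using that ext_class_mem[OF e] ext_class_mem[OF e'] by blast+
    from ext_mor_into_dsum[OF ext_mor_comp[OF dsum_ext_mor(1)[OF e e'] m(1)]
      ext_mor_comp[OF dsum_ext_mor(2)[OF e e'] m(2)]]
    have "ext_mor C (Ident C (bip Y Y')) (Ident C (bip X X'))
      (dsum C i i', dsum C p p') (dsum C j j', dsum C q q')"
      by (simp add: biprod_sum)
    from ext_class_eqI[OF this] show ?thesis by simp
  qed
  then have "ext_dsum C (ext_class C (i, p)) (ext_class C (i', p')) =
      (\<Union>_\<in>ext_class C (i, p). \<Union>_\<in>ext_class C (i', p'). ext_class C (dsum C i i', dsum C p p'))"
    unfolding ext_dsum_def by (intro SUP_cong refl) (auto split: prod.split)
  also have "\<dots> = ext_class C (dsum C i i', dsum C p p')"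
    using ext_class_self[OF e] ext_class_self[OF e'] by (simp only: UN_constant) auto
  finally show ?thesis .
qed

text \<open>
  A description of the Baer sum that mentions no biproduct, hence is visibly preserved by exact
  functors and by pullback: the extension \<open>z\<close> stands for the fibre product of \<open>e\<close> and \<open>e'\<close> over \<open>X\<close>.
\<close>

lemma baer_sum_eq:
  assumes ma: "ext_mor C a (Ident C X) z e" and mb: "ext_mor C b (Ident C X) z e'"
    and mn: "ext_mor C (a \<boxplus> b) (Ident C X) z n" and X: "X \<in> Obj C" and Y: "Cod C a = Y" "Cod C b = Y"
  shows "baer_sum C X Y (ext_class C e) (ext_class C e') = ext_class C n"
proof -
  note A = ext_morD[OF ma] and B = ext_morD[OF mb]
  have YO: "Y \<in> Obj C" using A(1) Y by auto
  note [simp] = A(1) B(1) X Y YO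
  have ab [simp]: "Dom C b = Dom C a" using A(3) B(3) by (auto simp: extensions_def)
  obtain i p i' p' where e: "e = (i, p)" "e' = (i', p')" by (cases e, cases e') auto
  define d where "d = (dsum C i i', dsum C p p')"
  have ee: "(i, p) \<in> extensions C X Y" "(i', p') \<in> extensions C X Y" using A(4) B(4) unfolding e by simp_all
  let ?D = "in1 C X X \<boxplus> in2 C X X" and ?N = "pr1 C Y Y \<boxplus> pr2 C Y Y"
  have d: "d \<in> extensions C (bip X X) (bip Y Y)" unfolding d_def by (rule dsum_extension[OF ee])
  \<comment> \<open>\<open>z'\<close> and \<open>n'\<close> retrace the definition of the Baer sum:
    pullback along the diagonal, then pushout along the codiagonal. The goal becomes the equivalence
    of \<open>n\<close> and \<open>n'\<close>.\<close>
  obtain z' where z': "ext_mor C (Ident C (bip Y Y)) ?D z' d"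
    by (rule pull_exists[OF d, of ?D]) simp_all
  have "z' \<in> extensions C X (bip Y Y)" using ext_morD(3)[OF z'] by simp
  then obtain n' where n': "ext_mor C ?N (Ident C X) z' n'"
    by (rule push_exists[of _ _ _ ?N]) simp_all
  \<comment> \<open>The pairing of the maps from \<open>z\<close> to \<open>e\<close> and
    \<open>e'\<close> lies over the diagonal, hence factors through \<open>z'\<close>.\<close>
  have "ext_mor C (in1 C Y Y \<cdot> a \<boxplus> in2 C Y Y \<cdot> b) (?D \<cdot> Ident C X) z d"
    using ext_mor_into_dsum[OF ma[unfolded e] mb[unfolded e]] by (simp add: d_def)
  from pull_factor[OF this z'] have "ext_mor C (in1 C Y Y \<cdot> a \<boxplus> in2 C Y Y \<cdot> b) (Ident C X) z z'" by simp
  \<comment> \<open>The codiagonal turns the pair of \<open>a\<close> and \<open>b\<close> into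
    their sum. The identity written in front is what remains after factoring through the pushout
    \<open>n\<close>.\<close>
  from ext_mor_comp[OF this n'] have "ext_mor C (Ident C Y \<cdot> (a \<boxplus> b)) (Ident C X) z n'" by simp
  from push_factor[OF this mn] have "ext_mor C (Ident C Y) (Ident C X) n n'" by simp
  then have "ext_class C n = ext_class C n'" by (rule ext_class_eqI) simp_all
  moreover have "ext_pull C ?D (ext_class C d) = ext_class C z'" by (rule ext_pull_eq[OF z']) simp
  moreover have "ext_push C ?N (ext_class C z') = ext_class C n'" by (rule ext_push_eq[OF n']) simp
  ultimately show ?thesis unfolding baer_sum_def e dsum_class[OF ee] d_def by simp
qed

text \<open>Here \<open>z\<close> is the direct sum pulled back along the diagonal, \<open>a\<close>
  and \<open>b\<close> are the projections of the biproduct of \<open>Y\<close> with itself, and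
  \<open>n\<close> is the pushout along their sum.\<close>

lemma baer_sum_exists:
  assumes e: "e \<in> extensions C X Y" and e': "e' \<in> extensions C X Y"
  obtains z a b n where "ext_mor C a (Ident C X) z e" "ext_mor C b (Ident C X) z e'"
    "ext_mor C (a \<boxplus> b) (Ident C X) z n" "Cod C a = Y" "Cod C b = Y"
proof -
  note [simp] = ext_obj[OF e]
  obtain i p i' p' where ee: "e = (i, p)" "e' = (i', p')" by (cases e, cases e') auto
  let ?D = "in1 C X X \<boxplus> in2 C X X"
  define d where "d = (dsum C i i', dsum C p p')"
  have d: "d \<in> extensions C (bip X X) (bip Y Y)"
    unfolding d_def by (rule dsum_extension[OF e[unfolded ee] e'[unfolded ee]])
  obtain z where z: "ext_mor C (Ident C (bip Y Y)) ?D z d"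
    by (rule pull_exists[OF d, of ?D]) simp_all
  have 1: "ext_mor C (pr1 C Y Y) (Ident C X) z e"
    using ext_mor_comp[OF z[unfolded d_def] dsum_ext_mor(1)[OF e[unfolded ee] e'[unfolded ee]]]
    by (simp add: ee)
  have 2: "ext_mor C (pr2 C Y Y) (Ident C X) z e'"
    using ext_mor_comp[OF z[unfolded d_def] dsum_ext_mor(2)[OF e[unfolded ee] e'[unfolded ee]]]
    by (simp add: ee)
  have "z \<in> extensions C X (bip Y Y)" using ext_morD(3)[OF z] by simp
  then obtain n where "ext_mor C (pr1 C Y Y \<boxplus> pr2 C Y Y) (Ident C X) z n"
    by (rule push_exists[of _ _ _ "pr1 C Y Y \<boxplus> pr2 C Y Y"]) simp_all
  then show ?thesis using that[OF 1 2] by simp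
qed

end

section \<open>Diagram categories are abelian\<close>

locale diagrams = S: category S + A: abelian_category A
  for S :: "('s, 't, 'm) cat_scheme" and A :: "('o, 'a, 'n) addcat_scheme"
begin

abbreviation X :: "(('s, 't, 'o, 'a) func, ('s, 't, 'o, 'a) ntrans) addcat" where
  "X \<equiv> fun_cat S A"

text \<open>Kept out of the default simp set: objectwise constructions unfold \<open>X\<close> by
  these rules, while later arguments treat it as an abstract abelian category.\<close>

lemma fun_cat_simps:
  "Obj X = functors S A" "Arr X = nat_transes S A" "Dom X = NDom" "Cod X = NCod"
  "NDom (\<theta> \<cdot>\<^bsub>X\<^esub> \<eta>) = NDom \<eta>" "NCod (\<theta> \<cdot>\<^bsub>X\<^esub> \<eta>) = NCod \<theta>"
  "NDom (\<eta> \<boxplus>\<^bsub>X\<^esub> \<theta>) = NDom \<eta>" "NCod (\<eta> \<boxplus>\<^bsub>X\<^esub> \<theta>) = NCod \<eta>"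
  "NDom (Zero X F G) = F" "NCod (Zero X F G) = G" "NDom (Ident X F) = F" "NCod (Ident X F) = F"
  "x \<in> Obj S \<Longrightarrow> NAt (\<theta> \<cdot>\<^bsub>X\<^esub> \<eta>) x = NAt \<theta> x \<cdot>\<^bsub>A\<^esub> NAt \<eta> x"
  "x \<in> Obj S \<Longrightarrow> NAt (\<eta> \<boxplus>\<^bsub>X\<^esub> \<theta>) x = NAt \<eta> x \<boxplus>\<^bsub>A\<^esub> NAt \<theta> x"
  "x \<in> Obj S \<Longrightarrow> NAt (Zero X F G) x = Zero A (FOb F x) (FOb G x)"
  "x \<in> Obj S \<Longrightarrow> NAt (Ident X F) x = Ident A (FOb F x)"
  by (simp_all add: fun_cat_def)

lemma functor_simps:
  assumes "F \<in> functors S A"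
  shows "x \<in> Obj S \<Longrightarrow> FOb F x \<in> Obj A"
    "f \<in> Arr S \<Longrightarrow> FAr F f \<in> Arr A"
    "f \<in> Arr S \<Longrightarrow> Dom A (FAr F f) = FOb F (Dom S f)"
    "f \<in> Arr S \<Longrightarrow> Cod A (FAr F f) = FOb F (Cod S f)"
    "x \<in> Obj S \<Longrightarrow> FAr F (Ident S x) = Ident A (FOb F x)"
    "f \<in> Arr S \<Longrightarrow> g \<in> Arr S \<Longrightarrow> Dom S g = Cod S f \<Longrightarrow> FAr F (g \<cdot>\<^bsub>S\<^esub> f) = FAr F g \<cdot>\<^bsub>A\<^esub> FAr F f"
  using assms unfolding functors_def by (auto simp: PiE_iff)

lemma trans_simps:
  assumes "\<eta> \<in> nat_transes S A"
  shows "NDom \<eta> \<in> functors S A" "NCod \<eta> \<in> functors S A"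
    "x \<in> Obj S \<Longrightarrow> NAt \<eta> x \<in> Arr A"
    "x \<in> Obj S \<Longrightarrow> Dom A (NAt \<eta> x) = FOb (NDom \<eta>) x"
    "x \<in> Obj S \<Longrightarrow> Cod A (NAt \<eta> x) = FOb (NCod \<eta>) x"
  using assms unfolding nat_transes_def by auto

lemma naturality:
  assumes "\<eta> \<in> nat_transes S A" "f \<in> Arr S"
  shows "FAr (NCod \<eta>) f \<cdot>\<^bsub>A\<^esub> NAt \<eta> (Dom S f) = NAt \<eta> (Cod S f) \<cdot>\<^bsub>A\<^esub> FAr (NDom \<eta>) f"
  using assms unfolding nat_transes_def by auto

text \<open>Agreement on the objects of \<open>S\<close> suffices because transformations are
  extensional there.\<close>

lemma trans_eqI:
  assumes "\<eta> \<in> nat_transes S A" "\<theta> \<in> nat_transes S A" "NDom \<eta> = NDom \<theta>" "NCod \<eta> = NCod \<theta>"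
    "\<And>x. x \<in> Obj S \<Longrightarrow> NAt \<eta> x = NAt \<theta> x"
  shows "\<eta> = \<theta>"
proof -
  have "NAt \<eta> \<in> extensional (Obj S)" "NAt \<theta> \<in> extensional (Obj S)"
    using assms(1,2) unfolding nat_transes_def by blast+
  then have "NAt \<eta> = NAt \<theta>" using assms(5) by (rule extensionalityI)
  then show ?thesis using assms(3,4) by simp
qed

lemma transI:
  assumes "F \<in> functors S A" "G \<in> functors S A"
    "\<And>x. x \<in> Obj S \<Longrightarrow> t x \<in> Hom A (FOb F x) (FOb G x)"
    "\<And>f. f \<in> Arr S \<Longrightarrow> FAr G f \<cdot>\<^bsub>A\<^esub> t (Dom S f) = t (Cod S f) \<cdot>\<^bsub>A\<^esub> FAr F f"
  shows "\<lparr>NDom = F, NCod = G, NAt = (\<lambda>x\<in>Obj S. t x)\<rparr> \<in> nat_transes S A"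
  using assms by (simp add: nat_transes_def)

lemma functorI:
  assumes "\<And>x. x \<in> Obj S \<Longrightarrow> o' x \<in> Obj A"
    "\<And>f. f \<in> Arr S \<Longrightarrow> a f \<in> Hom A (o' (Dom S f)) (o' (Cod S f))"
    "\<And>x. x \<in> Obj S \<Longrightarrow> a (Ident S x) = Ident A (o' x)"
    "\<And>f g. f \<in> Arr S \<Longrightarrow> g \<in> Arr S \<Longrightarrow> Dom S g = Cod S f \<Longrightarrow> a (g \<cdot>\<^bsub>S\<^esub> f) = a g \<cdot>\<^bsub>A\<^esub> a f"
  shows "\<lparr>FOb = (\<lambda>x\<in>Obj S. o' x), FAr = (\<lambda>f\<in>Arr S. a f)\<rparr> \<in> functors S A"
  using assms by (simp add: functors_def)

lemma Ident_trans: "F \<in> functors S A \<Longrightarrow> Ident X F \<in> nat_transes S A"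
  unfolding fun_cat_def by simp (rule transI; simp add: functor_simps)

lemma comp_trans:
  assumes "\<eta> \<in> nat_transes S A" "\<theta> \<in> nat_transes S A" "NDom \<theta> = NCod \<eta>"
  shows "\<theta> \<cdot>\<^bsub>X\<^esub> \<eta> \<in> nat_transes S A"
proof -
  note [simp] = functor_simps trans_simps[OF assms(1)] trans_simps[OF assms(2)] assms(3)
  have "FAr (NCod \<theta>) f \<cdot>\<^bsub>A\<^esub> NAt \<theta> (Dom S f) \<cdot>\<^bsub>A\<^esub> NAt \<eta> (Dom S f) =
      (NAt \<theta> (Cod S f) \<cdot>\<^bsub>A\<^esub> NAt \<eta> (Cod S f)) \<cdot>\<^bsub>A\<^esub> FAr (NDom \<eta>) f" if "f \<in> Arr S" for f
    using that naturality[OF assms(1) that, symmetric]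
    by (simp add: A.comp_reduce[OF naturality[OF assms(2) that]] assms(3))
  then show ?thesis unfolding fun_cat_def by simp (rule transI; simp)
qed

lemma add_trans:
  assumes "\<eta> \<in> nat_transes S A" "\<theta> \<in> nat_transes S A" "NDom \<theta> = NDom \<eta>" "NCod \<theta> = NCod \<eta>"
  shows "\<eta> \<boxplus>\<^bsub>X\<^esub> \<theta> \<in> nat_transes S A"
proof -
  note [simp] = functor_simps trans_simps[OF assms(1)] trans_simps[OF assms(2)] assms(3,4)
  have "FAr (NCod \<eta>) f \<cdot>\<^bsub>A\<^esub> (NAt \<eta> (Dom S f) \<boxplus>\<^bsub>A\<^esub> NAt \<theta> (Dom S f)) =
      (NAt \<eta> (Cod S f) \<boxplus>\<^bsub>A\<^esub> NAt \<theta> (Cod S f)) \<cdot>\<^bsub>A\<^esub> FAr (NDom \<eta>) f" if "f \<in> Arr S" for f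
    using that naturality[OF assms(1) that] naturality[OF assms(2) that] by simp
  then show ?thesis unfolding fun_cat_def by simp (rule transI; simp)
qed

lemma zero_trans: "F \<in> functors S A \<Longrightarrow> G \<in> functors S A \<Longrightarrow> Zero X F G \<in> nat_transes S A"
  unfolding fun_cat_def by simp (rule transI; simp add: functor_simps)

lemma neg_trans:
  assumes "\<eta> \<in> nat_transes S A"
  shows "\<lparr>NDom = NDom \<eta>, NCod = NCod \<eta>, NAt = (\<lambda>x\<in>Obj S. A.neg (NAt \<eta> x))\<rparr> \<in> nat_transes S A"
proof (rule transI)
  note [simp] = functor_simps trans_simps[OF assms]
  fix f assume "f \<in> Arr S"
  then show "FAr (NCod \<eta>) f \<cdot>\<^bsub>A\<^esub> A.neg (NAt \<eta> (Dom S f)) = A.neg (NAt \<eta> (Cod S f)) \<cdot>\<^bsub>A\<^esub> FAr (NDom \<eta>) f"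
    using naturality[OF assms, of f] by simp
qed (simp_all add: trans_simps[OF assms])

lemmas trans_closed = Ident_trans comp_trans add_trans zero_trans

lemma Hom_fun_cat: "\<eta> \<in> Hom X F G \<longleftrightarrow> \<eta> \<in> nat_transes S A \<and> NDom \<eta> = F \<and> NCod \<eta> = G"
  by (simp add: fun_cat_simps)

lemma preadditive_fun_cat: "preadditive_category X"
proof (intro preadditive_category.intro category.intro preadditive_category_axioms.intro)
  note [simp] = fun_cat_simps trans_simps functor_simps trans_closed
  fix F G assume FG: "F \<in> Obj X" "G \<in> Obj X"
  show "comm_group \<lparr>carrier = Hom X F G, mult = Add X, one = Zero X F G\<rparr>"
  proof (rule comm_groupI, unfold monoid.simps partial_object.simps Bex_def Hom_fun_cat)
    fix \<eta> assume e: "\<eta> \<in> nat_transes S A \<and> NDom \<eta> = F \<and> NCod \<eta> = G"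
    let ?n = "\<lparr>NDom = F, NCod = G, NAt = (\<lambda>x\<in>Obj S. A.neg (NAt \<eta> x))\<rparr>"
    have n: "?n \<in> nat_transes S A" using neg_trans[of \<eta>] e by simp
    have "?n \<boxplus>\<^bsub>X\<^esub> \<eta> = Zero X F G"
      by (rule trans_eqI) (use n e FG in \<open>auto simp: A.add_comm[of "A.neg _"]\<close>)
    then show "\<exists>\<theta>. (\<theta> \<in> nat_transes S A \<and> NDom \<theta> = F \<and> NCod \<theta> = G) \<and> \<theta> \<boxplus>\<^bsub>X\<^esub> \<eta> = Zero X F G"
      using n by (intro exI[of _ ?n]) simp
    show "Zero X F G \<boxplus>\<^bsub>X\<^esub> \<eta> = \<eta>"
      by (rule trans_eqI) (use e FG in auto)
    fix \<theta> assume t: "\<theta> \<in> nat_transes S A \<and> NDom \<theta> = F \<and> NCod \<theta> = G"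
    show "\<eta> \<boxplus>\<^bsub>X\<^esub> \<theta> \<in> nat_transes S A \<and> NDom (\<eta> \<boxplus>\<^bsub>X\<^esub> \<theta>) = F \<and> NCod (\<eta> \<boxplus>\<^bsub>X\<^esub> \<theta>) = G"
      using e t by auto
    show "\<eta> \<boxplus>\<^bsub>X\<^esub> \<theta> = \<theta> \<boxplus>\<^bsub>X\<^esub> \<eta>"
      by (rule trans_eqI) (use e t in \<open>auto intro: A.add_comm\<close>)
    fix \<zeta> assume z: "\<zeta> \<in> nat_transes S A \<and> NDom \<zeta> = F \<and> NCod \<zeta> = G"
    show "\<eta> \<boxplus>\<^bsub>X\<^esub> \<theta> \<boxplus>\<^bsub>X\<^esub> \<zeta> = \<eta> \<boxplus>\<^bsub>X\<^esub> (\<theta> \<boxplus>\<^bsub>X\<^esub> \<zeta>)"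
      by (rule trans_eqI) (use e t z in \<open>auto intro: A.add_assoc\<close>)
  qed (use FG in auto)
next
  note [simp] = fun_cat_simps trans_simps functor_simps trans_closed
  fix \<eta> \<eta>' \<theta> F G H
  assume a: "\<eta> \<in> Hom X F G" "\<eta>' \<in> Hom X F G" "\<theta> \<in> Hom X G H"
  show "\<theta> \<cdot>\<^bsub>X\<^esub> (\<eta> \<boxplus>\<^bsub>X\<^esub> \<eta>') = \<theta> \<cdot>\<^bsub>X\<^esub> \<eta> \<boxplus>\<^bsub>X\<^esub> \<theta> \<cdot>\<^bsub>X\<^esub> \<eta>'"
    by (rule trans_eqI) (use a in auto)
next
  note [simp] = fun_cat_simps trans_simps functor_simps trans_closed
  fix \<eta> \<theta> \<theta>' F G H
  assume a: "\<eta> \<in> Hom X F G" "\<theta> \<in> Hom X G H" "\<theta>' \<in> Hom X G H"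
  show "(\<theta> \<boxplus>\<^bsub>X\<^esub> \<theta>') \<cdot>\<^bsub>X\<^esub> \<eta> = \<theta> \<cdot>\<^bsub>X\<^esub> \<eta> \<boxplus>\<^bsub>X\<^esub> \<theta>' \<cdot>\<^bsub>X\<^esub> \<eta>"
    by (rule trans_eqI) (use a in auto)
next
  note [simp] = fun_cat_simps trans_simps functor_simps trans_closed
  fix \<eta> F G assume a: "\<eta> \<in> Hom X F G"
  show "\<eta> \<cdot>\<^bsub>X\<^esub> Ident X F = \<eta>" "Ident X G \<cdot>\<^bsub>X\<^esub> \<eta> = \<eta>"
    by (rule trans_eqI; use a in auto)+
  fix \<theta> \<zeta> H K assume "\<theta> \<in> Hom X G H" "\<zeta> \<in> Hom X H K"
  then show "(\<zeta> \<cdot>\<^bsub>X\<^esub> \<theta>) \<cdot>\<^bsub>X\<^esub> \<eta> = \<zeta> \<cdot>\<^bsub>X\<^esub> \<theta> \<cdot>\<^bsub>X\<^esub> \<eta>"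
    by - (rule trans_eqI; use a in auto)
qed (auto simp: fun_cat_simps trans_simps trans_closed)

section \<open>Objectwise kernels and cokernels of natural transformations\<close>

sublocale X: preadditive_category "fun_cat S A"
  by (rule preadditive_fun_cat)

text \<open>Lifts are chosen separately at every object; that they form a natural transformation is
  automatic, since they are unique.\<close>

lemma objectwise_kernel:
  assumes f: "f \<in> nat_transes S A" and k: "k \<in> nat_transes S A" and fk: "NCod k = NDom f"
    and ker: "\<And>x. x \<in> Obj S \<Longrightarrow> is_kernel A (NAt f x) (NAt k x)"
  shows "is_kernel X f k"
proof (rule X.is_kernelI)
  note [simp] = fun_cat_simps functor_simps trans_closed trans_simps[OF f] trans_simps[OF k] f k fk
  show "f \<in> Arr X" "Cod X k = Dom X f" by simp_all
  show "f \<cdot>\<^bsub>X\<^esub> k = Zero X (Dom X k) (Cod X f)"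
    by (rule trans_eqI) (use A.is_kernelD(4)[OF ker] in simp_all)
  show "is_mono X k"
  proof (rule X.is_monoI)
    fix h assume h: "h \<in> Arr X" "Cod X h = Dom X k" "k \<cdot>\<^bsub>X\<^esub> h = Zero X (Dom X h) (Cod X k)"
    then have hn: "h \<in> nat_transes S A" by simp
    note [simp] = trans_simps[OF hn]
    show "h = Zero X (Dom X h) (Dom X k)"
    proof (rule trans_eqI)
      fix x assume x: "x \<in> Obj S"
      have "NAt (k \<cdot>\<^bsub>X\<^esub> h) x = NAt (Zero X (Dom X h) (Cod X k)) x" unfolding h(3) by (rule refl)
      then have "NAt h x = Zero A (FOb (NDom h) x) (Dom A (NAt k x))"
        using x h(2) by (intro A.is_monoD_zero[OF A.kernel_mono[OF ker]]) simp_all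
      then show "NAt h x = NAt (Zero X (Dom X h) (Dom X k)) x" using x by simp
    qed (use h(2) hn in simp_all)
  qed simp
  fix h assume h: "h \<in> Arr X" "Cod X h = Dom X f" "f \<cdot>\<^bsub>X\<^esub> h = Zero X (Dom X h) (Cod X f)"
  then have hn: "h \<in> nat_transes S A" by simp
  note [simp] = trans_simps[OF hn]
  have hf: "NCod h = NDom f" using h(2) by simp
  have "\<exists>u\<in>Hom A (FOb (NDom h) x) (FOb (NDom k) x). NAt k x \<cdot>\<^bsub>A\<^esub> u = NAt h x" if x: "x \<in> Obj S" for x
  proof -
    have "NAt (f \<cdot>\<^bsub>X\<^esub> h) x = NAt (Zero X (Dom X h) (Cod X f)) x" unfolding h(3) by (rule refl)
    then obtain u where "u \<in> Arr A" "Dom A u = Dom A (NAt h x)" "Cod A u = Dom A (NAt k x)"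
      "NAt k x \<cdot>\<^bsub>A\<^esub> u = NAt h x"
      using A.kernel_lift[OF ker[OF x], of "NAt h x"] x hf by auto
    then show ?thesis using x by auto
  qed
  then obtain u where u: "\<And>x. x \<in> Obj S \<Longrightarrow> u x \<in> Hom A (FOb (NDom h) x) (FOb (NDom k) x)"
    and ku: "\<And>x. x \<in> Obj S \<Longrightarrow> NAt k x \<cdot>\<^bsub>A\<^esub> u x = NAt h x"
    by metis
  have [simp]: "u x \<in> Arr A" "Dom A (u x) = FOb (NDom h) x" "Cod A (u x) = FOb (NDom k) x"
    if "x \<in> Obj S" for x
    using u[OF that] by simp_all
  let ?u = "\<lparr>NDom = NDom h, NCod = NDom k, NAt = (\<lambda>x\<in>Obj S. u x)\<rparr>"
  have un: "?u \<in> nat_transes S A"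
  proof (rule transI)
    fix t assume t: "t \<in> Arr S"
    show "FAr (NDom k) t \<cdot>\<^bsub>A\<^esub> u (Dom S t) = u (Cod S t) \<cdot>\<^bsub>A\<^esub> FAr (NDom h) t"
    \<comment> \<open>Naturality of the lifts is checked after composing with the monomorphism at
      the target object, where it reduces to naturality of \<open>k\<close> and
      \<open>h\<close>.\<close>
    proof (rule A.is_monoD[OF A.kernel_mono[OF ker[of "Cod S t"]]])
      have "NAt k (Cod S t) \<cdot>\<^bsub>A\<^esub> FAr (NDom k) t \<cdot>\<^bsub>A\<^esub> u (Dom S t) =
        FAr (NCod k) t \<cdot>\<^bsub>A\<^esub> NAt k (Dom S t) \<cdot>\<^bsub>A\<^esub> u (Dom S t)"
        using t by (simp add: A.comp_reduce[OF naturality[OF k t, symmetric]] del: fk)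
      also have "\<dots> = FAr (NCod h) t \<cdot>\<^bsub>A\<^esub> NAt h (Dom S t)" using t hf by (simp add: ku)
      also have "\<dots> = NAt h (Cod S t) \<cdot>\<^bsub>A\<^esub> FAr (NDom h) t" by (rule naturality[OF hn t])
      also have "\<dots> = NAt k (Cod S t) \<cdot>\<^bsub>A\<^esub> u (Cod S t) \<cdot>\<^bsub>A\<^esub> FAr (NDom h) t"
        using t by (simp add: A.comp_reduce[OF ku])
      finally show "NAt k (Cod S t) \<cdot>\<^bsub>A\<^esub> FAr (NDom k) t \<cdot>\<^bsub>A\<^esub> u (Dom S t) =
        NAt k (Cod S t) \<cdot>\<^bsub>A\<^esub> u (Cod S t) \<cdot>\<^bsub>A\<^esub> FAr (NDom h) t" .
    qed (use t in simp_all)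
  qed simp_all
  have "k \<cdot>\<^bsub>X\<^esub> ?u = h"
    by (rule trans_eqI) (use un hn hf ku in simp_all)
  then show "\<exists>u\<in>Hom X (Dom X h) (Dom X k). k \<cdot>\<^bsub>X\<^esub> u = h"
    using un by (intro bexI[of _ ?u]) simp_all
qed

text \<open>Dualising the kernel statement would replace \<open>S\<close> by its opposite as well as
  \<open>A\<close>, so the mirrored argument is carried out directly, with epimorphisms at the
  source object of each arrow.\<close>

lemma objectwise_cokernel:
  assumes f: "f \<in> nat_transes S A" and k: "k \<in> nat_transes S A" and fk: "NDom k = NCod f"
    and ker: "\<And>x. x \<in> Obj S \<Longrightarrow> is_cokernel A (NAt f x) (NAt k x)"
  shows "is_cokernel X f k"
proof (rule X.is_cokernelI)
  note [simp] = fun_cat_simps functor_simps trans_closed trans_simps[OF f] trans_simps[OF k] f k fk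
  show "f \<in> Arr X" "Dom X k = Cod X f" by simp_all
  show "k \<cdot>\<^bsub>X\<^esub> f = Zero X (Dom X f) (Cod X k)"
    by (rule trans_eqI) (use A.is_cokernelD(4)[OF ker] in simp_all)
  show "is_epi X k"
  proof (rule X.is_epiI)
    fix h assume h: "h \<in> Arr X" "Dom X h = Cod X k" "h \<cdot>\<^bsub>X\<^esub> k = Zero X (Dom X k) (Cod X h)"
    then have hn: "h \<in> nat_transes S A" by simp
    note [simp] = trans_simps[OF hn]
    show "h = Zero X (Cod X k) (Cod X h)"
    proof (rule trans_eqI)
      fix x assume x: "x \<in> Obj S"
      have "NAt (h \<cdot>\<^bsub>X\<^esub> k) x = NAt (Zero X (Dom X k) (Cod X h)) x" unfolding h(3) by (rule refl)
      then have "NAt h x = Zero A (Cod A (NAt k x)) (FOb (NCod h) x)"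
        using x h(2) by (intro A.is_epiD_zero[OF A.cokernel_epi[OF ker]]) simp_all
      then show "NAt h x = NAt (Zero X (Cod X k) (Cod X h)) x" using x by simp
    qed (use h(2) hn in simp_all)
  qed simp
  fix h assume h: "h \<in> Arr X" "Dom X h = Cod X f" "h \<cdot>\<^bsub>X\<^esub> f = Zero X (Dom X f) (Cod X h)"
  then have hn: "h \<in> nat_transes S A" by simp
  note [simp] = trans_simps[OF hn]
  have hf: "NDom h = NCod f" using h(2) by simp
  have "\<exists>u\<in>Hom A (FOb (NCod k) x) (FOb (NCod h) x). u \<cdot>\<^bsub>A\<^esub> NAt k x = NAt h x" if x: "x \<in> Obj S" for x
  proof -
    have "NAt (h \<cdot>\<^bsub>X\<^esub> f) x = NAt (Zero X (Dom X f) (Cod X h)) x" unfolding h(3) by (rule refl)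
    then obtain u where "u \<in> Arr A" "Dom A u = Cod A (NAt k x)" "Cod A u = Cod A (NAt h x)"
      "u \<cdot>\<^bsub>A\<^esub> NAt k x = NAt h x"
      using A.cokernel_desc[OF ker[OF x], of "NAt h x"] x hf by auto
    then show ?thesis using x by auto
  qed
  then obtain u where u: "\<And>x. x \<in> Obj S \<Longrightarrow> u x \<in> Hom A (FOb (NCod k) x) (FOb (NCod h) x)"
    and ku: "\<And>x. x \<in> Obj S \<Longrightarrow> u x \<cdot>\<^bsub>A\<^esub> NAt k x = NAt h x"
    by metis
  have [simp]: "u x \<in> Arr A" "Dom A (u x) = FOb (NCod k) x" "Cod A (u x) = FOb (NCod h) x"
    if "x \<in> Obj S" for x
    using u[OF that] by simp_all
  let ?u = "\<lparr>NDom = NCod k, NCod = NCod h, NAt = (\<lambda>x\<in>Obj S. u x)\<rparr>"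
  have un: "?u \<in> nat_transes S A"
  proof (rule transI)
    fix t assume t: "t \<in> Arr S"
    show "FAr (NCod h) t \<cdot>\<^bsub>A\<^esub> u (Dom S t) = u (Cod S t) \<cdot>\<^bsub>A\<^esub> FAr (NCod k) t"
    proof (rule A.is_epiD[OF A.cokernel_epi[OF ker[of "Dom S t"]]])
      have "(FAr (NCod h) t \<cdot>\<^bsub>A\<^esub> u (Dom S t)) \<cdot>\<^bsub>A\<^esub> NAt k (Dom S t) = FAr (NCod h) t \<cdot>\<^bsub>A\<^esub> NAt h (Dom S t)"
        using t by (simp add: ku)
      also have "\<dots> = NAt h (Cod S t) \<cdot>\<^bsub>A\<^esub> FAr (NDom k) t" using naturality[OF hn t] hf by simp
      also have "\<dots> = u (Cod S t) \<cdot>\<^bsub>A\<^esub> NAt k (Cod S t) \<cdot>\<^bsub>A\<^esub> FAr (NDom k) t"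
        using t by (simp add: A.comp_reduce[OF ku])
      also have "\<dots> = (u (Cod S t) \<cdot>\<^bsub>A\<^esub> FAr (NCod k) t) \<cdot>\<^bsub>A\<^esub> NAt k (Dom S t)"
        unfolding naturality[OF k t, symmetric] using t by simp
      finally show "(FAr (NCod h) t \<cdot>\<^bsub>A\<^esub> u (Dom S t)) \<cdot>\<^bsub>A\<^esub> NAt k (Dom S t) =
        (u (Cod S t) \<cdot>\<^bsub>A\<^esub> FAr (NCod k) t) \<cdot>\<^bsub>A\<^esub> NAt k (Dom S t)" .
    qed (use t in simp_all)
  qed simp_all
  have "?u \<cdot>\<^bsub>X\<^esub> k = h"
    by (rule trans_eqI) (use un hn hf ku in simp_all)
  then show "\<exists>u\<in>Hom X (Cod X k) (Cod X h). u \<cdot>\<^bsub>X\<^esub> k = h"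
    using un by (intro bexI[of _ ?u]) simp_all
qed

text \<open>Kernels are chosen independently at each object and linked by induced arrows; the
  functor laws hold because the chosen kernels are mono. The objectwise form is what
  \<open>objectwise_mono\<close> and normality require later.\<close>

lemma objectwise_kernel_exists:
  assumes f: "f \<in> nat_transes S A"
  obtains k where "k \<in> nat_transes S A" "NCod k = NDom f"
    "\<And>x. x \<in> Obj S \<Longrightarrow> is_kernel A (NAt f x) (NAt k x)"
proof -
  note [simp] = functor_simps trans_simps[OF f]
  have "\<forall>x\<in>Obj S. \<exists>k. is_kernel A (NAt f x) k" using A.kernels by simp
  then obtain k where k: "\<And>x. x \<in> Obj S \<Longrightarrow> is_kernel A (NAt f x) (k x)" by metis
  have [simp]: "k x \<in> Arr A" "Cod A (k x) = FOb (NDom f) x"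
    "NAt f x \<cdot>\<^bsub>A\<^esub> k x = Zero A (Dom A (k x)) (FOb (NCod f) x)" if "x \<in> Obj S" for x
    using A.is_kernelD[OF k[OF that]] that by simp_all
  have "\<exists>u\<in>Hom A (Dom A (k (Dom S t))) (Dom A (k (Cod S t))).
      k (Cod S t) \<cdot>\<^bsub>A\<^esub> u = FAr (NDom f) t \<cdot>\<^bsub>A\<^esub> k (Dom S t)" if t: "t \<in> Arr S" for t
  proof -
    have "NAt f (Cod S t) \<cdot>\<^bsub>A\<^esub> FAr (NDom f) t \<cdot>\<^bsub>A\<^esub> k (Dom S t) =
      Zero A (Dom A (k (Dom S t))) (FOb (NCod f) (Cod S t))"
      using t by (simp add: A.comp_reduce[OF naturality[OF f t, symmetric]])
    then obtain u where "u \<in> Arr A" "Dom A u = Dom A (k (Dom S t))" "Cod A u = Dom A (k (Cod S t))"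
      "k (Cod S t) \<cdot>\<^bsub>A\<^esub> u = FAr (NDom f) t \<cdot>\<^bsub>A\<^esub> k (Dom S t)"
      using A.kernel_lift[OF k[of "Cod S t"], of "FAr (NDom f) t \<cdot>\<^bsub>A\<^esub> k (Dom S t)"] t by auto
    then show ?thesis by auto
  qed
  then obtain u where u: "\<And>t. t \<in> Arr S \<Longrightarrow> u t \<in> Hom A (Dom A (k (Dom S t))) (Dom A (k (Cod S t)))"
    and ku: "\<And>t. t \<in> Arr S \<Longrightarrow> k (Cod S t) \<cdot>\<^bsub>A\<^esub> u t = FAr (NDom f) t \<cdot>\<^bsub>A\<^esub> k (Dom S t)"
    by metis
  have [simp]: "u t \<in> Arr A" "Dom A (u t) = Dom A (k (Dom S t))" "Cod A (u t) = Dom A (k (Cod S t))"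
    if "t \<in> Arr S" for t
    using u[OF that] by simp_all
  let ?K = "\<lparr>FOb = (\<lambda>x\<in>Obj S. Dom A (k x)), FAr = (\<lambda>t\<in>Arr S. u t)\<rparr>"
  have K: "?K \<in> functors S A"
  proof (rule functorI)
    fix x assume x: "x \<in> Obj S"
    show "u (Ident S x) = Ident A (Dom A (k x))"
      by (rule A.is_monoD[OF A.kernel_mono[OF k[OF x]]]) (use x ku[of "Ident S x"] in simp_all)
  next
    fix r t assume rt: "r \<in> Arr S" "t \<in> Arr S" "Dom S t = Cod S r"
    show "u (t \<cdot>\<^bsub>S\<^esub> r) = u t \<cdot>\<^bsub>A\<^esub> u r"
    proof (rule A.is_monoD[OF A.kernel_mono[OF k[of "Cod S t"]]])
      show "k (Cod S t) \<cdot>\<^bsub>A\<^esub> u (t \<cdot>\<^bsub>S\<^esub> r) = k (Cod S t) \<cdot>\<^bsub>A\<^esub> u t \<cdot>\<^bsub>A\<^esub> u r"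
        using rt ku[of "t \<cdot>\<^bsub>S\<^esub> r"] ku[of r] by (simp add: A.comp_reduce[OF ku])
    qed (use rt in simp_all)
  qed simp_all
  show ?thesis
  proof (rule that)
    show "\<lparr>NDom = ?K, NCod = NDom f, NAt = (\<lambda>x\<in>Obj S. k x)\<rparr> \<in> nat_transes S A"
      by (rule transI) (use K ku in simp_all)
  qed (simp_all add: k)
qed

lemma objectwise_cokernel_exists:
  assumes f: "f \<in> nat_transes S A"
  obtains k where "k \<in> nat_transes S A" "NDom k = NCod f"
    "\<And>x. x \<in> Obj S \<Longrightarrow> is_cokernel A (NAt f x) (NAt k x)"
proof -
  note [simp] = functor_simps trans_simps[OF f]
  have "\<forall>x\<in>Obj S. \<exists>k. is_cokernel A (NAt f x) k" using A.cokernels by simp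
  then obtain k where k: "\<And>x. x \<in> Obj S \<Longrightarrow> is_cokernel A (NAt f x) (k x)" by metis
  have [simp]: "k x \<in> Arr A" "Dom A (k x) = FOb (NCod f) x"
    "k x \<cdot>\<^bsub>A\<^esub> NAt f x = Zero A (FOb (NDom f) x) (Cod A (k x))" if "x \<in> Obj S" for x
    using A.is_cokernelD[OF k[OF that]] that by simp_all
  have "\<exists>u\<in>Hom A (Cod A (k (Dom S t))) (Cod A (k (Cod S t))).
      u \<cdot>\<^bsub>A\<^esub> k (Dom S t) = k (Cod S t) \<cdot>\<^bsub>A\<^esub> FAr (NCod f) t" if t: "t \<in> Arr S" for t
  proof -
    have "k (Cod S t) \<cdot>\<^bsub>A\<^esub> FAr (NCod f) t \<cdot>\<^bsub>A\<^esub> NAt f (Dom S t) =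
      k (Cod S t) \<cdot>\<^bsub>A\<^esub> NAt f (Cod S t) \<cdot>\<^bsub>A\<^esub> FAr (NDom f) t"
      unfolding naturality[OF f t] by (rule refl)
    also have "\<dots> = Zero A (FOb (NDom f) (Dom S t)) (Cod A (k (Cod S t)))"
      using t A.is_cokernelD(4)[OF k[of "Cod S t"]] by (simp add: A.comp_reduce)
    finally obtain u where "u \<in> Arr A" "Dom A u = Cod A (k (Dom S t))" "Cod A u = Cod A (k (Cod S t))"
      "u \<cdot>\<^bsub>A\<^esub> k (Dom S t) = k (Cod S t) \<cdot>\<^bsub>A\<^esub> FAr (NCod f) t"
      using A.cokernel_desc[OF k[of "Dom S t"], of "k (Cod S t) \<cdot>\<^bsub>A\<^esub> FAr (NCod f) t"] t by auto
    then show ?thesis by auto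
  qed
  then obtain u where u: "\<And>t. t \<in> Arr S \<Longrightarrow> u t \<in> Hom A (Cod A (k (Dom S t))) (Cod A (k (Cod S t)))"
    and uk: "\<And>t. t \<in> Arr S \<Longrightarrow> u t \<cdot>\<^bsub>A\<^esub> k (Dom S t) = k (Cod S t) \<cdot>\<^bsub>A\<^esub> FAr (NCod f) t"
    by metis
  have [simp]: "u t \<in> Arr A" "Dom A (u t) = Cod A (k (Dom S t))" "Cod A (u t) = Cod A (k (Cod S t))"
    if "t \<in> Arr S" for t
    using u[OF that] by simp_all
  let ?K = "\<lparr>FOb = (\<lambda>x\<in>Obj S. Cod A (k x)), FAr = (\<lambda>t\<in>Arr S. u t)\<rparr>"
  have K: "?K \<in> functors S A"
  proof (rule functorI)
    fix x assume x: "x \<in> Obj S"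
    show "u (Ident S x) = Ident A (Cod A (k x))"
      by (rule A.is_epiD[OF A.cokernel_epi[OF k[OF x]]]) (use x uk[of "Ident S x"] in simp_all)
  next
    fix r t assume rt: "r \<in> Arr S" "t \<in> Arr S" "Dom S t = Cod S r"
    show "u (t \<cdot>\<^bsub>S\<^esub> r) = u t \<cdot>\<^bsub>A\<^esub> u r"
    proof (rule A.is_epiD[OF A.cokernel_epi[OF k[of "Dom S r"]]])
      have "u t \<cdot>\<^bsub>A\<^esub> u r \<cdot>\<^bsub>A\<^esub> k (Dom S r) = u t \<cdot>\<^bsub>A\<^esub> k (Dom S t) \<cdot>\<^bsub>A\<^esub> FAr (NCod f) r"
        using rt uk[of r] by simp
      also have "\<dots> = k (Cod S t) \<cdot>\<^bsub>A\<^esub> FAr (NCod f) t \<cdot>\<^bsub>A\<^esub> FAr (NCod f) r"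
        using rt A.comp_reduce[OF uk[of t], of "FAr (NCod f) r"] by simp
      finally show "u (t \<cdot>\<^bsub>S\<^esub> r) \<cdot>\<^bsub>A\<^esub> k (Dom S r) = (u t \<cdot>\<^bsub>A\<^esub> u r) \<cdot>\<^bsub>A\<^esub> k (Dom S r)"
        using rt uk[of "t \<cdot>\<^bsub>S\<^esub> r"] by simp
    qed (use rt in simp_all)
  qed simp_all
  show ?thesis
  proof (rule that)
    show "\<lparr>NDom = NCod f, NCod = ?K, NAt = (\<lambda>x\<in>Obj S. k x)\<rparr> \<in> nat_transes S A"
      by (rule transI) (use K uk in simp_all)
  qed (simp_all add: k)
qed

text \<open>Cancellation of transformations does not visibly give cancellation at a single object.
  The bridge is the kernel: an objectwise kernel is a kernel in \<open>X\<close>, so it vanishes for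
  a monomorphism, and evaluating at \<open>x\<close> makes the kernel of \<open>NAt m x\<close>
  vanish.\<close>

lemma objectwise_mono:
  assumes m: "is_mono X m" and x: "x \<in> Obj S"
  shows "is_mono A (NAt m x)"
proof (rule A.is_monoI)
  have mn: "m \<in> nat_transes S A" using X.mono_arr[OF m] by (simp add: fun_cat_simps)
  obtain k where k: "k \<in> nat_transes S A" "NCod k = NDom m"
    "\<And>x. x \<in> Obj S \<Longrightarrow> is_kernel A (NAt m x) (NAt k x)"
    using objectwise_kernel_exists[OF mn] by blast
  note [simp] = fun_cat_simps functor_simps trans_simps[OF mn] trans_simps[OF k(1)] k(1,2)
  have "is_kernel X m k" by (rule objectwise_kernel[OF mn k])
  then have "k = Zero X (Dom X k) (Dom X m)"
    using X.is_kernelD(4) by (intro X.is_monoD_zero[OF m]) simp_all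
  then have "NAt k x = NAt (Zero X (Dom X k) (Dom X m)) x" by (rule arg_cong)
  then have kx: "NAt k x = Zero A (FOb (NDom k) x) (FOb (NDom m) x)" using x by simp
  show "NAt m x \<in> Arr A" using x by simp
  fix f assume f: "f \<in> Arr A" "Cod A f = Dom A (NAt m x)"
    "NAt m x \<cdot>\<^bsub>A\<^esub> f = Zero A (Dom A f) (Cod A (NAt m x))"
  then obtain u where u: "u \<in> Arr A" "Dom A u = Dom A f" "Cod A u = Dom A (NAt k x)" "NAt k x \<cdot>\<^bsub>A\<^esub> u = f"
    using A.kernel_lift[OF k(3)[OF x]] by blast
  have "NAt k x \<cdot>\<^bsub>A\<^esub> u = Zero A (Dom A f) (Dom A (NAt m x))" unfolding kx using u(1-3) x by simp
  then show "f = Zero A (Dom A f) (Dom A (NAt m x))" unfolding u(4) .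
qed

lemma objectwise_epi:
  assumes m: "is_epi X m" and x: "x \<in> Obj S"
  shows "is_epi A (NAt m x)"
proof (rule A.is_epiI)
  have mn: "m \<in> nat_transes S A" using X.epi_arr[OF m] by (simp add: fun_cat_simps)
  obtain k where k: "k \<in> nat_transes S A" "NDom k = NCod m"
    "\<And>x. x \<in> Obj S \<Longrightarrow> is_cokernel A (NAt m x) (NAt k x)"
    using objectwise_cokernel_exists[OF mn] by blast
  note [simp] = fun_cat_simps functor_simps trans_simps[OF mn] trans_simps[OF k(1)] k(1,2)
  have "is_cokernel X m k" by (rule objectwise_cokernel[OF mn k])
  then have "k = Zero X (Cod X m) (Cod X k)"
    using X.is_cokernelD(4) by (intro X.is_epiD_zero[OF m]) simp_all
  then have "NAt k x = NAt (Zero X (Cod X m) (Cod X k)) x" by (rule arg_cong)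
  then have kx: "NAt k x = Zero A (FOb (NCod m) x) (FOb (NCod k) x)" using x by simp
  show "NAt m x \<in> Arr A" using x by simp
  fix f assume f: "f \<in> Arr A" "Dom A f = Cod A (NAt m x)"
    "f \<cdot>\<^bsub>A\<^esub> NAt m x = Zero A (Dom A (NAt m x)) (Cod A f)"
  then obtain u where u: "u \<in> Arr A" "Dom A u = Cod A (NAt k x)" "Cod A u = Cod A f" "u \<cdot>\<^bsub>A\<^esub> NAt k x = f"
    using A.cokernel_desc[OF k(3)[OF x]] by blast
  have "u \<cdot>\<^bsub>A\<^esub> NAt k x = Zero A (Cod A (NAt m x)) (Cod A f)" unfolding kx using u(1-3) x by simp
  then show "f = Zero A (Cod A (NAt m x)) (Cod A f)" unfolding u(4) .
qed

section \<open>Constant diagrams, and the remaining axioms of an abelian category\<close>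

lemma const_ob_simps:
  "x \<in> Obj S \<Longrightarrow> FOb (const_ob S A a) x = a" "f \<in> Arr S \<Longrightarrow> FAr (const_ob S A a) f = Ident A a"
  "NDom (const_ar S A g) = const_ob S A (Dom A g)" "NCod (const_ar S A g) = const_ob S A (Cod A g)"
  "x \<in> Obj S \<Longrightarrow> NAt (const_ar S A g) x = g"
  by (simp_all add: const_ob_def const_ar_def)

lemma const_ob_functor: "a \<in> Obj A \<Longrightarrow> const_ob S A a \<in> functors S A"
  unfolding const_ob_def by (rule functorI) simp_all

lemma const_ar_trans: "f \<in> Arr A \<Longrightarrow> const_ar S A f \<in> nat_transes S A"
  unfolding const_ar_def by (rule transI) (simp_all add: const_ob_functor const_ob_simps)

lemma fun_cat_zero_object: "\<exists>z. is_zero_object X z"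
proof -
  obtain z where z0: "is_zero_object A z" using A.zero_object by blast
  then have z: "z \<in> Obj A"
    and u: "\<forall>x\<in>Obj A. (\<exists>!f. f \<in> Hom A x z) \<and> (\<exists>!f. f \<in> Hom A z x)"
    unfolding is_zero_object_def by (rule conjunct1, rule conjunct2)
  let ?Z = "const_ob S A z"
  note [simp] = const_ob_functor[OF z] functor_simps trans_simps const_ob_simps(1) zero_trans fun_cat_simps
  have "\<exists>!f. f \<in> Hom X F ?Z" "\<exists>!f. f \<in> Hom X ?Z F" if F: "F \<in> functors S A" for F
  proof -
    have "f = g" if fg: "f \<in> Hom X F ?Z" "g \<in> Hom X F ?Z" for f g
    proof (rule trans_eqI)
      fix x assume "x \<in> Obj S"
      then have "NAt f x \<in> Hom A (FOb F x) z" "NAt g x \<in> Hom A (FOb F x) z" "FOb F x \<in> Obj A"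
        using fg F by simp_all
      then show "NAt f x = NAt g x" using u by blast
    qed (use fg in simp_all)
    moreover have "Zero X F ?Z \<in> Hom X F ?Z" using F by simp
    ultimately show "\<exists>!f. f \<in> Hom X F ?Z" by blast
    have "f = g" if fg: "f \<in> Hom X ?Z F" "g \<in> Hom X ?Z F" for f g
    proof (rule trans_eqI)
      fix x assume "x \<in> Obj S"
      then have "NAt f x \<in> Hom A z (FOb F x)" "NAt g x \<in> Hom A z (FOb F x)" "FOb F x \<in> Obj A"
        using fg F by simp_all
      then show "NAt f x = NAt g x" using u by blast
    qed (use fg in simp_all)
    moreover have "Zero X ?Z F \<in> Hom X ?Z F" using F by simp
    ultimately show "\<exists>!f. f \<in> Hom X ?Z F" by blast
  qed
  then have "is_zero_object X ?Z" unfolding is_zero_object_def by (simp del: mem_Hom)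
  then show ?thesis by blast
qed

text \<open>The chosen biproducts of \<open>A\<close> become a functor through \<open>dsum\<close>,
  and their structure arrows are natural.\<close>

lemma fun_cat_biproducts:
  assumes F: "F \<in> functors S A" and G: "G \<in> functors S A"
  shows "\<exists>i j p q. is_biproduct X F G i j p q"
proof -
  note [simp] = functor_simps[OF F] functor_simps[OF G]
  let ?B = "\<lparr>FOb = (\<lambda>x\<in>Obj S. A.bip (FOb F x) (FOb G x)), FAr = (\<lambda>t\<in>Arr S. dsum A (FAr F t) (FAr G t))\<rparr>"
  have B: "?B \<in> functors S A"
    by (rule functorI) (simp_all add: A.dsum_ident A.dsum_comp)
  let ?i = "\<lparr>NDom = F, NCod = ?B, NAt = (\<lambda>x\<in>Obj S. in1 A (FOb F x) (FOb G x))\<rparr>"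
  let ?j = "\<lparr>NDom = G, NCod = ?B, NAt = (\<lambda>x\<in>Obj S. in2 A (FOb F x) (FOb G x))\<rparr>"
  let ?p = "\<lparr>NDom = ?B, NCod = F, NAt = (\<lambda>x\<in>Obj S. pr1 A (FOb F x) (FOb G x))\<rparr>"
  let ?q = "\<lparr>NDom = ?B, NCod = G, NAt = (\<lambda>x\<in>Obj S. pr2 A (FOb F x) (FOb G x))\<rparr>"
  have t: "?i \<in> nat_transes S A" "?j \<in> nat_transes S A" "?p \<in> nat_transes S A" "?q \<in> nat_transes S A"
    by (rule transI; use F G B in simp)+
  have "is_biproduct X F G ?i ?j ?p ?q"
    unfolding is_biproduct_def
  proof (intro bexI[of _ ?B] conjI)
    note [simp] = fun_cat_simps
    show "?p \<cdot>\<^bsub>X\<^esub> ?i = Ident X F" "?q \<cdot>\<^bsub>X\<^esub> ?j = Ident X G"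
      "?q \<cdot>\<^bsub>X\<^esub> ?i = Zero X F G" "?p \<cdot>\<^bsub>X\<^esub> ?j = Zero X G F"
      by (rule trans_eqI; use F G t trans_closed in simp)+
    have c: "?i \<cdot>\<^bsub>X\<^esub> ?p \<in> nat_transes S A" "?j \<cdot>\<^bsub>X\<^esub> ?q \<in> nat_transes S A"
      using t by (simp_all add: comp_trans)
    show "?i \<cdot>\<^bsub>X\<^esub> ?p \<boxplus>\<^bsub>X\<^esub> ?j \<cdot>\<^bsub>X\<^esub> ?q = Ident X ?B"
      by (rule trans_eqI) (use B c in \<open>simp_all add: add_trans Ident_trans\<close>)
  qed (use t B in \<open>simp_all add: fun_cat_simps\<close>)
  then show ?thesis by blast
qed

lemma abelian_fun_cat: "abelian_category X"
proof (intro abelian_category.intro abelian_category_axioms.intro)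
  show "preadditive_category X" by (rule preadditive_fun_cat)
  show "\<exists>z. is_zero_object X z" by (rule fun_cat_zero_object)
  show "\<exists>i j p q. is_biproduct X F G i j p q" if "F \<in> Obj X" "G \<in> Obj X" for F G
    using that fun_cat_biproducts by (simp add: fun_cat_simps)
  fix f assume "f \<in> Arr X"
  then have f: "f \<in> nat_transes S A" by (simp add: fun_cat_simps)
  show "\<exists>k. is_kernel X f k"
    using objectwise_kernel_exists[OF f] objectwise_kernel[OF f] by metis
  show "\<exists>q. is_cokernel X f q"
    using objectwise_cokernel_exists[OF f] objectwise_cokernel[OF f] by metis
next
  fix m assume m: "is_mono X m"
  then have mn: "m \<in> nat_transes S A" using X.mono_arr[OF m] by (simp add: fun_cat_simps)
  obtain q where q: "q \<in> nat_transes S A" "NDom q = NCod m"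
    "\<And>x. x \<in> Obj S \<Longrightarrow> is_cokernel A (NAt m x) (NAt q x)"
    using objectwise_cokernel_exists[OF mn] by blast
  \<comment> \<open>At each object \<open>m\<close> is mono, hence the kernel of its cokernel there;
    these local facts assemble to a kernel in \<open>X\<close>.\<close>
  have "is_kernel X q m"
    by (rule objectwise_kernel[OF q(1) mn q(2)[symmetric]])
      (rule A.mono_kernel_of_cokernel[OF objectwise_mono[OF m] q(3)])
  then show "\<exists>f. is_kernel X f m" by blast
next
  fix m assume m: "is_epi X m"
  then have mn: "m \<in> nat_transes S A" using X.epi_arr[OF m] by (simp add: fun_cat_simps)
  obtain q where q: "q \<in> nat_transes S A" "NCod q = NDom m"
    "\<And>x. x \<in> Obj S \<Longrightarrow> is_kernel A (NAt m x) (NAt q x)"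
    using objectwise_kernel_exists[OF mn] by blast
  have "is_cokernel X q m"
    by (rule objectwise_cokernel[OF q(1) mn q(2)[symmetric]])
      (rule A.epi_cokernel_of_kernel[OF objectwise_epi[OF m] q(3)])
  then show "\<exists>f. is_cokernel X f m" by blast
qed

sublocale X: abelian_category "fun_cat S A"
  by (rule abelian_fun_cat)

section \<open>Additivity and exactness of the constant diagram functor\<close>

lemma const_simps [simp]:
  "a \<in> Obj A \<Longrightarrow> const_ob S A a \<in> Obj X"
  "f \<in> Arr A \<Longrightarrow> const_ar S A f \<in> Arr X"
  "Dom X (const_ar S A f) = const_ob S A (Dom A f)"
  "Cod X (const_ar S A f) = const_ob S A (Cod A f)"
  by (simp_all add: fun_cat_simps const_ob_functor const_ar_trans const_ob_simps)

lemma const_ident [simp]: "a \<in> Obj A \<Longrightarrow> const_ar S A (Ident A a) = Ident X (const_ob S A a)"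
  by (rule trans_eqI) (simp_all add: const_ar_trans Ident_trans const_ob_functor fun_cat_simps const_ob_simps)

lemma const_comp:
  assumes "f \<in> Arr A" "g \<in> Arr A" "Dom A g = Cod A f"
  shows "const_ar S A (g \<cdot>\<^bsub>A\<^esub> f) = const_ar S A g \<cdot>\<^bsub>X\<^esub> const_ar S A f"
  by (rule trans_eqI) (use assms in \<open>simp_all add: const_ar_trans comp_trans fun_cat_simps const_ob_simps\<close>)

lemma const_add:
  assumes "f \<in> Arr A" "g \<in> Arr A" "Dom A g = Dom A f" "Cod A g = Cod A f"
  shows "const_ar S A (f \<boxplus>\<^bsub>A\<^esub> g) = const_ar S A f \<boxplus>\<^bsub>X\<^esub> const_ar S A g"
  by (rule trans_eqI) (use assms in \<open>simp_all add: const_ar_trans add_trans fun_cat_simps const_ob_simps\<close>)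

lemma const_zero [simp]:
  "a \<in> Obj A \<Longrightarrow> b \<in> Obj A \<Longrightarrow> const_ar S A (Zero A a b) = Zero X (const_ob S A a) (const_ob S A b)"
  by (rule trans_eqI) (simp_all add: const_ar_trans zero_trans const_ob_functor fun_cat_simps const_ob_simps)

text \<open>At every object the constant sequence is the given one, so both halves of exactness are
  objectwise.\<close>

lemma const_exact:
  assumes "short_exact A i p"
  shows "short_exact X (const_ar S A i) (const_ar S A p)"
proof -
  note E = A.short_exactD[OF assms]
  have "is_kernel X (const_ar S A p) (const_ar S A i)"
    by (rule objectwise_kernel) (simp_all add: E const_ar_trans const_ob_simps)
  moreover have "is_cokernel X (const_ar S A i) (const_ar S A p)"
    by (rule objectwise_cokernel) (simp_all add: E const_ar_trans const_ob_simps)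
  ultimately show ?thesis by (simp add: short_exact_def)
qed

lemma const_ext_mor:
  assumes "ext_mor A a b (i, p) (i', p')"
  shows "ext_mor X (const_ar S A a) (const_ar S A b)
    (const_ar S A i, const_ar S A p) (const_ar S A i', const_ar S A p')"
proof -
  obtain g where ex: "short_exact A i p" "short_exact A i' p'"
    and ab: "a \<in> Hom A (Dom A i) (Dom A i')" "b \<in> Hom A (Cod A p) (Cod A p')"
    and g: "g \<in> Hom A (Cod A i) (Cod A i')" "g \<cdot>\<^bsub>A\<^esub> i = i' \<cdot>\<^bsub>A\<^esub> a" "p' \<cdot>\<^bsub>A\<^esub> g = b \<cdot>\<^bsub>A\<^esub> p"
    using assms unfolding ext_mor_def prod.case by blast
  note [simp] = A.short_exactD(1-3)[OF ex(1)] A.short_exactD(1-3)[OF ex(2)]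
  have 1: "const_ar S A g \<cdot>\<^bsub>X\<^esub> const_ar S A i = const_ar S A i' \<cdot>\<^bsub>X\<^esub> const_ar S A a"
    using arg_cong[OF g(2), of "const_ar S A"] g(1) ab by (simp add: const_comp)
  have 2: "const_ar S A p' \<cdot>\<^bsub>X\<^esub> const_ar S A g = const_ar S A b \<cdot>\<^bsub>X\<^esub> const_ar S A p"
    using arg_cong[OF g(3), of "const_ar S A"] g(1) ab by (simp add: const_comp)
  show ?thesis unfolding ext_mor_def prod.case
    using const_exact[OF ex(1)] const_exact[OF ex(2)] 1 2 ab g(1)
    by (intro conjI bexI[of _ "const_ar S A g"]) simp_all
qed

end

section \<open>Colimits and the comparison map\<close>

locale cocomplete_diagrams = diagrams +
  assumes cocomplete: "cocomplete S A"
begin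

text \<open>Notation of the adjunction: \<open>L0\<close> and \<open>L1\<close> form the left
  adjoint, \<open>K0\<close> and \<open>K1\<close> the right adjoint, \<open>\<rho>\<close> is the
  unit, and \<open>K\<close> applies the right adjoint to both arrows of an extension.\<close>

abbreviation K0 where "K0 \<equiv> const_ob S A"
abbreviation K1 where "K1 \<equiv> const_ar S A"
abbreviation L0 where "L0 \<equiv> colim_ob S A"
abbreviation L1 where "L1 \<equiv> colim_ar S A"
abbreviation \<rho> where "\<rho> \<equiv> colim_in S A"
abbreviation K where "K \<equiv> map_prod K1 K1"

section \<open>Colimits as left adjoint to constant diagrams\<close>

lemma colim_is_colimit:
  assumes "F \<in> Obj X"
  shows "is_colimit S A F (L0 F) (\<rho> F)"
proof -
  have "\<exists>z. case z of (c, r) \<Rightarrow> is_colimit S A F c r"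
    using cocomplete assms unfolding cocomplete_def by (auto simp: fun_cat_simps)
  then have "case colim_cocone S A F of (c, r) \<Rightarrow> is_colimit S A F c r"
    unfolding colim_cocone_def by (rule someI_ex)
  then show ?thesis by (simp add: colim_ob_def colim_in_def case_prod_unfold)
qed

lemma colim_simps [simp]:
  assumes "F \<in> Obj X"
  shows "L0 F \<in> Obj A" "\<rho> F \<in> Arr X" "Dom X (\<rho> F) = F" "Cod X (\<rho> F) = K0 (L0 F)"
proof -
  have "L0 F \<in> Obj A" "\<rho> F \<in> Hom X F (K0 (L0 F))"
    using colim_is_colimit[OF assms] unfolding is_colimit_def by blast+
  then show "L0 F \<in> Obj A" "\<rho> F \<in> Arr X" "Dom X (\<rho> F) = F" "Cod X (\<rho> F) = K0 (L0 F)"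
    by simp_all
qed

lemma colim_universal:
  assumes "\<sigma> \<in> Arr X" "Dom X \<sigma> = F" "Cod X \<sigma> = K0 d" "d \<in> Obj A"
  shows "\<exists>!u. u \<in> Hom A (L0 F) d \<and> K1 u \<cdot>\<^bsub>X\<^esub> \<rho> F = \<sigma>"
proof -
  have F: "F \<in> Obj X" and s: "\<sigma> \<in> Hom X F (K0 d)" using assms by auto
  have "\<forall>d\<in>Obj A. \<forall>\<sigma>\<in>Hom X F (K0 d). \<exists>!u. u \<in> Hom A (L0 F) d \<and> K1 u \<cdot>\<^bsub>X\<^esub> \<rho> F = \<sigma>"
    using colim_is_colimit[OF F] unfolding is_colimit_def by blast
  then show ?thesis using s assms(4) by blast
qed

lemma transpose:
  assumes "\<sigma> \<in> Arr X" "Dom X \<sigma> = F" "Cod X \<sigma> = K0 d" "d \<in> Obj A"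
  obtains u where "u \<in> Arr A" "Dom A u = L0 F" "Cod A u = d" "K1 u \<cdot>\<^bsub>X\<^esub> \<rho> F = \<sigma>"
proof -
  obtain u where "u \<in> Hom A (L0 F) d" "K1 u \<cdot>\<^bsub>X\<^esub> \<rho> F = \<sigma>" using colim_universal[OF assms] by blast
  then show ?thesis by (intro that) simp_all
qed

text \<open>Arrows out of a colimit are compared by their transposes; this is how identities between
  colimit arrows are proved below.\<close>

lemma colim_eqI:
  assumes "u \<in> Arr A" "v \<in> Arr A" "Dom A u = L0 F" "Dom A v = L0 F" "Cod A u = Cod A v" "F \<in> Obj X"
    "K1 u \<cdot>\<^bsub>X\<^esub> \<rho> F = K1 v \<cdot>\<^bsub>X\<^esub> \<rho> F"
  shows "u = v"
proof -
  have "\<exists>!w. w \<in> Hom A (L0 F) (Cod A v) \<and> K1 w \<cdot>\<^bsub>X\<^esub> \<rho> F = K1 v \<cdot>\<^bsub>X\<^esub> \<rho> F"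
    by (rule colim_universal) (use assms in simp_all)
  moreover have "u \<in> Hom A (L0 F) (Cod A v)" "v \<in> Hom A (L0 F) (Cod A v)" using assms by simp_all
  ultimately show ?thesis using assms(7) by blast
qed

lemma colim_ar_simps [simp]:
  assumes "\<eta> \<in> Arr X"
  shows "L1 \<eta> \<in> Arr A" "Dom A (L1 \<eta>) = L0 (Dom X \<eta>)" "Cod A (L1 \<eta>) = L0 (Cod X \<eta>)"
    "K1 (L1 \<eta>) \<cdot>\<^bsub>X\<^esub> \<rho> (Dom X \<eta>) = \<rho> (Cod X \<eta>) \<cdot>\<^bsub>X\<^esub> \<eta>"
proof -
  have "\<exists>!u. u \<in> Hom A (L0 (Dom X \<eta>)) (L0 (Cod X \<eta>)) \<and>
    K1 u \<cdot>\<^bsub>X\<^esub> \<rho> (Dom X \<eta>) = \<rho> (Cod X \<eta>) \<cdot>\<^bsub>X\<^esub> \<eta>"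
    by (rule colim_universal) (use assms in simp_all)
  from theI'[OF this]
  have "L1 \<eta> \<in> Hom A (L0 (Dom X \<eta>)) (L0 (Cod X \<eta>)) \<and>
    K1 (L1 \<eta>) \<cdot>\<^bsub>X\<^esub> \<rho> (Dom X \<eta>) = \<rho> (Cod X \<eta>) \<cdot>\<^bsub>X\<^esub> \<eta>"
    unfolding colim_ar_def by (simp only: fun_cat_simps)
  then show "L1 \<eta> \<in> Arr A" "Dom A (L1 \<eta>) = L0 (Dom X \<eta>)" "Cod A (L1 \<eta>) = L0 (Cod X \<eta>)"
    "K1 (L1 \<eta>) \<cdot>\<^bsub>X\<^esub> \<rho> (Dom X \<eta>) = \<rho> (Cod X \<eta>) \<cdot>\<^bsub>X\<^esub> \<eta>" by simp_all
qed

text \<open>Naturality of the unit inside a longer, right-nested composite.\<close>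

lemma colim_ar_nat:
  assumes "\<eta> \<in> Arr X" "F = Dom X \<eta>" "u \<in> Arr X" "Cod X u = F"
  shows "K1 (L1 \<eta>) \<cdot>\<^bsub>X\<^esub> \<rho> F \<cdot>\<^bsub>X\<^esub> u = \<rho> (Cod X \<eta>) \<cdot>\<^bsub>X\<^esub> \<eta> \<cdot>\<^bsub>X\<^esub> u"
  using assms(1,3,4) unfolding assms(2) by (simp add: X.comp_reduce[OF colim_ar_simps(4)])

lemma colim_ident: "F \<in> Obj X \<Longrightarrow> L1 (Ident X F) = Ident A (L0 F)"
  by (rule colim_eqI[of _ _ F]) (use colim_ar_simps(4)[of "Ident X F"] in simp_all)

lemma colim_comp:
  assumes "\<eta> \<in> Arr X" "\<theta> \<in> Arr X" "Dom X \<theta> = Cod X \<eta>"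
  shows "L1 (\<theta> \<cdot>\<^bsub>X\<^esub> \<eta>) = L1 \<theta> \<cdot>\<^bsub>A\<^esub> L1 \<eta>"
  by (rule colim_eqI[of _ _ "Dom X \<eta>"])
    (use assms colim_ar_simps(4)[of "\<theta> \<cdot>\<^bsub>X\<^esub> \<eta>"] in \<open>simp_all add: const_comp colim_ar_nat\<close>)

lemma colim_add:
  assumes "\<eta> \<in> Arr X" "\<theta> \<in> Arr X" "Dom X \<theta> = Dom X \<eta>" "Cod X \<theta> = Cod X \<eta>"
  shows "L1 (\<eta> \<boxplus>\<^bsub>X\<^esub> \<theta>) = L1 \<eta> \<boxplus>\<^bsub>A\<^esub> L1 \<theta>"
  by (rule colim_eqI[of _ _ "Dom X \<eta>"])
    (use assms colim_ar_simps(4)[of "\<eta> \<boxplus>\<^bsub>X\<^esub> \<theta>"] colim_ar_simps(4)[of \<theta>] in \<open>simp_all add: const_add\<close>)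

lemma colim_functor_functors: "colim_functor S A \<in> functors X A"
proof -
  have 1: "colim_functor S A = \<lparr>FOb = (\<lambda>F\<in>Obj X. L0 F), FAr = (\<lambda>\<eta>\<in>Arr X. L1 \<eta>)\<rparr>"
    by (simp add: colim_functor_def fun_cat_simps)
  \<comment> \<open>The category \<open>X\<close> itself takes the role of the index category, which
    makes \<open>functorI\<close> available for functors from \<open>X\<close> to
    \<open>A\<close>.\<close>
  interpret D: diagrams X A by unfold_locales
  show ?thesis unfolding 1
    by (rule D.functorI) (simp_all add: colim_ident colim_comp)
qed

text \<open>A left adjoint preserves cokernels: test arrows in \<open>A\<close> are transposed to
  \<open>X\<close>, treated there with the cokernel \<open>p\<close>, and transposed back.\<close>

lemma colim_right_exact:
  assumes "is_cokernel X i p"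
  shows "is_cokernel A (L1 i) (L1 p)"
proof (rule A.is_cokernelI)
  note P = X.is_cokernelD[OF assms]
  note [simp] = P(1-3)
  have "L1 (Zero X F G) = Zero A (L0 F) (L0 G)" if "F \<in> Obj X" "G \<in> Obj X" for F G
    by (rule colim_eqI[of _ _ F]) (use that colim_ar_simps(4)[of "Zero X F G"] in simp_all)
  then show "L1 p \<cdot>\<^bsub>A\<^esub> L1 i = Zero A (Dom A (L1 i)) (Cod A (L1 p))"
    using P(4) by (simp add: colim_comp[symmetric])
  show "is_epi A (L1 p)"
    unfolding is_epi_def
  proof (intro conjI allI ballI impI)
    fix w u v assume u: "u \<in> Hom A (Cod A (L1 p)) w" and v: "v \<in> Hom A (Cod A (L1 p)) w"
      and eq: "u \<cdot>\<^bsub>A\<^esub> L1 p = v \<cdot>\<^bsub>A\<^esub> L1 p"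
    \<comment> \<open>Under transposition, precomposing with \<open>L1 p\<close> becomes
      precomposing with \<open>p\<close>.\<close>
    have "(K1 x \<cdot>\<^bsub>X\<^esub> \<rho> (Cod X p)) \<cdot>\<^bsub>X\<^esub> p = K1 (x \<cdot>\<^bsub>A\<^esub> L1 p) \<cdot>\<^bsub>X\<^esub> \<rho> (Dom X p)"
      if "x \<in> Hom A (Cod A (L1 p)) w" for x
      using that colim_ar_simps(4)[of p] by (simp add: const_comp del: P(3))
    with u v eq have "(K1 u \<cdot>\<^bsub>X\<^esub> \<rho> (Cod X p)) \<cdot>\<^bsub>X\<^esub> p = (K1 v \<cdot>\<^bsub>X\<^esub> \<rho> (Cod X p)) \<cdot>\<^bsub>X\<^esub> p"
      by (simp only:)
    then have "K1 u \<cdot>\<^bsub>X\<^esub> \<rho> (Cod X p) = K1 v \<cdot>\<^bsub>X\<^esub> \<rho> (Cod X p)"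
      using u v by - (rule X.is_epiD[OF X.cokernel_epi[OF assms]]; simp)
    then show "u = v" using u v by - (rule colim_eqI[of _ _ "Cod X p"]; simp)
  qed simp
  fix h assume h: "h \<in> Arr A" "Dom A h = Cod A (L1 i)" "h \<cdot>\<^bsub>A\<^esub> L1 i = Zero A (Dom A (L1 i)) (Cod A h)"
  have "(K1 h \<cdot>\<^bsub>X\<^esub> \<rho> (Cod X i)) \<cdot>\<^bsub>X\<^esub> i = K1 (h \<cdot>\<^bsub>A\<^esub> L1 i) \<cdot>\<^bsub>X\<^esub> \<rho> (Dom X i)"
    using h(1,2) by (simp add: const_comp)
  also have "\<dots> = Zero X (Dom X i) (K0 (Cod A h))" unfolding h(3) using h(1) by simp
  finally obtain v where v: "v \<in> Arr X" "Dom X v = Cod X p" "Cod X v = K0 (Cod A h)"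
    "v \<cdot>\<^bsub>X\<^esub> p = K1 h \<cdot>\<^bsub>X\<^esub> \<rho> (Cod X i)"
    using X.cokernel_desc[OF assms, of "K1 h \<cdot>\<^bsub>X\<^esub> \<rho> (Cod X i)"] h(1,2) by auto
  \<comment> \<open>The factorisation \<open>v\<close> found in \<open>X\<close> ends at a constant
    diagram, so it has a transpose in \<open>A\<close>.\<close>
  obtain u where u: "u \<in> Arr A" "Dom A u = L0 (Cod X p)" "Cod A u = Cod A h" "K1 u \<cdot>\<^bsub>X\<^esub> \<rho> (Cod X p) = v"
    by (rule transpose[OF v(1-3)]) (use h(1) in simp)
  have "u \<cdot>\<^bsub>A\<^esub> L1 p = h"
  proof (rule colim_eqI[of _ _ "Cod X i"])
    have "K1 (u \<cdot>\<^bsub>A\<^esub> L1 p) \<cdot>\<^bsub>X\<^esub> \<rho> (Dom X p) = (K1 u \<cdot>\<^bsub>X\<^esub> \<rho> (Cod X p)) \<cdot>\<^bsub>X\<^esub> p"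
      using u(1-3) colim_ar_simps(4)[of p] by (simp add: const_comp del: P(3))
    then show "K1 (u \<cdot>\<^bsub>A\<^esub> L1 p) \<cdot>\<^bsub>X\<^esub> \<rho> (Cod X i) = K1 h \<cdot>\<^bsub>X\<^esub> \<rho> (Cod X i)"
      unfolding u(4) v(4) P(3) .
  qed (use u(1-3) h(1,2) in simp_all)
  then show "\<exists>u\<in>Hom A (Cod A (L1 p)) (Cod A h). u \<cdot>\<^bsub>A\<^esub> L1 p = h"
    using u(1-3) by (intro bexI[of _ u]) simp_all
qed (simp_all add: X.is_cokernelD(1-3)[OF assms])

section \<open>The comparison maps: additivity, naturality and bijectivity\<close>

lemma const_ext:
  assumes "e \<in> extensions A Y Z"
  shows "K e \<in> extensions X (K0 Y) (K0 Z)"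
  using assms const_exact by (cases e) (simp add: extensions_def)

lemma const_mor: "ext_mor A a b e e' \<Longrightarrow> ext_mor X (K1 a) (K1 b) (K e) (K e')"
  by (cases e, cases e') (simp add: const_ext_mor)

text \<open>\<open>K\<close> turns maps of extensions into maps of extensions and identities into
  identities, so the union over representatives is a single class.\<close>

lemma ext_const_class:
  assumes e: "e \<in> extensions A Y Z"
  shows "ext_const S A (ext_class A e) = ext_class X (K e)"
proof -
  note [simp] = A.ext_obj[OF e]
  have "ext_class X (K e') = ext_class X (K e)" if "e' \<in> ext_class A e" for e'
  proof -
    have "ext_mor A (Ident A Z) (Ident A Y) e e'" using that A.ext_class_mem[OF e] by blast
    from const_mor[OF this] have "ext_mor X (Ident X (K0 Z)) (Ident X (K0 Y)) (K e) (K e')" by simp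
    then show ?thesis by (rule X.ext_class_eqI[symmetric]) simp_all
  qed
  then have "ext_const S A (ext_class A e) = (\<Union>_\<in>ext_class A e. ext_class X (K e))"
    unfolding ext_const_def by (intro SUP_cong refl) (auto split: prod.split)
  also have "\<dots> = ext_class X (K e)" using A.ext_class_self[OF e] by (simp only: UN_constant) auto
  finally show ?thesis .
qed

text \<open>The only access to \<open>Psi\<close> needed later: no actual pullback square has to be
  exhibited, just a map with outer arrows the identity and the unit.\<close>

lemma Psi_eq:
  assumes "e \<in> extensions A (L0 F) a" "ext_mor X (Ident X (K0 a)) (\<rho> F) \<phi> (K e)"
  shows "Psi S A F (ext_class A e) = ext_class X \<phi>"
  unfolding Psi_def ext_const_class[OF assms(1)]
  by (rule X.ext_pull_eq[OF assms(2)]) (use A.ext_obj[OF assms(1)] in simp)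

lemma Psi_exists:
  assumes e: "e \<in> extensions A (L0 F) a" and F: "F \<in> Obj X"
  obtains \<phi> where "ext_mor X (Ident X (K0 a)) (\<rho> F) \<phi> (K e)"
    "Psi S A F (ext_class A e) = ext_class X \<phi>" "\<phi> \<in> extensions X F (K0 a)"
proof -
  obtain \<phi> where p: "ext_mor X (Ident X (K0 a)) (\<rho> F) \<phi> (K e)"
    by (rule X.pull_exists[OF const_ext[OF e], of "\<rho> F"]) (use F in simp_all)
  show ?thesis
    using that[OF p Psi_eq[OF e p]] X.ext_mor_source[OF p] A.ext_obj[OF e] F by simp
qed

text \<open>The configuration \<open>z\<close>, \<open>e\<close>, \<open>e'\<close>,
  \<open>n\<close> that computes the Baer sum in \<open>A\<close> is sent by \<open>K\<close> and
  pullback along \<open>\<rho> F\<close> to a configuration of the same kind in \<open>X\<close>,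
  where it computes the Baer sum again.\<close>

lemma Psi_add:
  assumes e: "e \<in> extensions A (L0 F) a" and e': "e' \<in> extensions A (L0 F) a" and F: "F \<in> Obj X"
  shows "Psi S A F (baer_sum A (L0 F) a (ext_class A e) (ext_class A e')) =
    baer_sum X F (K0 a) (Psi S A F (ext_class A e)) (Psi S A F (ext_class A e'))"
proof -
  note [simp] = A.ext_obj[OF e] F
  obtain z f g n where f: "ext_mor A f (Ident A (L0 F)) z e" and g: "ext_mor A g (Ident A (L0 F)) z e'"
    and n: "ext_mor A (f \<boxplus>\<^bsub>A\<^esub> g) (Ident A (L0 F)) z n" and c: "Cod A f = a" "Cod A g = a"
    by (rule A.baer_sum_exists[OF e e'])
  have fg [simp]: "f \<in> Arr A" "g \<in> Arr A" using A.ext_morD(1) f g by blast+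
  have z: "z \<in> extensions A (L0 F) (Dom A f)" "z \<in> extensions A (L0 F) (Dom A g)"
    using A.ext_morD(3)[OF f] A.ext_morD(3)[OF g] by simp_all
  then have [simp]: "Dom A g = Dom A f" by (auto simp: extensions_def)
  have nX: "n \<in> extensions A (L0 F) a" using A.ext_morD(4)[OF n] c by simp
  obtain \<zeta> where \<zeta>: "ext_mor X (Ident X (K0 (Dom A f))) (\<rho> F) \<zeta> (K z)"
    using Psi_exists[OF z(1) F] by blast
  \<comment> \<open>Applied to each of the three maps out of \<open>z\<close>: the composite from
    \<open>\<zeta>\<close> through \<open>K z\<close> to \<open>K d\<close> lies over
    \<open>\<rho> F\<close>, so it factors through the pullback \<open>\<phi>\<close> of
    \<open>K d\<close>.\<close>
  have lift: "ext_mor X (K1 h) (Ident X F) \<zeta> \<phi>"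
    if h: "ext_mor A h (Ident A (L0 F)) z d" "Cod A h = a" "Dom A h = Dom A f"
      and \<phi>: "ext_mor X (Ident X (K0 a)) (\<rho> F) \<phi> (K d)" for h d \<phi>
  proof -
    have "ext_mor X (K1 h) (\<rho> F \<cdot>\<^bsub>X\<^esub> Ident X F) \<zeta> (K d)"
      using X.ext_mor_comp[OF \<zeta> const_mor[OF h(1)]] A.ext_morD(1)[OF h(1)] h(3) by simp
    from X.pull_factor[OF this \<phi>] show ?thesis by simp
  qed
  obtain \<phi> where p: "ext_mor X (Ident X (K0 a)) (\<rho> F) \<phi> (K e)"
    "Psi S A F (ext_class A e) = ext_class X \<phi>" using Psi_exists[OF e F] by blast
  obtain \<phi>' where p': "ext_mor X (Ident X (K0 a)) (\<rho> F) \<phi>' (K e')"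
    "Psi S A F (ext_class A e') = ext_class X \<phi>'" using Psi_exists[OF e' F] by blast
  obtain \<nu> where q: "ext_mor X (Ident X (K0 a)) (\<rho> F) \<nu> (K n)"
    "Psi S A F (ext_class A n) = ext_class X \<nu>" using Psi_exists[OF nX F] by blast
  have "ext_mor X (K1 f) (Ident X F) \<zeta> \<phi>" "ext_mor X (K1 g) (Ident X F) \<zeta> \<phi>'"
    "ext_mor X (K1 f \<boxplus>\<^bsub>X\<^esub> K1 g) (Ident X F) \<zeta> \<nu>"
    using lift[OF f _ _ p(1)] lift[OF g _ _ p'(1)] lift[OF n _ _ q(1)] c by (simp_all add: const_add)
  then have "baer_sum X F (K0 a) (ext_class X \<phi>) (ext_class X \<phi>') = ext_class X \<nu>"
    by (rule X.baer_sum_eq) (use c in simp_all)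
  moreover have "baer_sum A (L0 F) a (ext_class A e) (ext_class A e') = ext_class A n"
    by (rule A.baer_sum_eq[OF f g n]) (use c in simp_all)
  ultimately show ?thesis unfolding p(2) p'(2) using q(2) by simp
qed

text \<open>Both sides are the class of \<open>\<phi>2\<close>: it represents the image of the
  transformed extension \<open>e2\<close>, and it is reached from \<open>\<phi>\<close> by pulling
  back along \<open>\<eta>\<close> and pushing out along \<open>K1 f\<close>.\<close>

lemma Psi_natural:
  assumes e: "e \<in> extensions A (L0 (Cod X \<eta>)) (Dom A f)" and \<eta>: "\<eta> \<in> Arr X" and f: "f \<in> Arr A"
  shows "Psi S A (Dom X \<eta>) (ext_act A (L1 \<eta>) f (ext_class A e)) =
    ext_act X \<eta> (K1 f) (Psi S A (Cod X \<eta>) (ext_class A e))"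
proof -
  note [simp] = \<eta> f
  let ?F = "Dom X \<eta>" and ?G = "Cod X \<eta>" and ?a = "Dom A f" and ?b = "Cod A f"
  obtain e1 where e1: "ext_mor A (Ident A ?a) (L1 \<eta>) e1 e"
    by (rule A.pull_exists[OF e, of "L1 \<eta>"]) simp_all
  have e1X: "e1 \<in> extensions A (L0 ?F) ?a" using A.ext_morD(3)[OF e1] by simp
  obtain e2 where e2: "ext_mor A f (Ident A (L0 ?F)) e1 e2"
    by (rule A.push_exists[OF e1X, of f]) simp_all
  have e2X: "e2 \<in> extensions A (L0 ?F) ?b" using A.ext_morD(4)[OF e2] by simp
  obtain \<phi>1 where p1: "ext_mor X (Ident X (K0 ?a)) (\<rho> ?F) \<phi>1 (K e1)"
    using Psi_exists[OF e1X X.Dom_Obj[OF \<eta>]] by blast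
  obtain \<phi>2 where p2: "ext_mor X (Ident X (K0 ?b)) (\<rho> ?F) \<phi>2 (K e2)"
    "Psi S A ?F (ext_class A e2) = ext_class X \<phi>2"
    using Psi_exists[OF e2X X.Dom_Obj[OF \<eta>]] by blast
  obtain \<phi> where p: "ext_mor X (Ident X (K0 ?a)) (\<rho> ?G) \<phi> (K e)"
    "Psi S A ?G (ext_class A e) = ext_class X \<phi>"
    using Psi_exists[OF e X.Cod_Obj[OF \<eta>]] by blast
  \<comment> \<open>Naturality of the unit rewrites the right-hand arrow
    \<open>K1 (L1 \<eta>) \<cdot> \<rho> ?F\<close>, so that factoring through \<open>\<phi>\<close>
    leaves exactly \<open>\<eta>\<close>.\<close>
  have "ext_mor X (Ident X (K0 ?a)) (\<rho> ?G \<cdot>\<^bsub>X\<^esub> \<eta>) \<phi>1 (K e)"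
    using X.ext_mor_comp[OF p1 const_mor[OF e1]] by simp
  from X.pull_factor[OF this p(1)] have m1: "ext_mor X (Ident X (K0 ?a)) \<eta> \<phi>1 \<phi>" by simp
  have "ext_mor X (K1 f) (\<rho> ?F \<cdot>\<^bsub>X\<^esub> Ident X ?F) \<phi>1 (K e2)"
    using X.ext_mor_comp[OF p1 const_mor[OF e2]] by simp
  from X.pull_factor[OF this p2(1)] have m2: "ext_mor X (K1 f) (Ident X ?F) \<phi>1 \<phi>2" by simp
  have "ext_act X \<eta> (K1 f) (ext_class X \<phi>) = ext_class X \<phi>2"
    unfolding ext_act_def X.ext_pull_eq[OF m1, simplified] X.ext_push_eq[OF m2, simplified] ..
  moreover have "ext_act A (L1 \<eta>) f (ext_class A e) = ext_class A e2"
    unfolding ext_act_def A.ext_pull_eq[OF e1, simplified] A.ext_push_eq[OF e2, simplified] ..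
  ultimately show ?thesis using p p2 by simp
qed

text \<open>Surjectivity is invoked for a single class: the one over \<open>Cod X p\<close> that
  arises by pushing the given sequence out to the constant diagram on the colimit of its
  subobject.\<close>

lemma colim_mono_if_surj:
  assumes ex: "short_exact X i p"
    and surj: "Psi S A (Cod X p) ` carrier (Ext1 A (L0 (Cod X p)) (L0 (Dom X i))) =
      carrier (Ext1 X (Cod X p) (K0 (L0 (Dom X i))))"
  shows "is_mono A (L1 i)"
proof -
  let ?F = "Dom X i" and ?G = "Cod X p" and ?a = "L0 (Dom X i)"
  note E = X.short_exactD[OF ex]
  note [simp] = E(1-3)
  have ipX: "(i, p) \<in> extensions X ?G ?F" using ex by (simp add: extensions_def)
  obtain \<phi> where \<phi>: "ext_mor X (\<rho> ?F) (Ident X ?G) (i, p) \<phi>"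
    by (rule X.push_exists[OF ipX, of "\<rho> ?F"]) simp_all
  have \<phi>X: "\<phi> \<in> extensions X ?G (K0 ?a)" using X.ext_morD(4)[OF \<phi>] by simp
  then have "ext_class X \<phi> \<in> Psi S A ?G ` ext_class A ` extensions A (L0 ?G) ?a"
    using surj unfolding X.Ext1_carrier A.Ext1_carrier by auto
  then obtain e where e: "e \<in> extensions A (L0 ?G) ?a" "ext_class X \<phi> = Psi S A ?G (ext_class A e)" by auto
  obtain \<phi>' where p': "ext_mor X (Ident X (K0 ?a)) (\<rho> ?G) \<phi>' (K e)"
    "Psi S A ?G (ext_class A e) = ext_class X \<phi>'" "\<phi>' \<in> extensions X ?G (K0 ?a)"
    using Psi_exists[OF e(1) X.Cod_Obj[OF E(2)]] by blast
  \<comment> \<open>Pushout, equivalence and pullback compose to one map from \<open>(i, p)\<close>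
    to \<open>K e\<close> whose outer arrows are both units.\<close>
  have "ext_mor X (Ident X (K0 ?a)) (Ident X ?G) \<phi> \<phi>'"
    by (rule X.ext_class_eqD[OF _ \<phi>X p'(3)]) (use e p' in simp)
  from X.ext_mor_comp[OF \<phi> X.ext_mor_comp[OF this p'(1)]]
  have m: "ext_mor X (\<rho> ?F) (\<rho> ?G) (i, p) (K e)" by simp
  obtain j r where jr: "e = (j, r)" by (cases e)
  note D = A.extensionsD[OF e(1)[unfolded jr]]
  note J = A.short_exactD[OF D(1)]
  note [simp] = D(2-6)
  obtain g where g: "g \<in> Hom X (Cod X i) (Cod X (K1 j))" "g \<cdot>\<^bsub>X\<^esub> i = K1 j \<cdot>\<^bsub>X\<^esub> \<rho> ?F"
    using m unfolding jr ext_mor_def by auto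
  then obtain u where u: "u \<in> Arr A" "Dom A u = L0 (Cod X i)" "Cod A u = Dom A r"
    "K1 u \<cdot>\<^bsub>X\<^esub> \<rho> (Cod X i) = g"
    by (auto intro: transpose[of g "Cod X i" "Dom A r"])
  \<comment> \<open>Transposed, this is the left square of that map.\<close>
  have uL: "u \<cdot>\<^bsub>A\<^esub> L1 i = j"
  proof (rule colim_eqI[of _ _ ?F])
    have "K1 (u \<cdot>\<^bsub>A\<^esub> L1 i) \<cdot>\<^bsub>X\<^esub> \<rho> ?F = (K1 u \<cdot>\<^bsub>X\<^esub> \<rho> (Cod X i)) \<cdot>\<^bsub>X\<^esub> i"
      using u(1-3) by (simp add: const_comp)
    then show "K1 (u \<cdot>\<^bsub>A\<^esub> L1 i) \<cdot>\<^bsub>X\<^esub> \<rho> ?F = K1 j \<cdot>\<^bsub>X\<^esub> \<rho> ?F" unfolding u(4) g(2) .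
  qed (use u(1-3) in simp_all)
  show ?thesis
  proof (rule A.is_monoI)
    fix h assume h: "h \<in> Arr A" "Cod A h = Dom A (L1 i)" "L1 i \<cdot>\<^bsub>A\<^esub> h = Zero A (Dom A h) (Cod A (L1 i))"
    have "j \<cdot>\<^bsub>A\<^esub> h = u \<cdot>\<^bsub>A\<^esub> L1 i \<cdot>\<^bsub>A\<^esub> h" using u(1,2) h(1,2) by (simp add: A.comp_reduce[OF uL])
    also have "\<dots> = Zero A (Dom A h) (Cod A j)" unfolding h(3) using u(1-3) h(1) by simp
    finally show "h = Zero A (Dom A h) (Dom A (L1 i))"
      using h(1,2) A.is_monoD_zero[OF J(7) h(1)] by simp
  qed simp
qed

text \<open>Right exactness and additivity come from the adjunction; surjectivity supplies the
  missing monomorphism, and a mono with its cokernel is short exact.\<close>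

lemma exact_if_surj:
  assumes "\<And>F a. F \<in> Obj X \<Longrightarrow> a \<in> Obj A \<Longrightarrow>
    Psi S A F ` carrier (Ext1 A (L0 F) a) = carrier (Ext1 X F (K0 a))"
  shows "exact_functor X A (colim_functor S A)"
proof -
  have FAr: "FAr (colim_functor S A) \<eta> = L1 \<eta>" if "\<eta> \<in> Arr X" for \<eta>
    using that by (simp add: colim_functor_def fun_cat_simps)
  have "short_exact A (L1 i) (L1 p)" if ex: "short_exact X i p" for i p
  proof -
    note E = X.short_exactD[OF ex]
    have "is_mono A (L1 i)" by (rule colim_mono_if_surj[OF ex]) (use E(1,2) assms in simp)
    then show ?thesis by (rule A.short_exactI_mono[OF colim_right_exact[OF E(6)]])
  qed
  then show ?thesis
    unfolding exact_functor_def
    using colim_functor_functors X.short_exactD(1,2) by (auto simp: FAr colim_add)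
qed

text \<open>The adjunction lifted to extensions: the middle arrow is transposed along with the outer
  two, and each square is checked after composing with the unit. Exactness of the colimit sequence
  enters here, as otherwise there is no extension to map from.\<close>

lemma ext_mor_transpose:
  assumes m: "ext_mor X a b (i, p) (K e)" and ex: "short_exact A (L1 i) (L1 p)"
    and e: "e \<in> extensions A Y Z"
    and a': "a' \<in> Arr A" "Dom A a' = L0 (Dom X i)" "Cod A a' = Z" "K1 a' \<cdot>\<^bsub>X\<^esub> \<rho> (Dom X i) = a"
    and b': "b' \<in> Arr A" "Dom A b' = L0 (Cod X p)" "Cod A b' = Y" "K1 b' \<cdot>\<^bsub>X\<^esub> \<rho> (Cod X p) = b"
  shows "ext_mor A a' b' (L1 i, L1 p) e"
proof -
  obtain j r where jr: "e = (j, r)" by (cases e)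
  note D = A.extensionsD[OF e[unfolded jr]]
  obtain g where exX: "short_exact X i p" and g: "g \<in> Hom X (Cod X i) (Cod X (K1 j))"
    "g \<cdot>\<^bsub>X\<^esub> i = K1 j \<cdot>\<^bsub>X\<^esub> a" "K1 r \<cdot>\<^bsub>X\<^esub> g = b \<cdot>\<^bsub>X\<^esub> p"
    using m unfolding jr ext_mor_def by auto
  note E = X.short_exactD[OF exX]
  note [simp] = E(1-3) D(2-6) a'(1-3) b'(1-3)
  have gs: "g \<in> Arr X" "Dom X g = Dom X p" "Cod X g = K0 (Dom A r)" using g(1) by simp_all
  obtain u where u [simp]: "u \<in> Arr A" "Dom A u = L0 (Dom X p)" "Cod A u = Dom A r"
    and uR: "K1 u \<cdot>\<^bsub>X\<^esub> \<rho> (Dom X p) = g"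
    by (rule transpose[OF gs]) simp
  have "u \<cdot>\<^bsub>A\<^esub> L1 i = j \<cdot>\<^bsub>A\<^esub> a'"
  proof (rule colim_eqI[of _ _ "Dom X i"])
    have "K1 (u \<cdot>\<^bsub>A\<^esub> L1 i) \<cdot>\<^bsub>X\<^esub> \<rho> (Dom X i) = (K1 u \<cdot>\<^bsub>X\<^esub> \<rho> (Dom X p)) \<cdot>\<^bsub>X\<^esub> i"
      by (simp add: const_comp)
    also have "\<dots> = K1 (j \<cdot>\<^bsub>A\<^esub> a') \<cdot>\<^bsub>X\<^esub> \<rho> (Dom X i)"
      unfolding uR g(2) a'(4)[symmetric] by (simp add: const_comp)
    finally show "K1 (u \<cdot>\<^bsub>A\<^esub> L1 i) \<cdot>\<^bsub>X\<^esub> \<rho> (Dom X i) = K1 (j \<cdot>\<^bsub>A\<^esub> a') \<cdot>\<^bsub>X\<^esub> \<rho> (Dom X i)" .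
  qed simp_all
  moreover have "r \<cdot>\<^bsub>A\<^esub> u = b' \<cdot>\<^bsub>A\<^esub> L1 p"
  proof (rule colim_eqI[of _ _ "Dom X p"])
    have "K1 (r \<cdot>\<^bsub>A\<^esub> u) \<cdot>\<^bsub>X\<^esub> \<rho> (Dom X p) = K1 r \<cdot>\<^bsub>X\<^esub> g"
      unfolding uR[symmetric] by (simp add: const_comp)
    also have "\<dots> = K1 (b' \<cdot>\<^bsub>A\<^esub> L1 p) \<cdot>\<^bsub>X\<^esub> \<rho> (Dom X p)"
      unfolding g(3) b'(4)[symmetric] by (simp add: const_comp)
    finally show "K1 (r \<cdot>\<^bsub>A\<^esub> u) \<cdot>\<^bsub>X\<^esub> \<rho> (Dom X p) = K1 (b' \<cdot>\<^bsub>A\<^esub> L1 p) \<cdot>\<^bsub>X\<^esub> \<rho> (Dom X p)" .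
  qed simp_all
  ultimately show ?thesis unfolding jr ext_mor_def prod.case
    using ex D(1) by (intro conjI bexI[of _ u]) simp_all
qed

text \<open>Both squares are naturality of the unit, whose component at the middle diagram is the
  middle arrow.\<close>

lemma colim_unit:
  assumes "short_exact X i p" "short_exact A (L1 i) (L1 p)"
  shows "ext_mor X (\<rho> (Dom X i)) (\<rho> (Cod X p)) (i, p) (K (L1 i, L1 p))"
proof -
  note E = X.short_exactD[OF assms(1)]
  note [simp] = E(1-3)
  show ?thesis unfolding ext_mor_def map_prod_simp prod.case
    using assms(1) const_exact[OF assms(2)] colim_ar_simps(4)[of i] colim_ar_simps(4)[of p]
    by (intro conjI bexI[of _ "\<rho> (Dom X p)"]) simp_all
qed

text \<open>The two halves read the same relation in opposite directions: \<open>e\<close> is the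
  pushout of the colimit of \<open>\<phi>\<close> along the counit exactly when
  \<open>\<phi>\<close> is the pullback of \<open>K e\<close> along the unit.\<close>

lemma Psi_bij_if_exact:
  assumes exact: "\<And>i p. short_exact X i p \<Longrightarrow> short_exact A (L1 i) (L1 p)"
    and F: "F \<in> Obj X" and a: "a \<in> Obj A"
  shows "bij_betw (Psi S A F) (carrier (Ext1 A (L0 F) a)) (carrier (Ext1 X F (K0 a)))"
  unfolding A.Ext1_carrier X.Ext1_carrier
proof (rule bij_betw_imageI)
  note [simp] = F a
  \<comment> \<open>The counit at \<open>a\<close>, obtained as transpose of the identity of
    \<open>K0 a\<close>; the equation \<open>cR\<close> is a triangle identity.\<close>
  obtain c where c [simp]: "c \<in> Arr A" "Dom A c = L0 (K0 a)" "Cod A c = a"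
    and cR: "K1 c \<cdot>\<^bsub>X\<^esub> \<rho> (K0 a) = Ident X (K0 a)"
    by (rule transpose[of "Ident X (K0 a)" "K0 a" a]) simp_all
  \<comment> \<open>Of the outer arrows, the identity of \<open>K0 a\<close> transposes to
    \<open>c\<close> and the unit \<open>\<rho> F\<close> to the identity.\<close>
  have down: "ext_mor A c (Ident A (L0 F)) (L1 i, L1 p) e"
    if "ext_mor X (Ident X (K0 a)) (\<rho> F) (i, p) (K e)" "e \<in> extensions A (L0 F) a"
      "(i, p) \<in> extensions X F (K0 a)" for i p e
    by (rule ext_mor_transpose[OF that(1) _ that(2)])
      (use X.extensionsD[OF that(3)] exact cR in simp_all)
  show "inj_on (Psi S A F) (ext_class A ` extensions A (L0 F) a)"
  proof (rule inj_onI, elim imageE, hypsubst)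
    fix e e' assume e: "e \<in> extensions A (L0 F) a" and e': "e' \<in> extensions A (L0 F) a"
      and eq: "Psi S A F (ext_class A e) = Psi S A F (ext_class A e')"
    obtain \<phi> where p: "ext_mor X (Ident X (K0 a)) (\<rho> F) \<phi> (K e)"
      "Psi S A F (ext_class A e) = ext_class X \<phi>" "\<phi> \<in> extensions X F (K0 a)"
      using Psi_exists[OF e F] by blast
    obtain \<phi>' where p': "ext_mor X (Ident X (K0 a)) (\<rho> F) \<phi>' (K e')"
      "Psi S A F (ext_class A e') = ext_class X \<phi>'" "\<phi>' \<in> extensions X F (K0 a)"
      using Psi_exists[OF e' F] by blast
    have "ext_mor X (Ident X (K0 a)) (Ident X F) \<phi> \<phi>'"
      by (rule X.ext_class_eqD[OF _ p(3) p'(3)]) (use eq p(2) p'(2) in simp)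
    \<comment> \<open>Now \<open>K e\<close> and \<open>K e'\<close> receive maps from the same
      \<open>\<phi>\<close>, so \<open>e\<close> and \<open>e'\<close> are pushouts of the same
      colimit sequence along \<open>c\<close>, hence equivalent.\<close>
    from X.ext_mor_comp[OF this p'(1)] have m': "ext_mor X (Ident X (K0 a)) (\<rho> F) \<phi> (K e')" by simp
    obtain i q where ip: "\<phi> = (i, q)" by (cases \<phi>)
    have "ext_mor A (Ident A a \<cdot>\<^bsub>A\<^esub> c) (Ident A (L0 F)) (L1 i, L1 q) e'"
      using down[OF m'[unfolded ip] e' p(3)[unfolded ip]] by simp
    from A.push_factor[OF this down[OF p(1)[unfolded ip] e p(3)[unfolded ip]]]
    have "ext_mor A (Ident A a) (Ident A (L0 F)) e e'" by simp
    then show "ext_class A e = ext_class A e'" by (rule A.ext_class_eqI) simp_all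
  qed
  show "Psi S A F ` ext_class A ` extensions A (L0 F) a = ext_class X ` extensions X F (K0 a)"
  proof (intro equalityI subsetI; elim imageE; hypsubst)
    fix e assume "e \<in> extensions A (L0 F) a"
    then show "Psi S A F (ext_class A e) \<in> ext_class X ` extensions X F (K0 a)"
      using Psi_exists[OF _ F] by (metis imageI)
  next
    fix \<phi> assume \<phi>: "\<phi> \<in> extensions X F (K0 a)"
    obtain i p where ip: "\<phi> = (i, p)" by (cases \<phi>)
    note D = X.extensionsD[OF \<phi>[unfolded ip]]
    have "(L1 i, L1 p) \<in> extensions A (L0 F) (L0 (K0 a))"
      using exact[OF D(1)] D by (simp add: extensions_def)
    then obtain e where e: "ext_mor A c (Ident A (L0 F)) (L1 i, L1 p) e"
      by (rule A.push_exists[of _ _ _ c]) simp_all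
    have eX: "e \<in> extensions A (L0 F) a" using A.ext_morD(4)[OF e] by simp
    \<comment> \<open>The unit of \<open>\<phi>\<close> followed by \<open>K\<close> of the pushout
      map; on the left the composite is the identity by \<open>cR\<close>.\<close>
    have "ext_mor X (Ident X (K0 a)) (\<rho> F) \<phi> (K e)"
      using X.ext_mor_comp[OF colim_unit[OF D(1) exact[OF D(1)]] const_mor[OF e]] D cR ip by simp
    then have "ext_class X \<phi> = Psi S A F (ext_class A e)" using Psi_eq[OF eX] by simp
    then show "ext_class X \<phi> \<in> Psi S A F ` ext_class A ` extensions A (L0 F) a" using eX by blast
  qed
qed

end

theorem theorem5:
  fixes S :: "('s, 't, 'm) cat_scheme"
    and A :: "('o, 'a, 'n) addcat_scheme"
  assumes "category S"
    and "abelian_category A"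
    and "cocomplete S A"
  shows
    "(exact_functor (fun_cat S A) A (colim_functor S A)
      \<longleftrightarrow>
      (\<forall>F\<in>functors S A. \<forall>a\<in>Obj A.
         bij_betw (Psi S A F)
           (carrier (Ext1 A (colim_ob S A F) a))
           (carrier (Ext1 (fun_cat S A) F (const_ob S A a)))))
     \<and>
     ((\<forall>F\<in>functors S A. \<forall>a\<in>Obj A.
         bij_betw (Psi S A F)
           (carrier (Ext1 A (colim_ob S A F) a))
           (carrier (Ext1 (fun_cat S A) F (const_ob S A a))))
      \<longleftrightarrow>
      natural_iso_of_bifunctors (fun_cat S A) A
        (\<lambda>F a. Ext1 A (colim_ob S A F) a)
        (\<lambda>\<eta> f. ext_act A (colim_ar S A \<eta>) f)
        (\<lambda>F a. Ext1 (fun_cat S A) F (const_ob S A a))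
        (\<lambda>\<eta> f. ext_act (fun_cat S A) \<eta> (const_ar S A f))
        (\<lambda>F a. Psi S A F))"
    (is "(?exact \<longleftrightarrow> ?bij) \<and> (_ \<longleftrightarrow> ?nat)")
proof -
  interpret S: category S by fact
  interpret A: abelian_category A by fact
  interpret cocomplete_diagrams S A by unfold_locales fact
  \<comment> \<open>The theorem quantifies over \<open>functors S A\<close>, the preceding lemmas
    over the objects of \<open>X\<close>.\<close>
  have ObjX: "functors S A = Obj X" by (simp add: fun_cat_simps)
  have "?bij" if ?exact
  proof (intro ballI)
    have FAr: "FAr (colim_functor S A) \<eta> = L1 \<eta>" if "\<eta> \<in> Arr X" for \<eta>
      using that by (simp add: colim_functor_def fun_cat_simps)
    have "short_exact A (L1 i) (L1 p)" if "short_exact X i p" for i p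
      using \<open>?exact\<close> that X.short_exactD(1,2)[OF that] unfolding exact_functor_def
      by (metis FAr)
    then show "bij_betw (Psi S A F) (carrier (Ext1 A (L0 F) a)) (carrier (Ext1 X F (K0 a)))"
      if "F \<in> functors S A" "a \<in> Obj A" for F a
      using Psi_bij_if_exact that unfolding ObjX by blast
  qed
  moreover have "?exact" if ?bij
    using that exact_if_surj unfolding ObjX by (simp add: bij_betw_def)
  moreover have "?nat" if ?bij
    unfolding natural_iso_of_bifunctors_def
  proof (intro conjI ballI)
    fix F a assume Fa: "F \<in> Obj X" "a \<in> Obj A"
    have bij: "bij_betw (Psi S A F) (carrier (Ext1 A (L0 F) a)) (carrier (Ext1 X F (K0 a)))"
      using that Fa unfolding ObjX by blast
    \<comment> \<open>A component of a natural isomorphism must respect the Baer sums; bijectivity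
      alone would only match underlying sets.\<close>
    have "Psi S A F \<in> hom (Ext1 A (L0 F) a) (Ext1 X F (K0 a))"
    proof (rule homI)
      show "Psi S A F x \<in> carrier (Ext1 X F (K0 a))" if "x \<in> carrier (Ext1 A (L0 F) a)" for x
        using bij that by (rule bij_betw_apply)
      fix x y assume "x \<in> carrier (Ext1 A (L0 F) a)" "y \<in> carrier (Ext1 A (L0 F) a)"
      then show "Psi S A F (x \<otimes>\<^bsub>Ext1 A (L0 F) a\<^esub> y) = Psi S A F x \<otimes>\<^bsub>Ext1 X F (K0 a)\<^esub> Psi S A F y"
        using Psi_add Fa unfolding A.Ext1_carrier by (auto simp: Ext1_def)
    qed
    then show "Psi S A F \<in> iso (Ext1 A (L0 F) a) (Ext1 X F (K0 a))"
      using bij by (simp add: iso_def)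
  next
    fix \<eta> f c assume "\<eta> \<in> Arr X" "f \<in> Arr A" "c \<in> carrier (Ext1 A (L0 (Cod X \<eta>)) (Dom A f))"
    then show "Psi S A (Dom X \<eta>) (ext_act A (L1 \<eta>) f c) =
        ext_act X \<eta> (K1 f) (Psi S A (Cod X \<eta>) c)"
      unfolding A.Ext1_carrier using Psi_natural by blast
  qed
  \<comment> \<open>Group isomorphisms are bijective on carriers by definition.\<close>
  moreover have "?bij" if ?nat
    using that unfolding natural_iso_of_bifunctors_def iso_def ObjX by blast
  ultimately show ?thesis by blast
qed

end
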